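(* Let $n\ge2$ and $f\in L^1(S^n_+)$. Put $\Phi(\theta,t)=(1-t^2)^{-1/2}(V_+f)(\theta,t)$ for $(\theta,t)\in S^{n-1}\times(-1,1)$ and $\Phi(\theta,t)=0$ for $|t|\ge1$. Then $\Phi=R\psi$ for a unique $\psi\in L^1(\mathbb{R}^n)$ supported in $B_n$ (denoted $\psi=R^{-1}\Phi$), and \[ f(x',x_{n+1})=x_{n+1}\,(R^{-1}\Phi)(x')\qquad\text{for almost every }x=(x',x_{n+1})\in S^n_+ . \]
   Context: Points of $\mathbb{R}^{n+1}$ are written $x=(x',x_{n+1})$, $x'\in\mathbb{R}^n$. $S^n$ is the unit sphere in $\mathbb{R}^{n+1}$, $S^n_+=\{x\in S^n:x_{n+1}\ge0\}$, $B_n$ the closed unit ball of $\mathbb{R}^n$, $S^{n-1}=\partial B_n$. For $\theta\in S^{n-1}$, $t\in(-1,1)$, let $\tau(\theta,t)=\{x\in S^n:x'\cdot\theta=t\}$ and $(V_+f)(\theta,t)=\int_{S^n_+\cap\tau(\theta,t)}f(x)\,d_\tau\sigma(x)$, with $d_\tau\sigma$ the induced surface measure on $\tau(\theta,t)$. The hyperplane Radon transform is $(R\psi)(\theta,t)=\int_{\{x'\cdot\theta=t\}}\psi(x')\,d_{\theta,t}x'$ ($\theta\in S^{n-1}$, $t\in\mathbb{R}$), with $d_{\theta,t}x'$ Lebesgue measure on the hyperplane. *)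

theory Defs
  imports "HOL-Analysis.Analysis"
begin

text \<open>Normalised k-dimensional Hausdorff measure on a metric space (agrees with
  k-dimensional Lebesgue measure on k-dimensional affine subspaces, and gives the
  usual surface measure on spheres).\<close>

definition hausdorff_const :: "real \<Rightarrow> real" where
  "hausdorff_const k = pi powr (k / 2) / (2 powr k * Gamma (k / 2 + 1))"

definition hausdorff_pre :: "real \<Rightarrow> real \<Rightarrow> 'a::metric_space set \<Rightarrow> ennreal" where
  "hausdorff_pre k \<delta> A =
     (INF C \<in> {C :: nat \<Rightarrow> 'a set. A \<subseteq> (\<Union>i. C i) \<and>
                 (\<forall>i. bounded (C i) \<and> diameter (C i) \<le> \<delta>)}.
        (\<Sum>i. ennreal (hausdorff_const k * diameter (C i) powr k)))"

definition hausdorff_outer :: "real \<Rightarrow> 'a::metric_space set \<Rightarrow> ennreal" where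
  "hausdorff_outer k A = (SUP \<delta> \<in> {0<..}. hausdorff_pre k \<delta> A)"

definition hausdorff_measure :: "real \<Rightarrow> 'a::metric_space measure" where
  "hausdorff_measure k = measure_of UNIV (sets borel) (hausdorff_outer k)"

text \<open>Points of R^(n+1) are pairs (x', x_{n+1}) with x' :: real^'n.\<close>

definition upper_hemisphere :: "((real^'n) \<times> real) set" where
  "upper_hemisphere = {x. norm x = 1 \<and> snd x \<ge> 0}"

definition tau_sec :: "real^'n \<Rightarrow> real \<Rightarrow> ((real^'n) \<times> real) set" where
  "tau_sec \<theta> t = {x. norm x = 1 \<and> fst x \<bullet> \<theta> = t}"

definition sigma_plus :: "((real^'n) \<times> real) measure" where
  "sigma_plus = restrict_space (hausdorff_measure (real CARD('n))) upper_hemisphere"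

definition V_plus :: "(((real^'n) \<times> real) \<Rightarrow> real) \<Rightarrow> real^'n \<Rightarrow> real \<Rightarrow> real" where
  "V_plus f \<theta> t =
     set_lebesgue_integral (hausdorff_measure (real CARD('n) - 1))
        (upper_hemisphere \<inter> tau_sec \<theta> t) f"

definition radon :: "(real^'n \<Rightarrow> real) \<Rightarrow> real^'n \<Rightarrow> real \<Rightarrow> real" where
  "radon \<psi> \<theta> t =
     set_lebesgue_integral (hausdorff_measure (real CARD('n) - 1)) {y. y \<bullet> \<theta> = t} \<psi>"

definition Phi_of :: "(((real^'n) \<times> real) \<Rightarrow> real) \<Rightarrow> real^'n \<Rightarrow> real \<Rightarrow> real" where
  "Phi_of f \<theta> t = (if \<bar>t\<bar> < 1 then (1 - t\<^sup>2) powr (-1/2) * V_plus f \<theta> t else 0)"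

definition sphere_line :: "((real^'n) \<times> real) measure" where
  "sphere_line = restrict_space (hausdorff_measure (real CARD('n) - 1)) (sphere 0 1) \<Otimes>\<^sub>M lborel"

definition is_inv_radon :: "(real^'n \<Rightarrow> real \<Rightarrow> real) \<Rightarrow> (real^'n \<Rightarrow> real) \<Rightarrow> bool" where
  "is_inv_radon \<Phi> \<psi> \<longleftrightarrow>
     integrable lborel \<psi> \<and> (\<forall>y. y \<notin> cball 0 1 \<longrightarrow> \<psi> y = 0) \<and>
     (AE p in sphere_line. \<Phi> (fst p) (snd p) = radon \<psi> (fst p) (snd p))"

end

theory Submission
  imports Defs
begin

text \<open>
  Over the hyperplane \<open>x' \<bullet> \<theta> = t\<close> the section of the hemisphere is the graph of
  \<open>h(x') = sqrt (1 - |x'|^2)\<close>, a half-sphere of radius \<open>\<rho> = sqrt (1 - t^2)\<close>. Its surface element is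
  \<open>\<rho> / h\<close> times the one of the hyperplane, so \<open>V_plus f\<close> is \<open>\<rho>\<close> times the Radon transform of
  \<open>\<psi>(x') = f(x', h(x')) / h(x')\<close>; the same computation for the whole hemisphere shows that \<open>\<psi>\<close> is
  integrable.

  The normalising constant of Hausdorff measure never matters: on a subspace the measure is translation
  invariant, hence a positive multiple of Lebesgue measure, and the area formula compares Hausdorff
  measure with Hausdorff measure, since the graph map is locally almost isometric to a linear stretching.

  For uniqueness, the slices determine the Laplace transform of a compactly supported \<open>\<psi>\<close>: the integral
  of \<open>\<psi>(y) exp (s \<theta> \<bullet> y)\<close> is the integral of \<open>exp (s t)\<close> against the Radon transform in direction
  \<open>\<theta>\<close>. Exponentials span an algebra that is dense by Stone-Weierstrass, so \<open>\<psi>\<close> is determined almost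
  everywhere.
\<close>

section \<open>Hausdorff measure as a Borel measure\<close>

text \<open>The hemisphere and its sections call for the same geometry, in dimensions n and n - 1:
  both are graphs over a ball in a linear subspace. Everything is therefore proved for an abstract
  pair of subspace and measure and applied to the full space and to each hyperplane through 0. To
  identify Hausdorff measure on a subspace up to a factor, finiteness and positivity on the unit
  ball suffice besides invariance; crude covering and packing bounds give them without the
  isodiametric inequality. The graph degenerates at the equator, where the density
  \<open>\<rho> / height\<close> blows up. The area formula is proved over the open ball, and the
  equator is discarded as a null set. The identity of Radon transforms holds for almost every pair
  of direction and offset, so a single direction may be exceptional. Good directions are dense, and
  the Laplace transform of an integrable function supported in the unit ball is continuous, so
  equality passes to all directions. Compact support also allows real exponentials, hence a real
  algebra, in place of Fourier analysis.\<close>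

lemma hausdorff_const_pos: "0 \<le> k \<Longrightarrow> 0 < hausdorff_const k"
  unfolding hausdorff_const_def by (intro divide_pos_pos mult_pos_pos Gamma_real_pos) auto

definition hcost :: "real \<Rightarrow> 'a::metric_space set \<Rightarrow> ennreal" where
  "hcost k C = ennreal (hausdorff_const k * diameter C powr k)"

definition hcovers :: "real \<Rightarrow> 'a::metric_space set \<Rightarrow> (nat \<Rightarrow> 'a set) set" where
  "hcovers \<delta> A = {C. A \<subseteq> (\<Union>i. C i) \<and> (\<forall>i. bounded (C i) \<and> diameter (C i) \<le> \<delta>)}"

lemma hausdorff_pre_alt: "hausdorff_pre k \<delta> A = (INF C \<in> hcovers \<delta> A. \<Sum>i. hcost k (C i))"
  unfolding hausdorff_pre_def hcovers_def hcost_def ..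

text \<open>Both \<open>diameter {}\<close> and \<open>0 powr k\<close> are 0, the latter even for
  \<open>k = 0\<close>. Hence finite covers may be padded with empty sets to sequences at no
  cost.\<close>

lemma hcost_empty [simp]: "hcost k {} = 0"
  by (simp add: hcost_def)

lemma hausdorff_pre_le: "C \<in> hcovers \<delta> A \<Longrightarrow> hausdorff_pre k \<delta> A \<le> (\<Sum>i. hcost k (C i))"
  unfolding hausdorff_pre_alt by (rule INF_lower)

lemma hausdorff_pre_mono: "A \<subseteq> B \<Longrightarrow> hausdorff_pre k \<delta> A \<le> hausdorff_pre k \<delta> B"
  unfolding hausdorff_pre_alt hcovers_def by (rule INF_superset_mono) auto

lemma hausdorff_pre_antimono: "\<delta> \<le> \<delta>' \<Longrightarrow> hausdorff_pre k \<delta>' A \<le> hausdorff_pre k \<delta> A"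
  unfolding hausdorff_pre_alt hcovers_def by (rule INF_superset_mono) (auto intro: order_trans)

lemma hausdorff_pre_empty [simp]: "0 \<le> \<delta> \<Longrightarrow> hausdorff_pre k \<delta> {} = 0"
  using hausdorff_pre_le[of "\<lambda>_. {}" \<delta> "{}" k] by (simp add: hcovers_def)

text \<open>Near-optimal covers of the pieces, with errors \<open>e / 2^(i+1)\<close>, are merged
  into one sequence by \<open>prod_decode\<close>. Finiteness of the right-hand side makes the
  strict inequality behind near-optimality available.\<close>

lemma hausdorff_pre_UN:
  "hausdorff_pre k \<delta> (\<Union>i. A i) \<le> (\<Sum>i::nat. hausdorff_pre k \<delta> (A i))"
proof (rule ennreal_le_epsilon)
  fix e :: real
  assume fin: "(\<Sum>i. hausdorff_pre k \<delta> (A i)) < top" and e: "0 < e"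
  have "\<exists>C\<in>hcovers \<delta> (A i). (\<Sum>j. hcost k (C j)) < hausdorff_pre k \<delta> (A i) + ennreal (e * (1/2)^Suc i)" for i
  proof -
    have "hausdorff_pre k \<delta> (A i) \<le> (\<Sum>i. hausdorff_pre k \<delta> (A i))"
      using sum_le_suminf[of "\<lambda>i. hausdorff_pre k \<delta> (A i)" "{i}"] by simp
    then have "hausdorff_pre k \<delta> (A i) < top" using fin by (rule le_less_trans)
    moreover have "0 < ennreal (e * (1/2)^Suc i)" using e by simp
    ultimately have "hausdorff_pre k \<delta> (A i) < hausdorff_pre k \<delta> (A i) + ennreal (e * (1/2)^Suc i)"
      by (metis add.right_neutral ennreal_add_left_cancel_less infinity_ennreal_def less_top_ennreal top.not_eq_extremum)
    then show ?thesis
      unfolding hausdorff_pre_alt INF_less_iff .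
  qed
  then obtain C where C: "\<And>i. C i \<in> hcovers \<delta> (A i)"
    "\<And>i. (\<Sum>j. hcost k (C i j)) < hausdorff_pre k \<delta> (A i) + ennreal (e * (1/2)^Suc i)"
    by metis
  define D where "D p = C (fst (prod_decode p)) (snd (prod_decode p))" for p
  have "D \<in> hcovers \<delta> (\<Union>i. A i)"
  proof -
    have "(\<Union>i. A i) \<subseteq> (\<Union>p. D p)"
    proof safe
      fix x i assume "x \<in> A i"
      then obtain j where "x \<in> C i j" using C(1)[of i] by (auto simp: hcovers_def)
      then have "x \<in> D (prod_encode (i, j))" by (simp add: D_def)
      then show "x \<in> (\<Union>p. D p)" by blast
    qed
    then show ?thesis using C(1) by (auto simp: hcovers_def D_def)
  qed
  then have "hausdorff_pre k \<delta> (\<Union>i. A i) \<le> (\<Sum>p. hcost k (D p))"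
    by (rule hausdorff_pre_le)
  also have "\<dots> = (\<Sum>i. \<Sum>j. hcost k (C i j))"
    unfolding D_def
    by (rule suminf_ennreal_2dimen[where f="\<lambda>q. hcost k (C (fst q) (snd q))"]) simp
  also have "\<dots> \<le> (\<Sum>i. hausdorff_pre k \<delta> (A i) + ennreal (e * (1/2)^Suc i))"
    by (intro suminf_le less_imp_le C(2)) auto
  also have "\<dots> = (\<Sum>i. hausdorff_pre k \<delta> (A i)) + (\<Sum>i. ennreal (e * (1/2)^Suc i))"
    by (rule suminf_add[symmetric]) auto
  also have "(\<Sum>i. ennreal (e * (1/2)^Suc i)) = ennreal e"
    using sums_mult[OF power_half_series, of e] e
    by (subst suminf_ennreal2) (auto simp: sums_iff)
  finally show "hausdorff_pre k \<delta> (\<Union>i. A i) \<le> (\<Sum>i. hausdorff_pre k \<delta> (A i)) + ennreal e" .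
qed

lemma hausdorff_pre_le_outer: "0 < \<delta> \<Longrightarrow> hausdorff_pre k \<delta> A \<le> hausdorff_outer k A"
  unfolding hausdorff_outer_def by (rule SUP_upper) simp

lemma hausdorff_outer_mono: "A \<subseteq> B \<Longrightarrow> hausdorff_outer k A \<le> hausdorff_outer k B"
  unfolding hausdorff_outer_def by (intro SUP_mono') (rule hausdorff_pre_mono)

lemma hausdorff_outer_empty [simp]: "hausdorff_outer k {} = 0"
proof -
  have "hausdorff_outer k {} \<le> (0::ennreal)"
    unfolding hausdorff_outer_def by (rule SUP_least) auto
  then show ?thesis by simp
qed

lemma hausdorff_outer_UN:
  "hausdorff_outer k (\<Union>i. A i) \<le> (\<Sum>i::nat. hausdorff_outer k (A i))"
proof -
  have "hausdorff_pre k \<delta> (\<Union>i. A i) \<le> (\<Sum>i. hausdorff_outer k (A i))" if "0 < \<delta>" for \<delta>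
    using hausdorff_pre_UN[of k \<delta> A] suminf_le[OF hausdorff_pre_le_outer[OF that]]
    by (rule order_trans) auto
  then show ?thesis
    unfolding hausdorff_outer_def[of k "\<Union>i. A i"] by (intro SUP_least) auto
qed

lemma hausdorff_outer_Un: "hausdorff_outer k (A \<union> B) \<le> hausdorff_outer k A + hausdorff_outer k B"
proof -
  let ?C = "\<lambda>i::nat. if i = 0 then A else if i = 1 then B else {}"
  have "A \<union> B = (\<Union>i. ?C i)" by (auto split: if_splits)
  then have "hausdorff_outer k (A \<union> B) \<le> (\<Sum>i. hausdorff_outer k (?C i))"
    using hausdorff_outer_UN[of k ?C] by simp
  also have "\<dots> = (\<Sum>i\<in>{0,1}. hausdorff_outer k (?C i))"
    by (rule suminf_finite) auto
  finally show ?thesis by simp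
qed

lemma outer_measure_space_hausdorff_outer: "outer_measure_space UNIV (hausdorff_outer k)"
  unfolding outer_measure_space_def positive_def increasing_def countably_subadditive_def
  by (auto intro: hausdorff_outer_mono hausdorff_outer_UN)

text \<open>This is Caratheodory's metric criterion. A covering set of diameter below
  \<open>e\<close> cannot meet both \<open>A\<close> and \<open>B\<close>, so a fine cover of the
  union splits into a cover of each.\<close>

lemma hausdorff_outer_metric:
  assumes "0 < e" and dist: "\<And>x y. x \<in> A \<Longrightarrow> y \<in> B \<Longrightarrow> e \<le> dist x y"
  shows "hausdorff_outer k A + hausdorff_outer k B \<le> hausdorff_outer k (A \<union> B)"
proof -
  \<comment> \<open>The two scales are kept independent because the sum of two suprema is rewritten
    as an iterated supremum.\<close>
  have *: "hausdorff_pre k \<delta>1 A + hausdorff_pre k \<delta>2 B \<le> hausdorff_outer k (A \<union> B)"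
    if "0 < \<delta>1" "0 < \<delta>2" for \<delta>1 \<delta>2
  proof -
    define \<delta> where "\<delta> = min (min \<delta>1 \<delta>2) (e/2)"
    have \<delta>: "0 < \<delta>" "\<delta> \<le> \<delta>1" "\<delta> \<le> \<delta>2" "\<delta> < e" using that \<open>0 < e\<close> by (auto simp: \<delta>_def)
    have "hausdorff_pre k \<delta> A + hausdorff_pre k \<delta> B \<le> (\<Sum>i. hcost k (C i))"
      if C: "C \<in> hcovers \<delta> (A \<union> B)" for C
    proof -
      define D where "D i = (if C i \<inter> A \<noteq> {} then C i else {})" for i
      define E where "E i = (if C i \<inter> A \<noteq> {} then {} else C i)" for i
      have "D \<in> hcovers \<delta> A" using C \<delta>(1) by (force simp: D_def hcovers_def)
      moreover have "E \<in> hcovers \<delta> B"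
      proof -
        have "C i \<inter> A = {}" if y: "y \<in> B" "y \<in> C i" for y i
        proof (rule ccontr)
          assume "C i \<inter> A \<noteq> {}"
          then obtain x where x: "x \<in> C i" "x \<in> A" by auto
          have "dist x y \<le> diameter (C i)"
            using C x y by (intro diameter_bounded_bound) (auto simp: hcovers_def)
          also have "\<dots> < e" using C \<delta> by (auto simp: hcovers_def intro: le_less_trans)
          finally show False using dist[OF x(2) y(1)] by simp
        qed
        then have "y \<in> (\<Union>i. E i)" if "y \<in> B" for y
          using C that unfolding hcovers_def E_def by (fastforce split: if_splits)
        moreover have "bounded (E i) \<and> diameter (E i) \<le> \<delta>" for i
          using C \<delta>(1) by (auto simp: E_def hcovers_def)
        ultimately show ?thesis by (auto simp: hcovers_def)
      qed
      ultimately have "hausdorff_pre k \<delta> A + hausdorff_pre k \<delta> B \<le> (\<Sum>i. hcost k (D i)) + (\<Sum>i. hcost k (E i))"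
        by (intro add_mono hausdorff_pre_le)
      also have "\<dots> = (\<Sum>i. hcost k (D i) + hcost k (E i))"
        by (rule suminf_add) auto
      also have "\<dots> = (\<Sum>i. hcost k (C i))"
        by (rule suminf_cong) (auto simp: D_def E_def)
      finally show ?thesis .
    qed
    then have "hausdorff_pre k \<delta> A + hausdorff_pre k \<delta> B \<le> hausdorff_pre k \<delta> (A \<union> B)"
      unfolding hausdorff_pre_alt[of k \<delta> "A \<union> B"] by (rule INF_greatest)
    also have "\<dots> \<le> hausdorff_outer k (A \<union> B)" using \<delta>(1) by (rule hausdorff_pre_le_outer)
    finally show ?thesis
      using add_mono[OF hausdorff_pre_antimono[OF \<delta>(2)] hausdorff_pre_antimono[OF \<delta>(3)]]
      by (rule order_trans[rotated])
  qed
  have "hausdorff_outer k A + hausdorff_outer k B =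
      (SUP \<delta>1\<in>{0<..}. SUP \<delta>2\<in>{0<..}. hausdorff_pre k \<delta>1 A + hausdorff_pre k \<delta>2 B)"
    unfolding hausdorff_outer_def
    by (subst ennreal_SUP_add_left[symmetric], simp, subst ennreal_SUP_add_right, simp, rule refl)
  also have "\<dots> \<le> hausdorff_outer k (A \<union> B)"
    by (intro SUP_least *) auto
  finally show ?thesis .
qed

text \<open>The metric criterion gives superadditivity over finitely many shells, since each
  \<open>R n\<close> keeps a positive distance from all earlier ones. The gap may shrink with
  \<open>n\<close>, because only partial sums are bounded.\<close>

lemma hausdorff_outer_shells:
  fixes R :: "nat \<Rightarrow> 'a::metric_space set"
  assumes sep: "\<And>n. \<exists>e>0. \<forall>j<n. \<forall>x\<in>R j. \<forall>y\<in>R n. e \<le> dist x y" and sub: "\<And>j. R j \<subseteq> A"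
  shows "(\<Sum>j. hausdorff_outer k (R j)) \<le> hausdorff_outer k A"
proof (rule suminf_le_const)
  fix n
  have "(\<Sum>j<n. hausdorff_outer k (R j)) \<le> hausdorff_outer k (\<Union>j<n. R j)"
  proof (induction n)
    case (Suc n)
    obtain e where e: "e > 0" "\<forall>j<n. \<forall>x\<in>R j. \<forall>y\<in>R n. e \<le> dist x y" using sep by metis
    have "(\<Sum>j<Suc n. hausdorff_outer k (R j)) \<le> hausdorff_outer k (\<Union>j<n. R j) + hausdorff_outer k (R n)"
      using Suc by (simp add: add_right_mono)
    also have "\<dots> \<le> hausdorff_outer k ((\<Union>j<n. R j) \<union> R n)"
      using e by (intro hausdorff_outer_metric[of e]) auto
    finally show ?case by (simp add: lessThan_Suc Un_commute)
  qed simp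
  also have "\<dots> \<le> hausdorff_outer k A" using sub by (intro hausdorff_outer_mono) auto
  finally show "(\<Sum>j<n. hausdorff_outer k (R j)) \<le> hausdorff_outer k A" .
qed auto

text \<open>The part of \<open>A\<close> outside the closed set \<open>F\<close> is cut into shells of
  points at distance about \<open>1/j\<close> from \<open>F\<close>; every other shell is at positive distance from the
  previous ones, so the measures of the shells are summable.\<close>

lemma hausdorff_outer_closed_split:
  fixes F :: "'a::metric_space set"
  assumes "closed F"
  shows "hausdorff_outer k (A \<inter> F) + hausdorff_outer k (A - F) \<le> hausdorff_outer k A"
proof (cases "F = {} \<or> hausdorff_outer k A = top")
  case True then show ?thesis by auto
next
  case False
  \<comment> \<open>The empty set is split off because \<open>infdist\<close> to it is 0 by
    convention. Finite measure of \<open>A\<close> makes the sums over the shells finite.\<close>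
  then have "F \<noteq> {}" and fin: "hausdorff_outer k A \<noteq> top" by auto
  let ?H = "hausdorff_outer k"
  define d where "d x = infdist x F" for x
  have d: "d x \<le> d y + dist x y" for x y unfolding d_def by (rule infdist_triangle)
  define r where "r j = 1 / (real j + 1)" for j :: nat
  have r: "r i \<le> r j" "0 < r i" if "j \<le> i" for i j using that by (auto simp: r_def field_simps)
  have r_strict: "r (Suc j) < r j" for j by (auto simp: r_def field_simps)
  define B where "B j = {x\<in>A. r j \<le> d x}" for j
  define R where "R j = {x\<in>A. r (Suc j) \<le> d x \<and> d x < r j}" for j
  \<comment> \<open>Between two shells of the same parity lies a whole shell. With
    \<open>n = m + 1\<close> the distance to \<open>F\<close> drops across it from at least
    \<open>r (2*m+p+1)\<close> to below \<open>r (2*m+p+2)\<close>, and \<open>d\<close> is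
    1-Lipschitz.\<close>
  have sep: "\<exists>e>0. \<forall>j<n. \<forall>x\<in>R (2*j+p). \<forall>y\<in>R (2*n+p). e \<le> dist x y" for p n
  proof (cases n)
    case (Suc m)
    let ?e = "r (2*m+p+1) - r (2*m+p+2)"
    have "?e \<le> dist x y" if "j < n" "x \<in> R (2*j+p)" "y \<in> R (2*n+p)" for j x y
    proof -
      have "r (2*m+p+1) \<le> r (Suc (2*j+p))" using that Suc by (intro r) auto
      also have "\<dots> \<le> d x" using that by (auto simp: R_def)
      finally have "r (2*m+p+1) \<le> d x" .
      moreover have "d y < r (2*m+p+2)" using that Suc by (auto simp: R_def)
      ultimately show ?thesis using d[of x y] by simp
    qed
    moreover have "0 < ?e" using r_strict[of "2*m+p+1"] by simp
    ultimately show ?thesis by blast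
  qed (auto intro: exI[of _ 1])
  have par: "(\<Sum>j. ?H (R (2*j+p))) \<le> ?H A" for p
    by (rule hausdorff_outer_shells[OF sep]) (auto simp: R_def)
  have "(\<Sum>j. ?H (R j)) \<le> ?H A + ?H A"
  proof (rule suminf_le_const)
    fix n
    have "(\<Sum>j<n. ?H (R j)) \<le> (\<Sum>j<2*n. ?H (R j))"
      by (rule sum_mono2) auto
    also have "\<dots> = (\<Sum>j<n. ?H (R (2*j+0))) + (\<Sum>j<n. ?H (R (2*j+1)))"
      by (induction n) (auto simp: algebra_simps)
    also have "\<dots> \<le> (\<Sum>j. ?H (R (2*j+0))) + (\<Sum>j. ?H (R (2*j+1)))"
      by (intro add_mono sum_le_suminf) auto
    also have "\<dots> \<le> ?H A + ?H A" by (intro add_mono par)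
    finally show "(\<Sum>j<n. ?H (R j)) \<le> ?H A + ?H A" .
  qed auto
  then have sfin: "(\<Sum>j. ?H (R j)) \<noteq> top"
    using fin by (metis ennreal_add_eq_top top.extremum_unique)
  \<comment> \<open>Finite total mass makes the tails vanish, so replacing \<open>A - F\<close> by
    \<open>B n\<close> costs an error tending to 0. The real-valued \<open>g\<close> gives access to
    summable series.\<close>
  have tail: "(\<lambda>n. \<Sum>j. ?H (R (j+n))) \<longlonglongrightarrow> 0"
  proof -
    have real: "?H (R j) = ennreal (enn2real (?H (R j)))" for j
    proof -
      have "?H (R j) \<le> ?H A" by (rule hausdorff_outer_mono) (auto simp: R_def)
      then have "?H (R j) \<noteq> top" using fin by (metis top.extremum_unique)
      then show ?thesis by (simp add: ennreal_enn2real_if)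
    qed
    define g where "g j = enn2real (?H (R j))" for j
    have Hg: "?H (R j) = ennreal (g j)" and g0: "0 \<le> g j" for j using real by (auto simp: g_def)
    have sg: "summable g"
      using sfin by (intro summable_suminf_not_top g0) (simp add: Hg)
    have "(\<lambda>n. \<Sum>j. g (j+n)) \<longlonglongrightarrow> 0"
      using suminf_exist_split2[OF sg] .
    then have "(\<lambda>n. ennreal (\<Sum>j. g (j+n))) \<longlonglongrightarrow> ennreal 0"
      by (rule tendsto_ennrealI)
    moreover have "ennreal (\<Sum>j. g (j+n)) = (\<Sum>j. ?H (R (j+n)))" for n
      unfolding Hg using sg g0 by (subst suminf_ennreal2) (auto intro: summable_ignore_initial_segment)
    ultimately show ?thesis by simp
  qed
  \<comment> \<open>A point off the closed set \<open>F\<close> has positive distance to it. If it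
    is not in \<open>B n\<close>, it lies in the shell just before the least \<open>m\<close> with
    \<open>r m \<le> d x\<close>.\<close>
  have AF: "A - F \<subseteq> B n \<union> (\<Union>j. R (j+n))" for n
  proof
    fix x assume x: "x \<in> A - F"
    have dx: "0 < d x"
      unfolding d_def using x \<open>closed F\<close> \<open>F \<noteq> {}\<close> by (simp add: infdist_pos_not_in_closed)
    show "x \<in> B n \<union> (\<Union>j. R (j+n))"
    proof (cases "r n \<le> d x")
      case False
      obtain N where "r N \<le> d x"
        using reals_Archimedean[OF dx] by (auto simp: r_def inverse_eq_divide field_simps intro: less_imp_le)
      define m where "m = (LEAST m. r m \<le> d x)"
      have m: "r m \<le> d x" unfolding m_def by (rule LeastI) fact
      have "n < m" using r(1)[of m n] m False by (metis not_le order_trans)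
      then obtain i where i: "m = Suc i" "n \<le> i" by (cases m) auto
      have "d x < r i" using not_less_Least[of i "\<lambda>m. r m \<le> d x"] i m_def by auto
      then have "x \<in> R ((i - n) + n)" using x m i by (auto simp: R_def)
      then show ?thesis by blast
    qed (use x in \<open>auto simp: B_def\<close>)
  qed
  have "?H (A \<inter> F) + ?H (A - F) \<le> ?H A + (\<Sum>j. ?H (R (j+n)))" for n
  proof -
    have "?H (A - F) \<le> ?H (B n) + (\<Sum>j. ?H (R (j+n)))"
    proof -
      have "?H (A - F) \<le> ?H (B n) + ?H (\<Union>j. R (j+n))"
        using hausdorff_outer_mono[OF AF] hausdorff_outer_Un by (rule order_trans)
      also have "\<dots> \<le> ?H (B n) + (\<Sum>j. ?H (R (j+n)))"
        by (intro add_left_mono hausdorff_outer_UN)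
      finally show ?thesis .
    qed
    then have "?H (A \<inter> F) + ?H (A - F) \<le> (?H (A \<inter> F) + ?H (B n)) + (\<Sum>j. ?H (R (j+n)))"
      by (simp add: add.assoc add_left_mono)
    also have "?H (A \<inter> F) + ?H (B n) \<le> ?H ((A \<inter> F) \<union> B n)"
    proof (rule hausdorff_outer_metric[of "r n"])
      fix x y assume "x \<in> A \<inter> F" "y \<in> B n"
      then show "r n \<le> dist x y" using infdist_le[of x F y] by (auto simp: B_def d_def dist_commute)
    qed (use r in auto)
    also have "?H ((A \<inter> F) \<union> B n) \<le> ?H A" by (rule hausdorff_outer_mono) (auto simp: B_def)
    finally show ?thesis by (simp add: add_right_mono)
  qed
  moreover have "(\<lambda>n. ?H A + (\<Sum>j. ?H (R (j+n)))) \<longlonglongrightarrow> ?H A + 0"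
    by (intro tendsto_add tendsto_const tail)
  ultimately show ?thesis by (intro LIMSEQ_le_const) auto
qed

text \<open>\<open>measure_of\<close> returns the zero measure unless the set function is a measure
  on the sigma-algebra, so this is what gives \<open>hausdorff_measure\<close> content.
  Caratheodory's lemma handles the system of sets that split all others additively; closed sets
  belong to it and generate the Borel sets.\<close>

lemma measure_space_hausdorff_outer:
  "measure_space UNIV (sets borel) (hausdorff_outer k :: 'a::metric_space set \<Rightarrow> ennreal)"
proof -
  let ?L = "lambda_system UNIV UNIV (hausdorff_outer k :: 'a set \<Rightarrow> ennreal)"
  interpret sigma_algebra UNIV "UNIV :: 'a set set"
    using sigma_algebra_Pow[of UNIV] by simp
  have ms: "measure_space UNIV ?L (hausdorff_outer k)"
    by (rule caratheodory_lemma[OF outer_measure_space_hausdorff_outer])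
  have "closed F \<Longrightarrow> F \<in> ?L" for F
    unfolding lambda_system_eq
    using hausdorff_outer_closed_split[of F k] hausdorff_outer_Un[of k "x \<inter> F" "x - F" for x]
    by (auto simp: Int_Diff_Un intro!: antisym)
  then have "sets borel \<subseteq> ?L"
    using ms sigma_algebra.sigma_sets_subset[of UNIV ?L "Collect closed"]
    unfolding borel_eq_closed measure_space_def by (simp add: subset_iff)
  then show ?thesis
    using ms sets.sigma_algebra_axioms[of "borel :: 'a measure"]
    by (auto simp: measure_space_def countably_additive_def positive_def subset_iff)
qed

lemma sets_hausdorff [measurable_cong, simp]: "sets (hausdorff_measure k) = sets borel"
  unfolding hausdorff_measure_def using sets.sigma_sets_eq[of borel] by simp

lemma space_hausdorff [simp]: "space (hausdorff_measure k) = UNIV"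
  unfolding hausdorff_measure_def by simp

lemma emeasure_hausdorff:
  "A \<in> sets borel \<Longrightarrow> emeasure (hausdorff_measure k) A = hausdorff_outer k A"
  using measure_space_hausdorff_outer[of k] unfolding hausdorff_measure_def measure_space_def
  by (subst emeasure_measure_of_sigma) auto

lemma hausdorff_outer_Lipschitz:
  fixes g :: "'a::metric_space \<Rightarrow> 'b::metric_space"
  assumes "0 < L" "0 \<le> k" and lip: "\<And>x y. x \<in> A \<Longrightarrow> y \<in> A \<Longrightarrow> dist (g x) (g y) \<le> L * dist x y"
  shows "hausdorff_outer k (g ` A) \<le> ennreal (L powr k) * hausdorff_outer k A"
proof -
  have "hausdorff_pre k \<delta> (g ` A) \<le> ennreal (L powr k) * hausdorff_outer k A" if "0 < \<delta>" for \<delta>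
  proof -
    have "hausdorff_pre k \<delta> (g ` A) \<le> ennreal (L powr k) * (\<Sum>i. hcost k (C i))"
      if C: "C \<in> hcovers (\<delta> / L) A" for C
    proof -
      \<comment> \<open>Cutting with \<open>A\<close> is needed because the Lipschitz bound holds
        only there.\<close>
      define D where "D i = g ` (C i \<inter> A)" for i
      have bC: "bounded (C i)" and dC: "diameter (C i) \<le> \<delta> / L" for i using C by (auto simp: hcovers_def)
      have le: "dist x y \<le> L * diameter (C i)" if xy: "x \<in> D i" "y \<in> D i" for x y i
      proof -
        obtain u v where uv: "x = g u" "y = g v" "u \<in> C i" "v \<in> C i" "u \<in> A" "v \<in> A"
          using xy by (auto simp: D_def)
        have "dist x y \<le> L * dist u v" using lip uv by auto
        also have "\<dots> \<le> L * diameter (C i)"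
          using diameter_bounded_bound[OF bC uv(3,4)] \<open>0 < L\<close> by (intro mult_left_mono) auto
        finally show ?thesis .
      qed
      have bD: "bounded (D i)" for i
        unfolding bounded_two_points using le by blast
      have dD: "diameter (D i) \<le> L * diameter (C i)" for i
      proof (cases "D i = {}")
        case True then show ?thesis using diameter_ge_0[OF bC[of i]] \<open>0 < L\<close> by simp
      next
        case False
        then have "diameter (D i) = (SUP (x,y)\<in>D i \<times> D i. dist x y)" by (simp add: diameter_def)
        also have "\<dots> \<le> L * diameter (C i)" using False le by (intro cSUP_least) auto
        finally show ?thesis .
      qed
      have "D \<in> hcovers \<delta> (g ` A)"
      proof -
        have "diameter (D i) \<le> \<delta>" for i
          using dD[of i] dC[of i] \<open>0 < L\<close> by (simp add: field_simps)
        moreover have "g ` A \<subseteq> (\<Union>i. D i)" using C by (fastforce simp: hcovers_def D_def)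
        ultimately show ?thesis using bD by (auto simp: hcovers_def)
      qed
      then have "hausdorff_pre k \<delta> (g ` A) \<le> (\<Sum>i. hcost k (D i))" by (rule hausdorff_pre_le)
      also have "\<dots> \<le> (\<Sum>i. ennreal (L powr k) * hcost k (C i))"
      proof (rule suminf_le)
        fix i
        have "diameter (D i) powr k \<le> (L * diameter (C i)) powr k"
          using dD \<open>0 \<le> k\<close> diameter_ge_0[OF bD] by (intro powr_mono2) auto
        also have "\<dots> = L powr k * diameter (C i) powr k"
          using \<open>0 < L\<close> diameter_ge_0[OF bC] by (simp add: powr_mult)
        finally have "hausdorff_const k * diameter (D i) powr k \<le> L powr k * (hausdorff_const k * diameter (C i) powr k)"
          using hausdorff_const_pos[OF \<open>0 \<le> k\<close>] by (simp add: algebra_simps)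
        then show "hcost k (D i) \<le> ennreal (L powr k) * hcost k (C i)"
          unfolding hcost_def by (subst ennreal_mult'[symmetric]) (auto intro: ennreal_leI)
      qed auto
      finally show ?thesis by simp
    qed
    note le = this
    \<comment> \<open>Multiplying by \<open>1 / c\<close> moves the constant to the left, where the
      infimum over covers can be taken; multiplying back is exact because \<open>c\<close> is a
      positive real.\<close>
    define c where "c = L powr k"
    have c: "0 < c" using \<open>0 < L\<close> by (simp add: c_def)
    then have one: "ennreal c * ennreal (1 / c) = 1" "ennreal (1 / c) * ennreal c = 1"
      by (simp_all flip: ennreal_mult')
    have "ennreal (1 / c) * hausdorff_pre k \<delta> (g ` A) \<le> hausdorff_pre k (\<delta> / L) A"
      unfolding hausdorff_pre_alt[of k "\<delta> / L"]
    proof (rule INF_greatest)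
      fix C assume "C \<in> hcovers (\<delta> / L) A"
      from mult_left_mono[OF le[OF this], of "ennreal (1 / c)"]
      show "ennreal (1 / c) * hausdorff_pre k \<delta> (g ` A) \<le> (\<Sum>i. hcost k (C i))"
        by (simp add: one flip: c_def mult.assoc)
    qed
    from mult_left_mono[OF this, of "ennreal c"]
    have "hausdorff_pre k \<delta> (g ` A) \<le> ennreal (L powr k) * hausdorff_pre k (\<delta> / L) A"
      by (simp add: one flip: c_def mult.assoc)
    also have "\<dots> \<le> ennreal (L powr k) * hausdorff_outer k A"
      using \<open>0 < L\<close> \<open>0 < \<delta>\<close> by (intro mult_left_mono hausdorff_pre_le_outer) auto
    finally show ?thesis .
  qed
  then show ?thesis unfolding hausdorff_outer_def[of k "g ` A"] by (intro SUP_least) auto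
qed

lemma hausdorff_outer_isometry:
  fixes g :: "'a::metric_space \<Rightarrow> 'b::metric_space"
  assumes "0 \<le> k" and iso: "\<And>x y. x \<in> A \<Longrightarrow> y \<in> A \<Longrightarrow> dist (g x) (g y) = dist x y"
  shows "hausdorff_outer k (g ` A) = hausdorff_outer k A"
proof (rule antisym)
  show "hausdorff_outer k (g ` A) \<le> hausdorff_outer k A"
    using hausdorff_outer_Lipschitz[of 1 k A g] assms by simp
  have inj: "inj_on g A" using iso by (intro inj_onI) (metis dist_eq_0_iff)
  have "hausdorff_outer k (inv_into A g ` g ` A) \<le> ennreal (1 powr k) * hausdorff_outer k (g ` A)"
    using assms inj by (intro hausdorff_outer_Lipschitz) auto
  then show "hausdorff_outer k A \<le> hausdorff_outer k (g ` A)" using inj by simp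
qed

section \<open>Hausdorff measure on flat subspaces\<close>

lemma UN_cball_of_nat: "(\<Union>n. cball 0 (real n)) = (UNIV :: 'a::real_normed_vector set)"
proof -
  have "x \<in> (\<Union>n. cball 0 (real n))" for x :: 'a
    using real_arch_simple[of "norm x"] by auto
  then show ?thesis by blast
qed

text \<open>This is the uniqueness argument for Haar measure: both sides equal the double integral
  of \<open>g x * h (y - x)\<close>, evaluated in the two orders. Symmetry of \<open>B\<close>
  absorbs the reflection that one of the substitutions produces. The cross-multiplied form avoids
  dividing by values that may be 0 or infinite.\<close>

lemma translation_invariant_proportional:
  fixes \<mu> \<nu> :: "'a::euclidean_space measure"
  assumes "sigma_finite_measure \<mu>" "sigma_finite_measure \<nu>"
    and sets [measurable_cong]: "sets \<mu> = sets borel" "sets \<nu> = sets borel"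
    and V: "subspace V" "AE x in \<mu>. x \<in> V" "AE x in \<nu>. x \<in> V"
    and inv_\<mu>: "\<And>v. v \<in> V \<Longrightarrow> distr \<mu> borel (\<lambda>x. x + v) = \<mu>"
    and inv_\<nu>: "\<And>v. v \<in> V \<Longrightarrow> distr \<nu> borel (\<lambda>x. x + v) = \<nu>"
    and AB [measurable]: "A \<in> sets borel" "B \<in> sets borel"
    and sym: "\<And>x. - x \<in> B \<longleftrightarrow> x \<in> B"
  shows "emeasure \<mu> A * emeasure \<nu> B = emeasure \<nu> A * emeasure \<mu> B"
proof -
  interpret \<mu>: sigma_finite_measure \<mu> by fact
  interpret \<nu>: sigma_finite_measure \<nu> by fact
  interpret pair_sigma_finite \<mu> \<nu> ..
  have shift_\<mu>: "(\<integral>\<^sup>+x. F (x + v) \<partial>\<mu>) = (\<integral>\<^sup>+x. F x \<partial>\<mu>)" if "v \<in> V" "F \<in> borel_measurable borel" for F v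
    using that by (subst (2) inv_\<mu>[OF that(1), symmetric]) (simp add: nn_integral_distr)
  have shift_\<nu>: "(\<integral>\<^sup>+x. F (x + v) \<partial>\<nu>) = (\<integral>\<^sup>+x. F x \<partial>\<nu>)" if "v \<in> V" "F \<in> borel_measurable borel" for F v
    using that by (subst (2) inv_\<nu>[OF that(1), symmetric]) (simp add: nn_integral_distr)
  define g :: "'a \<Rightarrow> ennreal" where "g = indicator A"
  define h :: "'a \<Rightarrow> ennreal" where "h = indicator B"
  have [measurable]: "g \<in> borel_measurable borel" "h \<in> borel_measurable borel"
    by (auto simp: g_def h_def)
  have h: "h (- x) = h x" for x using sym by (simp add: h_def indicator_def)
  have neg: "- v \<in> V" if "v \<in> V" for v using V(1) that by (rule subspace_neg)
  have "emeasure \<mu> A * emeasure \<nu> B = (\<integral>\<^sup>+x. g x * (\<integral>\<^sup>+y. h y \<partial>\<nu>) \<partial>\<mu>)"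
    by (simp add: g_def h_def nn_integral_multc sets)
  also have "\<dots> = (\<integral>\<^sup>+x. g x * (\<integral>\<^sup>+y. h (y - x) \<partial>\<nu>) \<partial>\<mu>)"
    using V(2) shift_\<nu>[of "- x" h for x, OF neg] by (intro nn_integral_cong_AE) auto
  also have "\<dots> = (\<integral>\<^sup>+x. \<integral>\<^sup>+y. g x * h (y - x) \<partial>\<nu> \<partial>\<mu>)"
    by (intro nn_integral_cong) (simp add: nn_integral_cmult)
  also have "\<dots> = (\<integral>\<^sup>+y. \<integral>\<^sup>+x. g x * h (y - x) \<partial>\<mu> \<partial>\<nu>)"
    by (rule Fubini'[symmetric]) simp
  also have "\<dots> = (\<integral>\<^sup>+y. \<integral>\<^sup>+x. g (x + y) * h x \<partial>\<mu> \<partial>\<nu>)"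
    using V(3) shift_\<mu>[of y "\<lambda>x. g x * h (y - x)" for y] by (intro nn_integral_cong_AE) (auto simp: h)
  also have "\<dots> = (\<integral>\<^sup>+x. \<integral>\<^sup>+y. g (x + y) * h x \<partial>\<nu> \<partial>\<mu>)"
    by (rule Fubini') simp
  also have "\<dots> = (\<integral>\<^sup>+x. (\<integral>\<^sup>+y. g (y + x) \<partial>\<nu>) * h x \<partial>\<mu>)"
    by (intro nn_integral_cong) (simp add: nn_integral_multc add.commute)
  also have "\<dots> = (\<integral>\<^sup>+x. (\<integral>\<^sup>+y. g y \<partial>\<nu>) * h x \<partial>\<mu>)"
    using V(2) shift_\<nu>[of x g for x] by (intro nn_integral_cong_AE) auto
  also have "\<dots> = emeasure \<nu> A * emeasure \<mu> B"
    by (simp add: g_def h_def nn_integral_cmult sets)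
  finally show ?thesis .
qed

text \<open>For a unit vector \<open>u\<close> this multiplies the component along \<open>u\<close>
  by \<open>s\<close> and fixes the orthogonal complement, so its determinant is \<open>s\<close>.
  Up to an isometry it is the differential of the graph map of a half-sphere.\<close>

definition stretch :: "real \<Rightarrow> 'a::euclidean_space \<Rightarrow> 'a \<Rightarrow> 'a" where
  "stretch s u v = v + ((s - 1) * (u \<bullet> v)) *\<^sub>R u"

lemma linear_stretch: "linear (stretch s u)"
  by (rule linearI) (simp_all add: stretch_def inner_add_right algebra_simps)

lemma borel_measurable_stretch [measurable]: "stretch s u \<in> borel_measurable borel"
  unfolding stretch_def by measurable

lemma stretch_stretch: "norm u = 1 \<Longrightarrow> s \<noteq> 0 \<Longrightarrow> stretch s u (stretch (1 / s) u v) = v"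
  by (simp add: stretch_def inner_add_right inner_diff_right dot_square_norm algebra_simps flip: scaleR_add_left)
     (simp add: field_simps)

lemma stretch_stretch': "norm u = 1 \<Longrightarrow> s \<noteq> 0 \<Longrightarrow> stretch (1 / s) u (stretch s u v) = v"
  using stretch_stretch[of u "1 / s" v] by simp

text \<open>The image of Lebesgue measure under \<open>f\<close> is translation invariant, hence
  proportional to it, and the unit ball, which \<open>f\<close> preserves, fixes the factor as
  1.\<close>

lemma emeasure_lborel_orthogonal:
  fixes A :: "'a::euclidean_space set" and f :: "'a \<Rightarrow> 'a"
  assumes f: "orthogonal_transformation f" and A: "A \<in> sets borel"
  shows "emeasure lborel (f -` A) = emeasure lborel A"
proof -
  have lin: "linear f" using f by (rule orthogonal_transformation_linear)
  have [measurable]: "f \<in> borel_measurable borel"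
    using lin by (intro borel_measurable_continuous_onI linear_continuous_on)
      (simp add: linear_conv_bounded_linear)
  let ?M = "distr lborel borel f"
  have ball: "f -` cball 0 r = cball 0 r" for r
    using f by (auto simp: orthogonal_transformation)
  have M: "emeasure ?M A = emeasure lborel (f -` A)" if "A \<in> sets borel" for A
    using that by (simp add: emeasure_distr)
  have "sigma_finite_measure ?M"
  proof
    show "\<exists>A. countable A \<and> A \<subseteq> sets ?M \<and> \<Union>A = space ?M \<and> (\<forall>a\<in>A. emeasure ?M a \<noteq> \<infinity>)"
      by (intro exI[of _ "range (\<lambda>n. cball 0 (real n))"])
         (auto simp: UN_cball_of_nat M ball emeasure_lborel_cball_finite[THEN less_imp_neq, simplified])
  qed
  moreover have "distr ?M borel (\<lambda>x. x + v) = ?M" for v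
  proof -
    have "surj f"
      by (rule linear_injective_imp_surjective[OF lin orthogonal_transformation_inj[OF f] refl])
    then obtain w where w: "f w = v" by (metis surjD)
    have "distr ?M borel (\<lambda>x. x + v) = distr lborel borel (\<lambda>x. f (w + x))"
      by (subst distr_distr) (auto simp: comp_def linear_add[OF lin] w add.commute)
    also have "\<dots> = distr (distr lborel borel ((+) w)) borel f"
      by (subst distr_distr) (auto simp: comp_def)
    finally show ?thesis by (simp add: lborel_distr_plus)
  qed
  moreover have "distr lborel borel (\<lambda>x. x + v) = lborel" for v :: 'a
    using lborel_distr_plus[of v] by (simp add: add.commute[of _ v])
  ultimately have "emeasure ?M A * emeasure lborel (cball 0 1 :: 'a set) = emeasure lborel A * emeasure ?M (cball 0 1)"
    using A by (intro translation_invariant_proportional[where V = UNIV])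
       (auto simp: sigma_finite_lborel)
  then have "emeasure lborel (cball 0 1 :: 'a set) * emeasure lborel (f -` A)
      = emeasure lborel (cball 0 1 :: 'a set) * emeasure lborel A"
    using A by (simp add: M ball mult.commute)
  moreover have "emeasure lborel (cball 0 1 :: 'a set) \<noteq> 0"
    by (simp add: emeasure_cball unit_ball_vol_pos[THEN less_imp_neq, symmetric] ennreal_eq_0_iff not_le)
  ultimately show ?thesis
    using emeasure_lborel_cball_finite[of "0::'a" 1] by (auto simp: ennreal_mult_cancel_left)
qed

lemma emeasure_lborel_stretch_Basis:
  fixes u :: "'a::euclidean_space"
  assumes u: "u \<in> Basis" and s: "0 < s" and A: "A \<in> sets borel"
  shows "emeasure lborel A = ennreal s * emeasure lborel (stretch s u -` A)"
proof -
  define c where "c j = (if j = u then s else 1)" for j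
  have "(\<Sum>j\<in>Basis. (c j * (x \<bullet> j)) *\<^sub>R j) = stretch s u x" for x
  proof (rule euclidean_eqI)
    fix i :: 'a assume "i \<in> Basis"
    then show "(\<Sum>j\<in>Basis. (c j * (x \<bullet> j)) *\<^sub>R j) \<bullet> i = stretch s u x \<bullet> i"
      using u inner_sum_left_Basis[of i "\<lambda>j. c j * (x \<bullet> j)"]
      by (auto simp: c_def stretch_def inner_add_left inner_Basis algebra_simps inner_commute)
  qed
  moreover have "(\<Prod>j\<in>Basis. \<bar>c j\<bar>) = s"
    using u s by (simp add: c_def if_distrib prod.delta cong: if_cong)
  ultimately have "lborel = density (distr lborel borel (\<lambda>x. 0 + stretch s u x)) (\<lambda>_. ennreal s)"
    using lborel_affine_euclidean[of c "0::'a"] s by (simp add: c_def)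
  then have "emeasure lborel A = emeasure (density (distr lborel borel (stretch s u)) (\<lambda>_. ennreal s)) A"
    by (simp add: fun_eq_iff)
  also have "\<dots> = ennreal s * emeasure lborel (stretch s u -` A)"
    using A by (simp add: emeasure_density_const emeasure_distr)
  finally show ?thesis .
qed

text \<open>Conjugating with an orthogonal map that takes a coordinate axis to \<open>u\<close>
  reduces to a diagonal map.\<close>

lemma emeasure_lborel_stretch:
  fixes u :: "real^'n"
  assumes u: "norm u = 1" and s: "0 < s" and A: "A \<in> sets borel"
  shows "emeasure lborel A = ennreal s * emeasure lborel (stretch s u -` A)"
proof -
  \<comment> \<open>Any index will do; it only provides a coordinate axis.\<close>
  fix k :: 'n
  let ?e = "axis k 1 :: real^'n"
  obtain f where f: "orthogonal_transformation f" "f ?e = u"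
    using orthogonal_transformation_exists_1[of ?e u] u by auto
  have lin: "linear f" using f(1) by (rule orthogonal_transformation_linear)
  have [measurable]: "f \<in> borel_measurable borel"
    using lin by (intro borel_measurable_continuous_onI linear_continuous_on)
      (simp add: linear_conv_bounded_linear)
  have "f ?e \<bullet> f v = ?e \<bullet> v" for v using f(1) by (simp add: orthogonal_transformation_def)
  then have comm: "stretch s u (f x) = f (stretch s ?e x)" for x
    using f(2) by (simp add: stretch_def linear_add[OF lin] linear_cmul[OF lin])
  have pre: "f -` A \<in> sets borel" "stretch s u -` A \<in> sets borel"
    using measurable_sets_borel[of f borel A] measurable_sets_borel[of "stretch s u" borel A] A by simp_all
  have "emeasure lborel (stretch s u -` A) = emeasure lborel (f -` (stretch s u -` A))"
    using emeasure_lborel_orthogonal[OF f(1) pre(2)] by simp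
  also have "f -` (stretch s u -` A) = stretch s ?e -` (f -` A)" by (auto simp: comm)
  finally show ?thesis
    using emeasure_lborel_stretch_Basis[OF _ s pre(1), of ?e] emeasure_lborel_orthogonal[OF f(1) A]
    by (simp add: axis_in_Basis_iff)
qed

lemma emeasure_lborel_scaleR:
  fixes A :: "'a::euclidean_space set"
  assumes r: "0 < r" and A: "A \<in> sets borel"
  shows "emeasure lborel A = ennreal (r ^ DIM('a)) * emeasure lborel ((*\<^sub>R) r -` A)"
proof -
  have "emeasure lborel A = emeasure (density (distr lborel borel (\<lambda>x::'a. 0 + r *\<^sub>R x)) (\<lambda>_. \<bar>r\<bar>^DIM('a))) A"
    using r by (subst lborel_affine[of r 0]) auto
  then show ?thesis using r A by (simp add: emeasure_density_const emeasure_distr)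
qed

text \<open>\<open>N\<close> plays the role of Lebesgue measure on the \<open>m\<close>-dimensional subspace \<open>V\<close>; it is
  defined on all Borel sets and concentrated on \<open>V\<close>, because a subspace need not be a type.\<close>

locale flat_measure =
  fixes V :: "'a::euclidean_space set" and m :: nat and N :: "'a measure"
  assumes V: "subspace V" and m: "0 < m"
    and sets_N [measurable_cong, simp]: "sets N = sets borel"
    and null: "emeasure N (- V) = 0"
    and translation: "\<And>v. v \<in> V \<Longrightarrow> distr N borel (\<lambda>x. x + v) = N"
    and scaling: "\<And>r. 0 < r \<Longrightarrow> emeasure N (cball 0 r) = ennreal (r ^ m) * emeasure N (cball 0 1)"
    and pos: "0 < emeasure N (cball 0 1)" and fin: "emeasure N (cball 0 1) < \<infinity>"
    and stretching: "\<And>u s A. u \<in> V \<Longrightarrow> norm u = 1 \<Longrightarrow> 0 < s \<Longrightarrow> A \<in> sets borel \<Longrightarrow>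
      emeasure N A = ennreal s * emeasure N (stretch s u -` A)"
begin

definition K where "K = enn2real (emeasure N (cball 0 1))"

lemma K: "emeasure N (cball 0 1) = ennreal K" "0 < K"
  using pos fin unfolding K_def by (auto simp: enn2real_positive_iff)

lemma V_borel [measurable]: "V \<in> sets borel"
  using closed_subspace[OF V] by (rule borel_closed)

lemma space_N [simp]: "space N = UNIV"
  using sets_eq_imp_space_eq[OF sets_N] by simp

lemma AE_V: "AE x in N. x \<in> V"
  using null by (intro AE_I[of _ _ "- V"]) auto

lemma emeasure_cball:
  assumes "x \<in> V" "0 \<le> r"
  shows "emeasure N (cball x r) = ennreal (K * r ^ m)"
proof -
  have *: "emeasure N (cball x r) = emeasure N (cball 0 r)" for r
  proof -
    have "emeasure N (cball x r) = emeasure (distr N borel (\<lambda>y. y + x)) (cball x r)"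
      using translation[OF assms(1)] by simp
    also have "\<dots> = emeasure N ((\<lambda>y. y + x) -` cball x r)"
      by (simp add: emeasure_distr)
    also have "(\<lambda>y. y + x) -` cball x r = cball 0 r" by (auto simp: dist_norm norm_minus_commute)
    finally show ?thesis .
  qed
  have **: "emeasure N (cball 0 r) = ennreal (K * r ^ m)" if "0 < r" for r
    using scaling[OF that] K that by (simp add: ennreal_mult mult.commute)
  show ?thesis
  proof (cases "r = 0")
    case True
    \<comment> \<open>The scaling law covers positive radii only. A point lies in arbitrarily small
      balls, so it has measure 0; this uses \<open>0 < m\<close>. Radius 0 does occur, for covering
      sets of diameter 0.\<close>
    have "emeasure N (cball x 0) \<le> ennreal (K * e ^ m)" if "0 < e" for e
      unfolding *[of 0] **[OF that, symmetric] using that by (intro emeasure_mono) auto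
    moreover have "((\<lambda>e. ennreal (K * e ^ m)) \<longlongrightarrow> ennreal (K * 0 ^ m)) (at_right 0)"
      by (intro tendsto_ennrealI tendsto_intros)
    ultimately have "emeasure N (cball x 0) \<le> ennreal (K * 0 ^ m)"
      by (intro tendsto_lowerbound[of _ _ "at_right 0"])
         (auto simp: eventually_at_filter trivial_limit_at_right_real)
    then show ?thesis using True m by (simp add: zero_power)
  qed (use * ** assms in auto)
qed

abbreviation H :: "'b::metric_space set \<Rightarrow> ennreal" where "H \<equiv> hausdorff_outer (real m)"

abbreviation hc where "hc \<equiv> hausdorff_const (real m)"

lemma hc: "0 < hc" by (rule hausdorff_const_pos) simp

text \<open>For diameter 0 the real power is 0 by convention, and the natural power is 0 because
  \<open>0 < m\<close>.\<close>

lemma hcost_real: "bounded C \<Longrightarrow> hcost (real m) C = ennreal (hc * diameter C ^ m)"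
  using m diameter_ge_0[of C] by (cases "diameter C = 0") (auto simp: hcost_def powr_realpow zero_power)

text \<open>The reason is that a set of diameter \<open>d\<close> lies in a ball of radius \<open>d\<close>.\<close>

lemma N_le_hausdorff:
  assumes [measurable]: "A \<in> sets borel"
  shows "emeasure N A \<le> ennreal (K / hc) * H (A \<inter> V)"
proof -
  have le: "emeasure N A \<le> ennreal (K / hc) * (\<Sum>i. hcost (real m) (C i))"
    if C: "C \<in> hcovers 1 (A \<inter> V)" for C
  proof -
    \<comment> \<open>Centres must lie on \<open>V\<close>, where the measure of balls is known.
      Taking the full diameter as radius loses a constant factor, which is harmless: the estimate
      only serves to tell null sets from others.\<close>
    define x where "x i = (SOME x. x \<in> C i \<inter> V)" for i
    define D where "D i = (if C i \<inter> V = {} then {} else cball (x i) (diameter (C i)))" for i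
    have bC: "bounded (C i)" for i using C by (auto simp: hcovers_def)
    have x: "x i \<in> C i \<inter> V" if "C i \<inter> V \<noteq> {}" for i using that some_in_eq unfolding x_def by blast
    have sub: "A \<inter> V \<subseteq> (\<Union>i. D i)"
    proof
      fix y assume y: "y \<in> A \<inter> V"
      then obtain i where i: "y \<in> C i" using C by (auto simp: hcovers_def)
      then have "C i \<inter> V \<noteq> {}" using y by auto
      then have "y \<in> D i"
        using diameter_bounded_bound[OF bC, of "x i" i y] x[of i] i by (auto simp: D_def)
      then show "y \<in> (\<Union>i. D i)" by blast
    qed
    have [measurable]: "D i \<in> sets borel" for i by (auto simp: D_def)
    have "emeasure N A = emeasure N (A \<inter> V)"
      using AE_V by (intro emeasure_eq_AE) auto
    also have "\<dots> \<le> emeasure N (\<Union>i. D i)" using sub by (intro emeasure_mono) auto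
    also have "\<dots> \<le> (\<Sum>i. emeasure N (D i))" by (rule emeasure_subadditive_countably) auto
    also have "\<dots> \<le> (\<Sum>i. ennreal (K / hc) * hcost (real m) (C i))"
    proof (rule suminf_le)
      fix i
      have "ennreal (K / hc) * hcost (real m) (C i) = ennreal (K * diameter (C i) ^ m)"
        using hc K unfolding hcost_real[OF bC] by (subst ennreal_mult'[symmetric]) auto
      then show "emeasure N (D i) \<le> ennreal (K / hc) * hcost (real m) (C i)"
        using x[of i] diameter_ge_0[OF bC] by (auto simp: D_def emeasure_cball)
    qed auto
    finally show ?thesis by simp
  qed
  define c where "c = K / hc"
  have c: "0 < c" using K hc by (simp add: c_def)
  then have one: "ennreal c * ennreal (1 / c) = 1" "ennreal (1 / c) * ennreal c = 1"
    by (simp_all flip: ennreal_mult')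
  have "ennreal (1 / c) * emeasure N A \<le> hausdorff_pre (real m) 1 (A \<inter> V)"
    unfolding hausdorff_pre_alt
  proof (rule INF_greatest)
    fix C assume "C \<in> hcovers 1 (A \<inter> V)"
    from mult_left_mono[OF le[OF this], of "ennreal (1 / c)"]
    show "ennreal (1 / c) * emeasure N A \<le> (\<Sum>i. hcost (real m) (C i))"
      by (simp add: one flip: c_def mult.assoc)
  qed
  also have "\<dots> \<le> H (A \<inter> V)" by (rule hausdorff_pre_le_outer) simp
  finally have "ennreal (1 / c) * emeasure N A \<le> H (A \<inter> V)" .
  from mult_left_mono[OF this, of "ennreal c"] show ?thesis
    by (simp add: one flip: c_def mult.assoc)
qed

text \<open>Balls of radius \<open>\<delta> / 2\<close> about the points are disjoint and lie in the
  ball of radius 2; comparing the volumes \<open>K * r ^ m\<close> gives the bound.\<close>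

lemma separated_card:
  assumes "0 < \<delta>" "\<delta> \<le> 1" "finite F" "F \<subseteq> cball 0 1 \<inter> V"
    and sep: "\<And>x y. x \<in> F \<Longrightarrow> y \<in> F \<Longrightarrow> x \<noteq> y \<Longrightarrow> \<delta> < dist x y"
  shows "real (card F) \<le> (4 / \<delta>) ^ m"
proof -
  have "ennreal (real (card F) * (K * (\<delta>/2)^m)) = (\<Sum>x\<in>F. emeasure N (cball x (\<delta>/2)))"
    using assms K by (subst sum.cong[OF refl emeasure_cball]) (auto simp: ennreal_mult ennreal_of_nat_eq_real_of_nat)
  also have "\<dots> = emeasure N (\<Union>x\<in>F. cball x (\<delta>/2))"
  proof (rule sum_emeasure)
    show "disjoint_family_on (\<lambda>x. cball x (\<delta>/2)) F"
      unfolding disjoint_family_on_def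
    proof (intro ballI impI)
      fix x y assume "x \<in> F" "y \<in> F" "x \<noteq> y"
      then have "\<delta> < dist x y" by (rule sep)
      then have "\<not> (dist x z \<le> \<delta>/2 \<and> dist y z \<le> \<delta>/2)" for z
        using dist_triangle2[of x y z] by linarith
      then show "cball x (\<delta>/2) \<inter> cball y (\<delta>/2) = {}" by auto
    qed
  qed (use assms in auto)
  also have "\<dots> \<le> emeasure N (cball 0 2)"
  proof (intro emeasure_mono UN_least subsetI)
    fix x y assume "x \<in> F" "y \<in> cball x (\<delta>/2)"
    then show "y \<in> cball 0 2"
      using assms(2,4) dist_triangle[of 0 y x] by fastforce
  qed auto
  also have "\<dots> = ennreal (K * 2 ^ m)"
    using emeasure_cball[of 0 2] subspace_0[OF V] by simp
  finally have "real (card F) * (K * (\<delta>/2)^m) \<le> K * 2 ^ m"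
    using K by (subst (asm) ennreal_le_iff) auto
  then have "real (card F) * (\<delta>/2)^m \<le> 2 ^ m" using K by (simp add: algebra_simps)
  then have "real (card F) \<le> 2 ^ m / (\<delta>/2)^m" using assms(1) by (simp add: pos_le_divide_eq)
  also have "\<dots> = (4 / \<delta>) ^ m" using assms(1) by (simp add: power_divide[symmetric])
  finally show ?thesis .
qed

text \<open>A maximal \<open>\<delta>\<close>-separated subset is also a
  \<open>\<delta>\<close>-net. So at most \<open>(4 / \<delta>) ^ m\<close> balls of diameter
  \<open>2 * \<delta>\<close> cover, and the powers of \<open>\<delta>\<close> cancel, leaving
  \<open>4 * 2 = 8\<close> to the power \<open>m\<close>.\<close>

lemma hausdorff_unit_ball_finite: "H (cball 0 1 \<inter> V) \<le> ennreal (hc * 8 ^ m)"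
proof -
  have *: "hausdorff_pre (real m) (2 * \<delta>) (cball 0 1 \<inter> V) \<le> ennreal (hc * 8 ^ m)"
    if \<delta>: "0 < \<delta>" "\<delta> \<le> 1" for \<delta>
  proof -
    define P where "P F \<longleftrightarrow> finite F \<and> F \<subseteq> cball 0 1 \<inter> V \<and> (\<forall>x\<in>F. \<forall>y\<in>F. x \<noteq> y \<longrightarrow> \<delta> < dist x y)" for F
    have "card F < Suc (nat \<lfloor>(4 / \<delta>) ^ m\<rfloor>)" if "P F" for F
      using separated_card[OF \<delta>, of F] that unfolding P_def by (auto simp: le_nat_floor less_Suc_eq_le)
    moreover have "P {}" by (simp add: P_def)
    ultimately have "\<exists>F. P F \<and> (\<forall>G. P G \<longrightarrow> card G \<le> card F)"
      by (intro ex_has_greatest_nat) auto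
    then obtain F where F: "P F" and max: "\<And>G. P G \<Longrightarrow> card G \<le> card F" by blast
    have finF: "finite F" using F by (simp add: P_def)
    have cover: "cball 0 1 \<inter> V \<subseteq> (\<Union>x\<in>F. cball x \<delta>)"
    proof (rule ccontr)
      assume "\<not> ?thesis"
      then obtain y where y: "y \<in> cball 0 1 \<inter> V" "\<And>x. x \<in> F \<Longrightarrow> \<delta> < dist x y" by fastforce
      then have "P (insert y F)" using F by (auto simp: P_def dist_commute)
      moreover have "y \<notin> F" using y(2)[of y] \<delta> by auto
      ultimately show False using max[of "insert y F"] finF by simp
    qed
    obtain xs where xs: "set xs = F" "distinct xs" using finite_distinct_list[OF finF] by auto
    define C where "C i = (if i < length xs then cball (xs ! i) \<delta> else {})" for i
    have "C \<in> hcovers (2 * \<delta>) (cball 0 1 \<inter> V)"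
    proof -
      have "(\<Union>x\<in>F. cball x \<delta>) \<subseteq> (\<Union>i. C i)"
        unfolding xs(1)[symmetric] by (auto simp: C_def in_set_conv_nth)
      then show ?thesis using cover \<delta> by (auto simp: hcovers_def C_def)
    qed
    then have "hausdorff_pre (real m) (2 * \<delta>) (cball 0 1 \<inter> V) \<le> (\<Sum>i. hcost (real m) (C i))"
      by (rule hausdorff_pre_le)
    also have "\<dots> = (\<Sum>i<length xs. hcost (real m) (C i))"
      by (rule suminf_finite) (auto simp: C_def)
    also have "\<dots> = (\<Sum>i<length xs. ennreal (hc * (2 * \<delta>) ^ m))"
      using \<delta> by (intro sum.cong) (auto simp: C_def hcost_real)
    also have "\<dots> = ennreal (real (card F) * (hc * (2 * \<delta>) ^ m))"
      using distinct_card[OF xs(2)] xs(1) hc \<delta> by (simp add: ennreal_mult ennreal_of_nat_eq_real_of_nat)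
    also have "\<dots> \<le> ennreal ((4 / \<delta>) ^ m * (hc * (2 * \<delta>) ^ m))"
      using separated_card[OF \<delta> finF] F hc \<delta> by (intro ennreal_leI mult_right_mono) (auto simp: P_def)
    also have "(4 / \<delta>) ^ m * (hc * (2 * \<delta>) ^ m) = hc * 8 ^ m"
    proof -
      have "(4 / \<delta>) * (2 * \<delta>) = 8" using \<delta> by simp
      then have "(4 / \<delta>) ^ m * (2 * \<delta>) ^ m = 8 ^ m" by (metis power_mult_distrib)
      then show ?thesis by (simp only: mult.left_commute)
    qed
    finally show ?thesis .
  qed
  show ?thesis unfolding hausdorff_outer_def
  proof (rule SUP_least)
    \<comment> \<open>The packing bound needs a scale of at most 1; refining the scale only
      increases \<open>hausdorff_pre\<close>, which settles larger \<open>d\<close>.\<close>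
    fix d :: real assume "d \<in> {0<..}"
    then show "hausdorff_pre (real m) d (cball 0 1 \<inter> V) \<le> ennreal (hc * 8 ^ m)"
      using order_trans[OF hausdorff_pre_antimono[of "2 * min (d/2) 1" d] *[of "min (d/2) 1"]] by simp
  qed
qed

lemma sigma_finite_N: "sigma_finite_measure N"
proof
  show "\<exists>A. countable A \<and> A \<subseteq> sets N \<and> \<Union>A = space N \<and> (\<forall>a\<in>A. emeasure N a \<noteq> \<infinity>)"
    using emeasure_cball[of 0] subspace_0[OF V]
    by (intro exI[of _ "range (\<lambda>n. cball 0 (real n))"]) (auto simp: UN_cball_of_nat)
qed

lemma hausdorff_translate: "H ((\<lambda>x. x + v) ` A) = H (A :: 'c::euclidean_space set)"
  by (rule hausdorff_outer_isometry) (auto simp: dist_norm)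

text \<open>The unit ball is the symmetric test set. Its Hausdorff measure is finite by the packing
  bound and nonzero by \<open>N_le_hausdorff\<close>; together these make \<open>c\<close> a
  positive real.\<close>

theorem hausdorff_proportional:
  "\<exists>c>0. \<forall>A\<in>sets borel. emeasure (hausdorff_measure m) (A \<inter> V) = ennreal c * emeasure N A"
proof -
  \<comment> \<open>Restriction by a density keeps a measure on all Borel sets of the ambient type,
    as the uniqueness lemma requires.\<close>
  define \<mu> where "\<mu> = density (hausdorff_measure m) (indicator V)"
  have sets_\<mu> [measurable_cong, simp]: "sets \<mu> = sets borel" by (simp add: \<mu>_def)
  have space_\<mu> [simp]: "space \<mu> = UNIV" by (simp add: \<mu>_def)
  have \<mu>: "emeasure \<mu> A = H (A \<inter> V)" if [measurable]: "A \<in> sets borel" for A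
    using that unfolding \<mu>_def
    by (simp add: emeasure_density emeasure_hausdorff Int_commute nn_integral_indicator flip: indicator_inter_arith)
  have fin_pos: "emeasure \<mu> (cball 0 r) < \<infinity>" if "0 < r" for r
  proof -
    have eq: "cball 0 r \<inter> V = (*\<^sub>R) r ` (cball 0 1 \<inter> V)"
    proof safe
      fix x assume "x \<in> V" "x \<in> cball 0 r"
      then have "x = r *\<^sub>R ((1 / r) *\<^sub>R x)" "(1 / r) *\<^sub>R x \<in> cball 0 1 \<inter> V"
        using that by (auto simp: field_simps intro: subspace_scale[OF V])
      then show "x \<in> (*\<^sub>R) r ` (cball 0 1 \<inter> V)" by blast
    qed (use that in \<open>auto intro: subspace_scale[OF V] simp: mult_le_cancel_left1\<close>)
    have "emeasure \<mu> (cball 0 r) \<le> ennreal (r powr m) * H (cball 0 1 \<inter> V)"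
      using that by (simp add: \<mu> eq, intro hausdorff_outer_Lipschitz) (auto simp: dist_norm simp flip: scaleR_diff_right)
    also have "\<dots> < \<infinity>" using hausdorff_unit_ball_finite by (auto simp: ennreal_mult_less_top intro: le_less_trans)
    finally show ?thesis .
  qed
  have fin_\<mu>: "emeasure \<mu> (cball 0 r) < \<infinity>" for r
    by (rule le_less_trans[OF emeasure_mono[of "cball 0 r" "cball 0 (max r 1)" \<mu>] fin_pos[of "max r 1"]]) auto
  have "sigma_finite_measure \<mu>"
  proof
    show "\<exists>A. countable A \<and> A \<subseteq> sets \<mu> \<and> \<Union>A = space \<mu> \<and> (\<forall>a\<in>A. emeasure \<mu> a \<noteq> \<infinity>)"
      using fin_\<mu>[THEN less_imp_neq]
      by (intro exI[of _ "range (\<lambda>n. cball 0 (real n))"]) (auto simp: UN_cball_of_nat)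
  qed
  moreover have "AE x in \<mu>. x \<in> V"
    by (intro AE_I[of _ _ "- V"]) (auto simp: \<mu>)
  moreover have "distr \<mu> borel (\<lambda>x. x + v) = \<mu>" if v: "v \<in> V" for v
  proof (rule measure_eqI)
    fix A assume "A \<in> sets (distr \<mu> borel (\<lambda>x. x + v))"
    then have [measurable]: "A \<in> sets borel" by simp
    have "x - v \<in> V" if "x \<in> V" for x using V v that by (simp add: subspace_diff)
    then have "A \<inter> V = (\<lambda>x. x + v) ` (((\<lambda>x. x + v) -` A) \<inter> V)"
      using subspace_add[OF V _ v] by (auto simp: image_iff intro!: bexI[of _ "x - v" for x])
    moreover have "(\<lambda>x. x + v) -` A \<in> sets borel"
      using measurable_sets_borel[of "\<lambda>x. x + v" borel A] by simp
    ultimately show "emeasure (distr \<mu> borel (\<lambda>x. x + v)) A = emeasure \<mu> A"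
      using hausdorff_translate[of v "((\<lambda>x. x + v) -` A) \<inter> V"] by (simp add: emeasure_distr \<mu>)
  qed simp
  ultimately have proportional: "emeasure \<mu> A * emeasure N (cball 0 1) = emeasure N A * emeasure \<mu> (cball 0 1)"
    if "A \<in> sets borel" for A
    using translation_invariant_proportional[OF _ sigma_finite_N, of \<mu> V A "cball 0 1"] V AE_V translation that by auto
  define c where "c = enn2real (emeasure \<mu> (cball 0 1)) / K"
  have c1: "emeasure \<mu> (cball 0 1) = ennreal (c * K)"
    using fin_\<mu>[of 1] K by (simp add: c_def)
  have "emeasure \<mu> (cball 0 1) \<noteq> 0"
    using N_le_hausdorff[of "cball 0 1"] K by (auto simp: \<mu>)
  then have "0 < c * K" using c1 by (simp add: ennreal_eq_0_iff not_le)
  then have "0 < c" using K(2) by (simp add: zero_less_mult_iff)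
  have "emeasure (hausdorff_measure m) (A \<inter> V) = ennreal c * emeasure N A" if A: "A \<in> sets borel" for A
  proof -
    have "ennreal K * emeasure \<mu> A = ennreal K * (ennreal c * emeasure N A)"
      using proportional[OF A] K \<open>0 < c\<close> unfolding c1 by (simp add: ennreal_mult ac_simps)
    then have "emeasure \<mu> A = ennreal c * emeasure N A"
      using K by (subst (asm) ennreal_mult_cancel_left) auto
    then show ?thesis using A by (simp add: \<mu> emeasure_hausdorff)
  qed
  then show ?thesis using \<open>0 < c\<close> by blast
qed

end

section \<open>Lebesgue measure on the whole space and on a hyperplane\<close>

lemma emeasure_lborel_ball_pos: "0 < r \<Longrightarrow> 0 < emeasure lborel (ball (c::'a::euclidean_space) r)"
  by (simp add: emeasure_ball zero_less_mult_iff)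

lemma flat_measure_lborel: "flat_measure UNIV CARD('n) (lborel :: (real^'n) measure)"
proof
  show "0 < emeasure lborel (cball (0::real^'n) 1)"
    using emeasure_lborel_ball_pos[of 1 "0::real^'n"] emeasure_mono[of "ball 0 1" "cball (0::real^'n) 1" lborel]
    by (auto intro: less_le_trans)
  show "distr lborel borel (\<lambda>x. x + v) = lborel" for v :: "real^'n"
    using lborel_distr_plus[of v] by (simp add: add.commute[of _ v])
  show "emeasure lborel (cball (0::real^'n) r) = ennreal (r ^ CARD('n)) * emeasure lborel (cball (0::real^'n) 1)"
    if "0 < r" for r
  proof -
    have "(*\<^sub>R) r -` cball 0 r = cball (0::real^'n) 1"
      using that by (auto simp: mult_le_cancel_left1)
    then show ?thesis using emeasure_lborel_scaleR[OF that, of "cball (0::real^'n) r"] by simp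
  qed
qed (auto simp: emeasure_lborel_cball_finite[simplified] emeasure_lborel_stretch)

definition slab :: "'a::euclidean_space \<Rightarrow> 'a set" where
  "slab \<theta> = {y. 0 \<le> y \<bullet> \<theta> \<and> y \<bullet> \<theta> \<le> 1}"

definition proj :: "'a::euclidean_space \<Rightarrow> 'a \<Rightarrow> 'a" where
  "proj \<theta> y = y - (y \<bullet> \<theta>) *\<^sub>R \<theta>"

text \<open>Lebesgue measure on the hyperplane orthogonal to the unit vector \<open>\<theta>\<close>: the measure of \<open>A\<close>
  is the volume of the cylinder of height 1 over \<open>A\<close>.\<close>

definition perp_measure :: "'a::euclidean_space \<Rightarrow> 'a measure" where
  "perp_measure \<theta> = distr (density lborel (indicator (slab \<theta>))) borel (proj \<theta>)"

lemma slab_borel [measurable]: "slab \<theta> \<in> sets borel"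
  unfolding slab_def by measurable

lemma borel_measurable_proj [measurable]: "proj \<theta> \<in> borel_measurable borel"
  unfolding proj_def by measurable

lemma sets_perp_measure [simp, measurable_cong]: "sets (perp_measure \<theta>) = sets borel"
  by (simp add: perp_measure_def)

lemma space_perp_measure [simp]: "space (perp_measure \<theta>) = UNIV"
  by (simp add: perp_measure_def)

lemma nn_integral_perp_measure:
  "f \<in> borel_measurable borel \<Longrightarrow>
    (\<integral>\<^sup>+z. f z \<partial>perp_measure \<theta>) = (\<integral>\<^sup>+y. indicator (slab \<theta>) y * f (proj \<theta> y) \<partial>lborel)"
  unfolding perp_measure_def by (simp add: nn_integral_distr nn_integral_density)

lemma emeasure_perp_measure:
  assumes [measurable]: "A \<in> sets borel"
  shows "emeasure (perp_measure \<theta>) A = emeasure lborel (proj \<theta> -` A \<inter> slab \<theta>)"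
proof -
  have [measurable]: "proj \<theta> -` A \<in> sets borel"
    using measurable_sets_borel[OF borel_measurable_proj assms] by simp
  have "emeasure (perp_measure \<theta>) A = (\<integral>\<^sup>+y. indicator (slab \<theta>) y * indicator A (proj \<theta> y) \<partial>lborel)"
    by (simp add: nn_integral_perp_measure flip: nn_integral_indicator)
  also have "\<dots> = (\<integral>\<^sup>+y. indicator (proj \<theta> -` A \<inter> slab \<theta>) y \<partial>lborel)"
    by (intro nn_integral_cong) (auto simp: indicator_def)
  finally show ?thesis by simp
qed

context
  fixes \<theta> :: "'a::euclidean_space"
  assumes unit: "norm \<theta> = 1"
begin

lemma inner_unit: "\<theta> \<bullet> \<theta> = 1"
  using unit by (simp add: dot_square_norm)

lemma proj_inner: "proj \<theta> y \<bullet> \<theta> = 0"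
  by (simp add: proj_def inner_diff_left inner_unit)

lemma norm_proj_le: "norm (proj \<theta> y) \<le> norm y"
proof -
  have "proj \<theta> y \<bullet> proj \<theta> y = y \<bullet> y - (y \<bullet> \<theta>)\<^sup>2"
    by (simp add: proj_def inner_diff_left inner_diff_right inner_unit inner_commute power2_eq_square)
  then show ?thesis by (simp add: norm_le)
qed

lemma proj_add: "proj \<theta> (x + y) = proj \<theta> x + proj \<theta> y"
  by (simp add: proj_def inner_add_left algebra_simps)

end

text \<open>The properties are inherited from Lebesgue measure through cylinders, because
  translations and stretchings along the hyperplane commute with them: they preserve
  \<open>slab\<close> and pass through \<open>proj\<close>. Dilations do not preserve the slab, and
  this is where one dimension is lost.\<close>

lemma flat_measure_perp:
  fixes \<theta> :: "real^'n"
  assumes unit: "norm \<theta> = 1" and n: "2 \<le> CARD('n)"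
  shows "flat_measure {y. y \<bullet> \<theta> = 0} (CARD('n) - 1) (perp_measure \<theta>)"
proof
  note inner = inner_unit[OF unit]
  show "subspace {y. y \<bullet> \<theta> = 0}" by (auto simp: subspace_def inner_add_left)
  show "0 < CARD('n) - 1" using n by simp
  show "emeasure (perp_measure \<theta>) (- {y. y \<bullet> \<theta> = 0}) = 0"
  proof -
    have "- {y. y \<bullet> \<theta> = 0} \<in> sets borel" by measurable
    then show ?thesis
      using proj_inner[OF unit] by (subst emeasure_perp_measure) (auto simp: vimage_def)
  qed
  show "distr (perp_measure \<theta>) borel (\<lambda>x. x + v) = perp_measure \<theta>" if v: "v \<in> {y. y \<bullet> \<theta> = 0}" for v
  proof (rule measure_eqI)
    fix A assume "A \<in> sets (distr (perp_measure \<theta>) borel (\<lambda>x. x + v))"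
    then have [measurable]: "A \<in> sets borel" by simp
    have [measurable]: "proj \<theta> -` A \<in> sets borel" "(\<lambda>x. x + v) -` A \<in> sets borel"
      using measurable_sets_borel[OF borel_measurable_proj, of A \<theta>]
        measurable_sets_borel[of "\<lambda>x. x + v" borel A] by simp_all
    have pv: "proj \<theta> v = v" using v by (simp add: proj_def)
    have "emeasure (distr (perp_measure \<theta>) borel (\<lambda>x. x + v)) A
        = emeasure lborel (proj \<theta> -` ((\<lambda>x. x + v) -` A) \<inter> slab \<theta>)"
      by (simp add: emeasure_distr emeasure_perp_measure)
    also have "proj \<theta> -` ((\<lambda>x. x + v) -` A) \<inter> slab \<theta> = (\<lambda>y. v + y) -` (proj \<theta> -` A \<inter> slab \<theta>)"
      using v by (auto simp: proj_add[OF unit] pv slab_def inner_add_left add.commute)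
    also have "emeasure lborel \<dots> = emeasure (distr lborel borel ((+) v)) (proj \<theta> -` A \<inter> slab \<theta>)"
      by (simp add: emeasure_distr)
    also have "\<dots> = emeasure (perp_measure \<theta>) A"
      by (simp add: lborel_distr_plus emeasure_perp_measure)
    finally show "emeasure (distr (perp_measure \<theta>) borel (\<lambda>x. x + v)) A = emeasure (perp_measure \<theta>) A" .
  qed simp
  have cyl [measurable]: "proj \<theta> -` cball 0 r \<in> sets borel" for r
    using measurable_sets_borel[OF borel_measurable_proj, of "cball 0 r" \<theta>] by simp
  show "emeasure (perp_measure \<theta>) (cball 0 r) = ennreal (r ^ (CARD('n) - 1)) * emeasure (perp_measure \<theta>) (cball 0 1)"
    if r: "0 < r" for r
  proof -
    \<comment> \<open>Dilating by \<open>r\<close> also changes the height of the cylinder.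
      Stretching by \<open>1 / r\<close> along \<open>\<theta>\<close> compensates for this and
      accounts for the exponent \<open>CARD('n) - 1\<close>.\<close>
    let ?C = "proj \<theta> -` cball 0 r \<inter> slab \<theta>"
    have [measurable]: "(*\<^sub>R) r -` ?C \<in> sets borel"
      using measurable_sets_borel[of "(*\<^sub>R) r" borel ?C] by simp
    have "emeasure lborel ?C = ennreal (r ^ CARD('n)) * emeasure lborel ((*\<^sub>R) r -` ?C)"
      using emeasure_lborel_scaleR[OF r, of ?C] by simp
    also have "emeasure lborel ((*\<^sub>R) r -` ?C)
        = ennreal (1 / r) * emeasure lborel (stretch (1 / r) \<theta> -` ((*\<^sub>R) r -` ?C))"
      using r by (intro emeasure_lborel_stretch unit) auto
    also have "stretch (1 / r) \<theta> -` ((*\<^sub>R) r -` ?C) = proj \<theta> -` cball 0 1 \<inter> slab \<theta>"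
    proof -
      have "stretch (1 / r) \<theta> y \<bullet> \<theta> = (1 / r) * (y \<bullet> \<theta>)" for y
        by (simp add: stretch_def inner_add_left inner inner_commute algebra_simps)
      then have "(r *\<^sub>R stretch (1 / r) \<theta> y) \<bullet> \<theta> = y \<bullet> \<theta>" for y
        using r by simp
      moreover have "proj \<theta> (r *\<^sub>R stretch (1 / r) \<theta> y) = r *\<^sub>R proj \<theta> y" for y
        by (simp add: stretch_def proj_def inner_add_left inner inner_commute algebra_simps)
      ultimately show ?thesis
        using r by (auto simp: slab_def mult_le_cancel_left1)
    qed
    also have "ennreal (r ^ CARD('n)) * (ennreal (1 / r) * emeasure lborel (proj \<theta> -` cball 0 1 \<inter> slab \<theta>))
        = ennreal (r ^ (CARD('n) - 1)) * emeasure lborel (proj \<theta> -` cball 0 1 \<inter> slab \<theta>)"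
    proof -
      have "r ^ CARD('n) * (1 / r) = r ^ (CARD('n) - 1)"
        using r n by (cases "CARD('n)") auto
      then show ?thesis using r by (simp add: mult.assoc[symmetric] flip: ennreal_mult')
    qed
    finally show ?thesis by (simp add: emeasure_perp_measure)
  qed
  show "0 < emeasure (perp_measure \<theta>) (cball 0 1)"
  proof -
    \<comment> \<open>The ball that has the segment from 0 to \<open>\<theta>\<close> as a diameter
      fits into the cylinder.\<close>
    have "ball ((1/2) *\<^sub>R \<theta>) (1/2) \<subseteq> proj \<theta> -` cball 0 1 \<inter> slab \<theta>"
    proof
      fix y assume y: "y \<in> ball ((1/2) *\<^sub>R \<theta>) (1/2)"
      then have d: "norm (y - (1/2) *\<^sub>R \<theta>) < 1/2" by (simp add: dist_norm norm_minus_commute)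
      have "norm y \<le> norm (y - (1/2) *\<^sub>R \<theta>) + norm ((1/2) *\<^sub>R \<theta>)" by norm
      then have "norm y \<le> 1" using d unit by simp
      moreover have "\<bar>(y - (1/2) *\<^sub>R \<theta>) \<bullet> \<theta>\<bar> \<le> norm (y - (1/2) *\<^sub>R \<theta>)"
        using Cauchy_Schwarz_ineq2[of "y - (1/2) *\<^sub>R \<theta>" \<theta>] unit by simp
      then have "\<bar>y \<bullet> \<theta> - 1/2\<bar> < 1/2" using d by (simp add: inner_diff_left inner)
      ultimately show "y \<in> proj \<theta> -` cball 0 1 \<inter> slab \<theta>"
        using norm_proj_le[OF unit, of y] by (auto simp: slab_def abs_if split: if_splits)
    qed
    then have "emeasure lborel (ball ((1/2) *\<^sub>R \<theta>) (1/2)) \<le> emeasure (perp_measure \<theta>) (cball 0 1)"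
      by (simp add: emeasure_perp_measure emeasure_mono)
    then show ?thesis
      using emeasure_lborel_ball_pos[of "1/2" "(1/2) *\<^sub>R \<theta>"] by (auto intro: less_le_trans)
  qed
  show "emeasure (perp_measure \<theta>) (cball 0 1) < \<infinity>"
  proof -
    have "proj \<theta> -` cball 0 1 \<inter> slab \<theta> \<subseteq> cball 0 2"
    proof
      fix y assume y: "y \<in> proj \<theta> -` cball 0 1 \<inter> slab \<theta>"
      have "norm y \<le> norm (proj \<theta> y) + norm ((y \<bullet> \<theta>) *\<^sub>R \<theta>)"
        using norm_triangle_ineq[of "proj \<theta> y" "(y \<bullet> \<theta>) *\<^sub>R \<theta>"] by (simp add: proj_def)
      then show "y \<in> cball 0 2" using y unit by (auto simp: slab_def)
    qed
    then have "emeasure (perp_measure \<theta>) (cball 0 1) \<le> emeasure lborel (cball (0::real^'n) 2)"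
      by (simp add: emeasure_perp_measure emeasure_mono)
    then show ?thesis using emeasure_lborel_cball_finite by (rule le_less_trans)
  qed
  show "emeasure (perp_measure \<theta>) A = ennreal s * emeasure (perp_measure \<theta>) (stretch s u -` A)"
    if u: "u \<in> {y. y \<bullet> \<theta> = 0}" and nu: "norm u = 1" and s: "0 < s" and A [measurable]: "A \<in> sets borel" for u s A
  proof -
    have [measurable]: "stretch s u -` A \<in> sets borel" "proj \<theta> -` A \<in> sets borel"
      using measurable_sets_borel[OF borel_measurable_stretch A] measurable_sets_borel[OF borel_measurable_proj A]
      by simp_all
    have 1: "stretch s u y \<bullet> \<theta> = y \<bullet> \<theta>" for y
      using u by (simp add: stretch_def inner_add_left)
    have 2: "proj \<theta> (stretch s u y) = stretch s u (proj \<theta> y)" for y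
      using u unfolding proj_def 1 by (simp add: stretch_def inner_diff_right)
    have "emeasure (perp_measure \<theta>) A = ennreal s * emeasure lborel (stretch s u -` (proj \<theta> -` A \<inter> slab \<theta>))"
      using emeasure_lborel_stretch[OF nu s, of "proj \<theta> -` A \<inter> slab \<theta>"] by (simp add: emeasure_perp_measure)
    also have "stretch s u -` (proj \<theta> -` A \<inter> slab \<theta>) = proj \<theta> -` (stretch s u -` A) \<inter> slab \<theta>"
      by (auto simp: 1 2 slab_def)
    finally show ?thesis by (simp add: emeasure_perp_measure)
  qed
qed simp

text \<open>Fubini for parallel slices. Writing out \<open>perp_measure\<close> produces a factor
  \<open>slab\<close>, and replacing \<open>proj \<theta> y\<close> by \<open>y\<close> is a shift
  of \<open>t\<close>. Exchanging the integrals and shifting \<open>y\<close> by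
  \<open>t *\<^sub>R \<theta>\<close> moves the dependence on \<open>t\<close> into the slab factor,
  whose integral over \<open>t\<close> is the height 1.\<close>

lemma lborel_slice:
  fixes \<theta> :: "'a::euclidean_space"
  assumes unit: "norm \<theta> = 1"
  shows "distr (perp_measure \<theta> \<Otimes>\<^sub>M lborel) borel (\<lambda>(z, t). z + t *\<^sub>R \<theta>) = lborel"
proof (rule measure_eqI)
  fix A assume "A \<in> sets (distr (perp_measure \<theta> \<Otimes>\<^sub>M lborel) borel (\<lambda>(z, t). z + t *\<^sub>R \<theta>))"
  then have [measurable]: "A \<in> sets borel" by simp
  interpret lborel_pair: pair_sigma_finite "lborel :: 'a measure" "lborel :: real measure" ..
  have unit_interval: "(\<integral>\<^sup>+t. indicator (slab \<theta>) (y - t *\<^sub>R \<theta>) \<partial>lborel) = 1" for y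
  proof -
    have "(\<integral>\<^sup>+t. indicator (slab \<theta>) (y - t *\<^sub>R \<theta>) \<partial>lborel) = (\<integral>\<^sup>+t. indicator {y \<bullet> \<theta> - 1 .. y \<bullet> \<theta>} t \<partial>lborel)"
      by (intro nn_integral_cong) (auto simp: indicator_def slab_def inner_diff_left inner_unit[OF unit])
    then show ?thesis by simp
  qed
  have shift: "(\<integral>\<^sup>+t. indicator A (proj \<theta> y + t *\<^sub>R \<theta>) \<partial>lborel) = (\<integral>\<^sup>+t. indicator A (y + t *\<^sub>R \<theta>) \<partial>lborel)" for y
  proof -
    have "(\<integral>\<^sup>+t. indicator A (proj \<theta> y + t *\<^sub>R \<theta>) \<partial>lborel)
        = (\<integral>\<^sup>+t. indicator A (proj \<theta> y + t *\<^sub>R \<theta>) \<partial>distr lborel borel ((+) (y \<bullet> \<theta>)))"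
      by (simp add: lborel_distr_plus)
    also have "\<dots> = (\<integral>\<^sup>+t. indicator A (y + t *\<^sub>R \<theta>) \<partial>lborel)"
      by (subst nn_integral_distr) (auto simp: proj_def algebra_simps)
    finally show ?thesis .
  qed
  have "emeasure (distr (perp_measure \<theta> \<Otimes>\<^sub>M lborel) borel (\<lambda>(z, t). z + t *\<^sub>R \<theta>)) A
      = (\<integral>\<^sup>+p. indicator A (fst p + snd p *\<^sub>R \<theta>) \<partial>(perp_measure \<theta> \<Otimes>\<^sub>M lborel))"
    by (simp add: nn_integral_distr case_prod_beta flip: nn_integral_indicator)
  also have "\<dots> = (\<integral>\<^sup>+z. \<integral>\<^sup>+t. indicator A (z + t *\<^sub>R \<theta>) \<partial>lborel \<partial>perp_measure \<theta>)"
    by (subst lborel.nn_integral_fst[symmetric]) auto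
  also have "\<dots> = (\<integral>\<^sup>+y. indicator (slab \<theta>) y * (\<integral>\<^sup>+t. indicator A (proj \<theta> y + t *\<^sub>R \<theta>) \<partial>lborel) \<partial>lborel)"
    by (subst nn_integral_perp_measure) auto
  also have "\<dots> = (\<integral>\<^sup>+y. indicator (slab \<theta>) y * (\<integral>\<^sup>+t. indicator A (y + t *\<^sub>R \<theta>) \<partial>lborel) \<partial>lborel)"
    by (simp add: shift)
  also have "\<dots> = (\<integral>\<^sup>+y. \<integral>\<^sup>+t. indicator (slab \<theta>) y * indicator A (y + t *\<^sub>R \<theta>) \<partial>lborel \<partial>lborel)"
    by (intro nn_integral_cong) (simp add: nn_integral_cmult)
  also have "\<dots> = (\<integral>\<^sup>+t. \<integral>\<^sup>+y. indicator (slab \<theta>) y * indicator A (y + t *\<^sub>R \<theta>) \<partial>lborel \<partial>lborel)"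
    by (rule lborel_pair.Fubini'[symmetric]) simp
  also have "\<dots> = (\<integral>\<^sup>+t. \<integral>\<^sup>+y. indicator (slab \<theta>) (y - t *\<^sub>R \<theta>) * indicator A y \<partial>lborel \<partial>lborel)"
  proof (rule nn_integral_cong)
    fix t
    have "(\<integral>\<^sup>+y. indicator (slab \<theta>) (y - t *\<^sub>R \<theta>) * indicator A y \<partial>lborel)
      = (\<integral>\<^sup>+y. indicator (slab \<theta>) (y - t *\<^sub>R \<theta>) * indicator A y \<partial>distr lborel borel ((+) (t *\<^sub>R \<theta>)))"
      by (simp add: lborel_distr_plus)
    also have "\<dots> = (\<integral>\<^sup>+y. indicator (slab \<theta>) y * indicator A (y + t *\<^sub>R \<theta>) \<partial>lborel)"
      by (subst nn_integral_distr) (auto simp: add.commute)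
    finally show "(\<integral>\<^sup>+y. indicator (slab \<theta>) y * indicator A (y + t *\<^sub>R \<theta>) \<partial>lborel)
      = (\<integral>\<^sup>+y. indicator (slab \<theta>) (y - t *\<^sub>R \<theta>) * indicator A y \<partial>lborel)" by simp
  qed
  also have "\<dots> = (\<integral>\<^sup>+y. \<integral>\<^sup>+t. indicator (slab \<theta>) (y - t *\<^sub>R \<theta>) * indicator A y \<partial>lborel \<partial>lborel)"
    by (rule lborel_pair.Fubini') simp
  also have "\<dots> = (\<integral>\<^sup>+y. indicator A y \<partial>lborel)"
    by (intro nn_integral_cong) (simp add: nn_integral_multc unit_interval)
  finally show "emeasure (distr (perp_measure \<theta> \<Otimes>\<^sub>M lborel) borel (\<lambda>(z, t). z + t *\<^sub>R \<theta>)) A = emeasure lborel A"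
    by simp
qed simp

section \<open>Hausdorff measure on the hemisphere\<close>

text \<open>The hypothesis forces \<open>f\<close> to agree wherever \<open>g\<close> does, so on
  \<open>A\<close> it factors through \<open>g\<close> by a Lipschitz map. Two images of one set can
  thus be compared in either direction by distance inequalities alone.\<close>

lemma hausdorff_outer_compare:
  fixes f :: "'a \<Rightarrow> 'b::metric_space" and g :: "'a \<Rightarrow> 'c::metric_space"
  assumes "0 < L" "0 \<le> k" and le: "\<And>x y. x \<in> A \<Longrightarrow> y \<in> A \<Longrightarrow> dist (f x) (f y) \<le> L * dist (g x) (g y)"
  shows "hausdorff_outer k (f ` A) \<le> ennreal (L powr k) * hausdorff_outer k (g ` A)"
proof -
  define i where "i = inv_into A g"
  have i: "i (g x) \<in> A" "g (i (g x)) = g x" if "x \<in> A" for x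
    using that by (auto simp: i_def inv_into_into f_inv_into_f)
  have "f (i (g x)) = f x" if "x \<in> A" for x
    using le[of "i (g x)" x] i[OF that] that by simp
  then have "f ` A = (\<lambda>y. f (i y)) ` (g ` A)" by (auto simp: image_iff)
  moreover have "hausdorff_outer k ((\<lambda>y. f (i y)) ` (g ` A)) \<le> ennreal (L powr k) * hausdorff_outer k (g ` A)"
    using assms(1,2)
  proof (rule hausdorff_outer_Lipschitz)
    fix x y assume "x \<in> g ` A" "y \<in> g ` A"
    then show "dist (f (i x)) (f (i y)) \<le> L * dist x y"
      using le[of "i x" "i y"] i by auto
  qed
  ultimately show ?thesis by simp
qed

text \<open>By Lindelof countably many of the neighbourhoods cover \<open>D\<close>. Made disjoint,
  they cut \<open>E\<close> into Borel pieces on which the estimate holds with the same factor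
  \<open>k\<close>.\<close>

lemma emeasure_le_locally:
  fixes \<mu> \<nu> :: "'a::second_countable_topology measure"
  assumes sets: "sets \<mu> = sets borel" "sets \<nu> = sets borel"
    and E: "E \<in> sets borel" "E \<subseteq> D"
    and loc: "\<And>z. z \<in> D \<Longrightarrow> \<exists>U. open U \<and> z \<in> U \<and>
      (\<forall>A\<in>sets borel. A \<subseteq> U \<inter> D \<longrightarrow> emeasure \<mu> A \<le> k * emeasure \<nu> A)"
  shows "emeasure \<mu> E \<le> k * emeasure \<nu> E"
proof (cases "D = {}")
  case False
  obtain U where U: "\<And>z. z \<in> D \<Longrightarrow> open (U z)" "\<And>z. z \<in> D \<Longrightarrow> z \<in> U z"
    and le: "\<And>z A. z \<in> D \<Longrightarrow> A \<in> sets borel \<Longrightarrow> A \<subseteq> U z \<inter> D \<Longrightarrow> emeasure \<mu> A \<le> k * emeasure \<nu> A"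
    using loc by metis
  obtain F where F: "F \<subseteq> U ` D" "countable F" "\<Union>F = \<Union>(U ` D)"
    using Lindelof[of "U ` D"] U(1) by blast
  have "F \<noteq> {}" using F(3) False U(2) by blast
  define W where "W = from_nat_into F"
  have W: "W n \<in> F" for n unfolding W_def using \<open>F \<noteq> {}\<close> by (rule from_nat_into)
  have WU: "(\<Union>n. W n) = \<Union>F"
    using range_from_nat_into[OF \<open>F \<noteq> {}\<close> F(2)] by (simp add: W_def)
  define X where "X n = E \<inter> disjointed W n" for n
  have "open (W n)" for n
  proof -
    obtain z where "z \<in> D" "W n = U z" using W[of n] F(1) by blast
    then show ?thesis using U(1) by simp
  qed
  then have Wb: "W n \<in> sets borel" for n by (rule borel_open)
  then have "range (disjointed W) \<subseteq> sets borel"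
    by (intro sets.range_disjointed_sets) auto
  then have X [measurable]: "X n \<in> sets borel" for n using E(1) by (auto simp: X_def)
  have XE: "(\<Union>n. X n) = E"
  proof -
    have "D \<subseteq> \<Union>(U ` D)" using U(2) by blast
    then have "E \<subseteq> (\<Union>n. disjointed W n)"
      using E(2) unfolding UN_disjointed_eq WU F(3) by blast
    then show ?thesis unfolding X_def by blast
  qed
  have dis: "disjoint_family X"
    using disjoint_family_disjointed[of W] unfolding X_def disjoint_family_on_def by blast
  have "emeasure \<mu> (X n) \<le> k * emeasure \<nu> (X n)" for n
  proof -
    obtain z where "z \<in> D" "W n = U z" using W[of n] F(1) by blast
    then show ?thesis
      using le[of z "X n"] X disjointed_subset[of W n] E(2) by (auto simp: X_def)
  qed
  then have "(\<Sum>n. emeasure \<mu> (X n)) \<le> (\<Sum>n. k * emeasure \<nu> (X n))" by (intro suminf_le) auto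
  then show ?thesis
    using suminf_emeasure[of X \<mu>] suminf_emeasure[of X \<nu>] X dis sets by (simp add: XE subset_eq)
qed (use E in auto)

lemma borel_measurable_fst_snd [measurable]:
  "fst \<in> borel_measurable (borel :: ('a::second_countable_topology \<times> 'b::second_countable_topology) measure)"
  "snd \<in> borel_measurable (borel :: ('a::second_countable_topology \<times> 'b::second_countable_topology) measure)"
  by (auto intro!: borel_measurable_continuous_onI continuous_intros)

section \<open>The area formula for half-spheres as graphs\<close>

definition height :: "real \<Rightarrow> 'a::euclidean_space \<Rightarrow> real" where
  "height \<rho> z = sqrt (\<rho>\<^sup>2 - (norm z)\<^sup>2)"

text \<open>The offset \<open>a\<close> moves the base point only; the height depends on
  \<open>z\<close> alone. So \<open>a = 0\<close>, \<open>\<rho> = 1\<close> parametrises the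
  hemisphere and \<open>a = t *\<^sub>R \<theta>\<close>,
  \<open>\<rho> = sqrt (1 - t\<^sup>2)\<close> its section, in both cases over a ball in a linear
  subspace.\<close>

definition lift :: "'a::euclidean_space \<Rightarrow> real \<Rightarrow> 'a \<Rightarrow> 'a \<times> real" where
  "lift a \<rho> z = (a + z, height \<rho> z)"

lemma continuous_on_height [continuous_intros]: "continuous_on S (height \<rho>)"
  unfolding height_def by (intro continuous_intros)

lemma borel_measurable_height [measurable]: "height \<rho> \<in> borel_measurable borel"
  unfolding height_def by measurable

lemma borel_measurable_lift [measurable]: "lift a \<rho> \<in> borel_measurable borel"
  unfolding lift_def by measurable

lemma height_pos: "norm z < \<rho> \<Longrightarrow> 0 < height \<rho> z"
  by (simp add: height_def power_strict_mono)

lemma height_sq: "norm z < \<rho> \<Longrightarrow> (height \<rho> z)\<^sup>2 = \<rho>\<^sup>2 - z \<bullet> z"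
  using power_mono[of "norm z" \<rho> 2] by (simp add: height_def power2_norm_eq_inner)

text \<open>Factoring the difference of the squared heights gives an exact difference quotient. Its
  coefficient tends to \<open>(1 / height \<rho> z) *\<^sub>R z\<close> as \<open>w\<close> tends to
  \<open>z\<close>, which replaces any use of derivatives.\<close>

lemma height_diff:
  assumes "norm z < \<rho>" "norm w < \<rho>"
  shows "height \<rho> z - height \<rho> w = - (((1 / (height \<rho> z + height \<rho> w)) *\<^sub>R (z + w)) \<bullet> (z - w))"
proof -
  have "(height \<rho> z - height \<rho> w) * (height \<rho> z + height \<rho> w) = - ((z + w) \<bullet> (z - w))"
    using height_sq[OF assms(1)] height_sq[OF assms(2)]
    by (simp add: algebra_simps power2_eq_square inner_commute)
  moreover have "0 < height \<rho> z + height \<rho> w" using height_pos assms by (metis add_pos_pos)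
  ultimately have "height \<rho> z - height \<rho> w = - (((z + w) \<bullet> (z - w)) / (height \<rho> z + height \<rho> w))"
    by (metis less_irrefl minus_divide_left nonzero_eq_divide_eq)
  then show ?thesis by (simp only: inner_scaleR_left) simp
qed

text \<open>The right-hand side is the length of the differential of \<open>lift\<close> at
  \<open>z\<close> applied to \<open>v\<close>. Both squares are \<open>|v|^2\<close> plus a
  multiple of \<open>(z \<bullet> v)^2\<close>, and the multiples agree because
  \<open>\<rho>\<^sup>2 - (height \<rho> z)\<^sup>2 = |z|^2\<close>. At \<open>z = 0\<close> the
  tangent plane is horizontal and the stretching is the identity.\<close>

lemma norm_stretch_height:
  assumes "norm z < \<rho>"
  shows "norm (stretch (\<rho> / height \<rho> z) (sgn z) v) = norm (v, - (((1 / height \<rho> z) *\<^sub>R z) \<bullet> v))"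
proof (cases "z = 0")
  case False
  define h where "h = height \<rho> z"
  have h: "0 < h" "h\<^sup>2 = \<rho>\<^sup>2 - z \<bullet> z" using height_pos[OF assms] height_sq[OF assms] by (auto simp: h_def)
  define s where "s = \<rho> / h"
  have zz: "z \<bullet> z = (norm z)\<^sup>2" "norm z \<noteq> 0" using False by (auto simp: power2_norm_eq_inner)
  have "s\<^sup>2 - 1 = (norm z)\<^sup>2 / h\<^sup>2"
    using h by (simp add: s_def power_divide field_simps zz)
  then have "(s\<^sup>2 - 1) * (sgn z \<bullet> v)\<^sup>2 = ((z \<bullet> v) / h)\<^sup>2"
    using zz(2) by (simp add: sgn_div_norm power_mult_distrib power_divide power_inverse)
  moreover have "sgn z \<bullet> sgn z = 1" using False by (simp add: dot_square_norm norm_sgn)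
  then have "stretch s (sgn z) v \<bullet> stretch s (sgn z) v = v \<bullet> v + (s\<^sup>2 - 1) * (sgn z \<bullet> v)\<^sup>2"
    by (simp add: stretch_def inner_add_left inner_add_right inner_commute algebra_simps power2_eq_square)
  ultimately have "stretch s (sgn z) v \<bullet> stretch s (sgn z) v = v \<bullet> v + ((z \<bullet> v) / h)\<^sup>2" by simp
  then show ?thesis
    unfolding s_def[symmetric] h_def[symmetric]
    by (simp add: norm_eq_sqrt_inner[of "stretch s (sgn z) v"] norm_Pair power2_norm_eq_inner power_divide)
qed (use assms in \<open>simp add: stretch_def norm_Pair height_def\<close>)

lemma lift_close_to_stretch:
  assumes z0: "norm z0 < \<rho>" and e: "0 < e" "e < 1"
  defines "S \<equiv> stretch (\<rho> / height \<rho> z0) (sgn z0)"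
  obtains U where "open U" "z0 \<in> U"
    "\<And>z w. z \<in> U \<inter> ball 0 \<rho> \<Longrightarrow> w \<in> U \<inter> ball 0 \<rho> \<Longrightarrow> dist (lift a \<rho> z) (lift a \<rho> w) \<le> (1 + e) * dist (S z) (S w)"
    "\<And>z w. z \<in> U \<inter> ball 0 \<rho> \<Longrightarrow> w \<in> U \<inter> ball 0 \<rho> \<Longrightarrow> dist (S z) (S w) \<le> (1 / (1 - e)) * dist (lift a \<rho> z) (lift a \<rho> w)"
proof -
  define h :: "'a \<Rightarrow> real" where "h = height \<rho>"
  have h0: "0 < h z0" using height_pos[OF z0] by (simp add: h_def)
  define d where "d = (1 / h z0) *\<^sub>R z0"
  \<comment> \<open>This is the coefficient from \<open>height_diff\<close> as a function of the two
    points; on the diagonal it is the slope vector \<open>d\<close>.\<close>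
  define F where "F p = (1 / (h (fst p) + h (snd p))) *\<^sub>R (fst p + snd p)" for p
  have ch: "isCont h x" for x
    using continuous_on_height[of "UNIV :: 'a set" \<rho>] by (simp add: h_def continuous_on_eq_continuous_at)
  have "isCont F (z0, z0)"
    unfolding F_def using h0
    by (intro continuous_intros isCont_o2[OF _ ch]) auto
  moreover have "F (z0, z0) = d"
    using h0 by (simp add: F_def d_def scaleR_2[symmetric] field_simps)
  ultimately obtain r where r: "0 < r" "\<And>p. dist p (z0, z0) < r \<Longrightarrow> dist (F p) d < e"
    using e(1) unfolding continuous_at_eps_delta by auto
  \<comment> \<open>Halving the radius keeps a pair of points of \<open>U\<close> within
    \<open>r\<close> of \<open>(z0, z0)\<close>.\<close>
  define U where "U = ball z0 (r/2)"
  have main: "\<bar>dist (lift a \<rho> z) (lift a \<rho> w) - dist (S z) (S w)\<bar> \<le> e * dist (S z) (S w)"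
    if zw: "z \<in> U \<inter> ball 0 \<rho>" "w \<in> U \<inter> ball 0 \<rho>" for z w
  proof -
    have "dist (z, w) (z0, z0) \<le> dist z z0 + dist w z0"
      unfolding dist_Pair_Pair by (rule sqrt_sum_squares_le_sum) auto
    also have "\<dots> < r" using zw by (simp add: U_def dist_commute)
    finally have Fd: "norm (F (z, w) - d) < e" using r(2) by (simp add: dist_norm)
    have S: "dist (S z) (S w) = norm (z - w, - (d \<bullet> (z - w)))"
      using norm_stretch_height[OF z0, of "z - w"]
      by (simp add: S_def dist_norm linear_diff[OF linear_stretch, symmetric] d_def h_def)
    have L: "dist (lift a \<rho> z) (lift a \<rho> w) = norm (z - w, h z - h w)"
      by (simp add: lift_def dist_norm h_def)
    have "h z - h w = - (F (z, w) \<bullet> (z - w))"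
      using height_diff[of z \<rho> w] zw by (simp add: F_def h_def)
    then have "(z - w, h z - h w) - (z - w, - (d \<bullet> (z - w))) = (0, - ((F (z, w) - d) \<bullet> (z - w)))"
      by (simp add: inner_diff_left)
    then have "\<bar>dist (lift a \<rho> z) (lift a \<rho> w) - dist (S z) (S w)\<bar> \<le> norm (0 :: 'a, - ((F (z, w) - d) \<bullet> (z - w)))"
      unfolding S L by (metis norm_triangle_ineq3)
    also have "\<dots> = \<bar>(F (z, w) - d) \<bullet> (z - w)\<bar>" by (simp add: norm_Pair)
    also have "\<dots> \<le> norm (F (z, w) - d) * norm (z - w)" by (rule Cauchy_Schwarz_ineq2)
    also have "\<dots> \<le> e * norm (z - w)" using Fd by (intro mult_right_mono) auto
    \<comment> \<open>The first component of the differential is the identity, so \<open>S\<close>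
      never shortens distances; the additive error thereby becomes a relative one.\<close>
    also have "\<dots> \<le> e * dist (S z) (S w)"
      using norm_fst_le[of "z - w" "- (d \<bullet> (z - w))"] e(1) unfolding S by (intro mult_left_mono) auto
    finally show ?thesis .
  qed
  show ?thesis
  proof (rule that[of U])
    fix z w assume zw: "z \<in> U \<inter> ball 0 \<rho>" "w \<in> U \<inter> ball 0 \<rho>"
    show "dist (lift a \<rho> z) (lift a \<rho> w) \<le> (1 + e) * dist (S z) (S w)"
      using main[OF zw] by (simp add: algebra_simps)
    have "(1 - e) * dist (S z) (S w) \<le> dist (lift a \<rho> z) (lift a \<rho> w)"
      using main[OF zw] by (simp add: algebra_simps)
    then show "dist (S z) (S w) \<le> (1 / (1 - e)) * dist (lift a \<rho> z) (lift a \<rho> w)"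
      using e(2) by (simp add: field_simps)
  qed (use r in \<open>auto simp: U_def\<close>)
qed

text \<open>Images of Borel sets are not Borel in general; a graph over a Borel set is, being cut
  out by measurable conditions on the coordinates.\<close>

lemma lift_image_borel:
  assumes [measurable]: "D \<in> sets borel"
  shows "lift a \<rho> ` D \<in> sets borel"
proof -
  have "lift a \<rho> ` D = {x. fst x - a \<in> D \<and> snd x = height \<rho> (fst x - a)}"
    by (auto simp: lift_def image_iff intro!: bexI[of _ "_ - a"])
  also have "\<dots> \<in> sets borel" by measurable
  finally show ?thesis .
qed

lemma ennreal_le_mult: "x \<le> c * y \<Longrightarrow> 0 \<le> c \<Longrightarrow> ennreal x \<le> ennreal c * ennreal y"
  by (metis ennreal_leI ennreal_mult')

lemma ennreal_power_Suc:
  "0 < x \<Longrightarrow> ennreal x * (ennreal (x powr real m) * y) = ennreal (x ^ Suc m) * y"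
  by (simp add: powr_realpow ennreal_mult mult.assoc)

context flat_measure
begin

text \<open>\<open>N\<close> and Hausdorff measure on \<open>V\<close> differ by a constant factor,
  which cancels, so the determinant rule \<open>stretching\<close> carries over.\<close>

lemma hausdorff_stretch:
  assumes u: "u \<in> V" "norm u = 1" and s: "0 < s" and E [measurable]: "E \<in> sets borel" and EV: "E \<subseteq> V"
  shows "H (stretch s u ` E) = ennreal s * H E"
proof -
  obtain c where c: "\<And>A. A \<in> sets borel \<Longrightarrow> emeasure (hausdorff_measure m) (A \<inter> V) = ennreal c * emeasure N A"
    using hausdorff_proportional by blast
  have img: "stretch s u ` E = stretch (1 / s) u -` E"
    using stretch_stretch[OF u(2), of s] stretch_stretch'[OF u(2), of s] s
    by (auto simp: image_iff intro!: bexI[of _ "stretch (1 / s) u _"])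
  have SE [measurable]: "stretch s u ` E \<in> sets borel"
    unfolding img using measurable_sets_borel[OF borel_measurable_stretch E] by simp
  have "stretch s u ` E \<inter> V = stretch s u ` E" "E \<inter> V = E"
    using EV u(1) by (auto simp: stretch_def intro: subspace_add[OF V] subspace_scale[OF V])
  then have "H (stretch s u ` E) = ennreal c * emeasure N (stretch s u ` E)" "H E = ennreal c * emeasure N E"
    using c[OF SE] c[OF E] by (simp_all add: emeasure_hausdorff)
  moreover have "emeasure N (stretch s u ` E) = ennreal s * emeasure N E"
  proof -
    have "stretch s u -` (stretch s u ` E) = E"
      unfolding img using stretch_stretch'[OF u(2), of s] s by auto
    then show ?thesis using stretching[OF u s SE] by simp
  qed
  ultimately show ?thesis by (simp add: mult.left_commute)
qed

text \<open>Near a point \<open>z0\<close> the map \<open>lift\<close> is almost isometric to the stretching by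
  \<open>\<rho> / height\<close> in the radial direction.\<close>

theorem hausdorff_lift:
  fixes a :: 'a and \<rho> :: real
  defines "D \<equiv> V \<inter> ball 0 \<rho>"
  shows "distr (density (hausdorff_measure m) (indicator (lift a \<rho> ` D))) borel (\<lambda>x. fst x - a)
       = density (hausdorff_measure m) (\<lambda>z. ennreal (\<rho> / height \<rho> z) * indicator D z)"
    (is "?\<mu> = ?\<nu>")
proof -
  have D [measurable]: "D \<in> sets borel" by (simp add: D_def)
  have LD [measurable]: "lift a \<rho> ` D \<in> sets borel" by (rule lift_image_borel) fact
  have \<mu>: "emeasure ?\<mu> A = H (lift a \<rho> ` (A \<inter> D))" if [measurable]: "A \<in> sets borel" for A
  proof -
    have pre: "(\<lambda>x :: 'a \<times> real. fst x - a) -` A \<in> sets borel"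
      using measurable_sets_borel[of "\<lambda>x :: 'a \<times> real. fst x - a" borel A] by simp
    have eq: "lift a \<rho> ` D \<inter> (\<lambda>x. fst x - a) -` A = lift a \<rho> ` (A \<inter> D)"
      by (auto simp: lift_def image_iff)
    have "emeasure ?\<mu> A = emeasure (hausdorff_measure m) (lift a \<rho> ` D \<inter> ((\<lambda>x. fst x - a) -` A))"
      using pre by (simp add: emeasure_distr emeasure_density flip: indicator_inter_arith)
    then show ?thesis using emeasure_hausdorff[OF lift_image_borel, of "A \<inter> D" m a \<rho>] by (simp add: eq)
  qed
  have \<nu>: "emeasure ?\<nu> A = (\<integral>\<^sup>+z. ennreal (\<rho> / height \<rho> z) * indicator (A \<inter> D) z \<partial>hausdorff_measure m)"
    if [measurable]: "A \<in> sets borel" for A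
    by (simp add: emeasure_density indicator_inter_arith mult_ac)
  have sets: "sets ?\<mu> = sets borel" "sets ?\<nu> = sets borel" by simp_all
  have loc: "\<exists>U. open U \<and> z0 \<in> U \<and> (\<forall>A\<in>sets borel. A \<subseteq> U \<inter> D \<longrightarrow>
      emeasure ?\<mu> A \<le> ennreal k * emeasure ?\<nu> A \<and> emeasure ?\<nu> A \<le> ennreal k * emeasure ?\<mu> A)"
    if z0: "z0 \<in> D" and k: "1 < k" for z0 k
  proof -
    have nz0: "norm z0 < \<rho>" and z0V: "z0 \<in> V" using z0 by (auto simp: D_def)
    \<comment> \<open>The exponent \<open>Suc m\<close> consists of \<open>m\<close> for the
      distortion of \<open>m\<close>-dimensional measure and one more for the oscillation of the
      density \<open>\<rho> / height\<close> near \<open>z0\<close>.\<close>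
    have "((\<lambda>e::real. (1 + e) ^ Suc m) \<longlongrightarrow> (1 + 0) ^ Suc m) (at_right 0)"
      "((\<lambda>e::real. (1 / (1 - e)) ^ Suc m) \<longlongrightarrow> (1 / (1 - 0)) ^ Suc m) (at_right 0)"
      by (intro tendsto_intros; simp)+
    then have "\<forall>\<^sub>F e in at_right 0. (1 + e) ^ Suc m < k" "\<forall>\<^sub>F e in at_right 0. (1 / (1 - e)) ^ Suc m < k"
      using k by (auto intro!: order_tendstoD(2))
    moreover have "\<forall>\<^sub>F e in at_right (0::real). 0 < e \<and> e < 1"
      by (auto simp: eventually_at_right_field intro: exI[of _ 1])
    ultimately have "\<forall>\<^sub>F e in at_right (0::real). (1 + e) ^ Suc m < k \<and> (1 / (1 - e)) ^ Suc m < k \<and> 0 < e \<and> e < 1"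
      by eventually_elim auto
    then obtain e :: real where e: "(1 + e) ^ Suc m < k" "(1 / (1 - e)) ^ Suc m < k" "0 < e" "e < 1"
      using eventually_happens'[OF trivial_limit_at_right_real] by blast
    define s where "s z = \<rho> / height \<rho> z" for z :: 'a
    define S where "S = stretch (s z0) (sgn z0)"
    have s0: "0 < s z0" using height_pos[OF nz0] nz0 norm_ge_zero[of z0] unfolding s_def
      by (intro divide_pos_pos) linarith+
    have "isCont s z0"
      unfolding s_def using continuous_on_height[of "UNIV :: 'a set" \<rho>] height_pos[OF nz0]
      by (intro continuous_intros) (auto simp: continuous_on_eq_continuous_at)
    then have "isCont (\<lambda>z. (1 + e) * s z - s z0) z0" "isCont (\<lambda>z. s z0 - (1 - e) * s z) z0"
      by (auto intro!: continuous_intros)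
    moreover have "0 < (1 + e) * s z0 - s z0" "0 < s z0 - (1 - e) * s z0"
      using s0 e by (auto simp: algebra_simps)
    moreover have ev: "\<forall>\<^sub>F z in nhds z0. 0 < f z" if "isCont f z0" "0 < f z0" for f :: "'a \<Rightarrow> real"
      using that order_tendstoD(1)[of f "f z0" "nhds z0" 0] by (simp add: isCont_def tendsto_at_iff_tendsto_nhds)
    ultimately have "\<forall>\<^sub>F z in nhds z0. 0 < (1 + e) * s z - s z0 \<and> 0 < s z0 - (1 - e) * s z"
      by (intro eventually_conj ev)
    then obtain W where W: "open W" "z0 \<in> W" "\<And>z. z \<in> W \<Longrightarrow> s z0 \<le> (1 + e) * s z \<and> (1 - e) * s z \<le> s z0"
      unfolding eventually_nhds by (metis diff_gt_0_iff_gt less_imp_le)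
    obtain U where U: "open U" "z0 \<in> U"
      "\<And>z w. z \<in> U \<inter> ball 0 \<rho> \<Longrightarrow> w \<in> U \<inter> ball 0 \<rho> \<Longrightarrow> dist (lift a \<rho> z) (lift a \<rho> w) \<le> (1 + e) * dist (S z) (S w)"
      "\<And>z w. z \<in> U \<inter> ball 0 \<rho> \<Longrightarrow> w \<in> U \<inter> ball 0 \<rho> \<Longrightarrow> dist (S z) (S w) \<le> (1 / (1 - e)) * dist (lift a \<rho> z) (lift a \<rho> w)"
      using lift_close_to_stretch[OF nz0 e(3,4), of a] unfolding S_def s_def by blast
    have "emeasure ?\<mu> A \<le> ennreal k * emeasure ?\<nu> A \<and> emeasure ?\<nu> A \<le> ennreal k * emeasure ?\<mu> A"
      if A [measurable]: "A \<in> sets borel" and sub: "A \<subseteq> (U \<inter> W) \<inter> D" for A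
    proof -
      have AV: "A \<subseteq> V" and AU: "A \<subseteq> U \<inter> ball 0 \<rho>" and AD: "A \<inter> D = A"
        using sub by (auto simp: D_def)
      \<comment> \<open>At the centre there is no radial direction: \<open>sgn z0\<close> is 0
        rather than a unit vector of \<open>V\<close>, and \<open>S\<close> is the identity.\<close>
      have HS: "H (S ` A) = ennreal (s z0) * H A"
      proof (cases "z0 = 0")
        case True
        then have "s z0 = 1" "S = (\<lambda>x. x)" using nz0 by (auto simp: S_def s_def height_def stretch_def)
        then show ?thesis by simp
      next
        case False
        then have "sgn z0 \<in> V" "norm (sgn z0) = 1"
          using z0V by (auto simp: sgn_div_norm intro: subspace_scale[OF V])
        then show ?thesis unfolding S_def using hausdorff_stretch s0 A AV by blast
      qed
      have HA: "emeasure (hausdorff_measure m) A = H A" by (simp add: emeasure_hausdorff A)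
      have \<mu>A: "emeasure ?\<mu> A = H (lift a \<rho> ` A)" using \<mu>[OF A] AD by simp
      have \<nu>A: "emeasure ?\<nu> A = (\<integral>\<^sup>+z. ennreal (s z) * indicator A z \<partial>hausdorff_measure m)"
        using \<nu>[OF A] AD by (simp add: s_def)
      have [measurable]: "s \<in> borel_measurable borel" unfolding s_def by measurable
      have up: "ennreal (s z0) * H A \<le> ennreal (1 + e) * emeasure ?\<nu> A"
      proof -
        have "ennreal (s z0) * H A = (\<integral>\<^sup>+z. ennreal (s z0) * indicator A z \<partial>hausdorff_measure m)"
          by (simp add: nn_integral_cmult HA)
        also have "\<dots> \<le> (\<integral>\<^sup>+z. ennreal (1 + e) * (ennreal (s z) * indicator A z) \<partial>hausdorff_measure m)"
        proof (rule nn_integral_mono)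
          fix z
          show "ennreal (s z0) * indicator A z \<le> ennreal (1 + e) * (ennreal (s z) * indicator A z)"
            using W(3)[of z] sub e(3) by (auto simp: indicator_def simp del: ennreal_plus intro!: ennreal_le_mult)
        qed
        also have "\<dots> = ennreal (1 + e) * emeasure ?\<nu> A"
          unfolding \<nu>A by (rule nn_integral_cmult) simp
        finally show ?thesis .
      qed
      have lo: "emeasure ?\<nu> A \<le> ennreal (1 / (1 - e)) * (ennreal (s z0) * H A)"
      proof -
        have "emeasure ?\<nu> A \<le> (\<integral>\<^sup>+z. ennreal (1 / (1 - e)) * (ennreal (s z0) * indicator A z) \<partial>hausdorff_measure m)"
          unfolding \<nu>A
        proof (rule nn_integral_mono)
          fix z
          have "s z \<le> 1 / (1 - e) * s z0" if "z \<in> A"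
            using W(3)[of z] sub e(4) that by (auto simp: field_simps)
          then show "ennreal (s z) * indicator A z \<le> ennreal (1 / (1 - e)) * (ennreal (s z0) * indicator A z)"
            using e(4) by (auto simp: indicator_def intro!: ennreal_le_mult)
        qed
        also have "\<dots> = ennreal (1 / (1 - e)) * (ennreal (s z0) * H A)"
          by (simp add: nn_integral_cmult HA)
        finally show ?thesis .
      qed
      have "emeasure ?\<mu> A \<le> ennreal ((1 + e) powr m) * H (S ` A)"
        unfolding \<mu>A using e(3) AU by (intro hausdorff_outer_compare U) auto
      also have "\<dots> \<le> ennreal ((1 + e) powr m) * (ennreal (1 + e) * emeasure ?\<nu> A)"
        unfolding HS by (intro mult_left_mono up) auto
      also have "\<dots> = ennreal ((1 + e) ^ Suc m) * emeasure ?\<nu> A"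
        using e(3) by (simp only: mult.left_commute[of "ennreal (_ powr _)"]) (intro ennreal_power_Suc, simp)
      also have "\<dots> \<le> ennreal k * emeasure ?\<nu> A"
        using e(1) by (intro mult_right_mono ennreal_leI) auto
      finally have 1: "emeasure ?\<mu> A \<le> ennreal k * emeasure ?\<nu> A" .
      note lo
      also have "ennreal (1 / (1 - e)) * (ennreal (s z0) * H A)
          \<le> ennreal (1 / (1 - e)) * (ennreal ((1 / (1 - e)) powr m) * emeasure ?\<mu> A)"
        unfolding HS[symmetric] \<mu>A using e(4) AU
        by (intro mult_left_mono hausdorff_outer_compare U) auto
      also have "\<dots> = ennreal ((1 / (1 - e)) ^ Suc m) * emeasure ?\<mu> A"
        using e(4) by (intro ennreal_power_Suc) simp
      also have "\<dots> \<le> ennreal k * emeasure ?\<mu> A"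
        using e(2) by (intro mult_right_mono ennreal_leI) auto
      finally show ?thesis using 1 by blast
    qed
    then show ?thesis using U(1,2) W(1,2) by (intro exI[of _ "U \<inter> W"]) auto
  qed
  \<comment> \<open>The local estimates hold with any factor \<open>k > 1\<close>; letting
    \<open>k\<close> decrease to 1 makes the comparison exact.\<close>
  have lim: "x \<le> y" if "\<And>k. 1 < k \<Longrightarrow> x \<le> ennreal k * y" for x y :: ennreal
  proof (cases "y = top")
    case False
    then have "((\<lambda>k. ennreal k * y) \<longlongrightarrow> ennreal 1 * y) (at_right 1)"
      by (intro tendsto_mult_ennreal tendsto_ennrealI tendsto_intros) auto
    moreover have "\<forall>\<^sub>F k in at_right 1. x \<le> ennreal k * y"
      using that by (auto simp: eventually_at_right_field intro: exI[of _ 2])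
    ultimately show ?thesis by (intro tendsto_lowerbound[of _ _ "at_right (1::real)"]) auto
  qed simp
  show ?thesis
  proof (rule measure_eqI)
    fix A assume "A \<in> sets ?\<mu>"
    then have A [measurable]: "A \<in> sets borel" by simp
    \<comment> \<open>The local comparison covers subsets of \<open>D\<close> only. Both measures
      vanish off \<open>D\<close>, so cutting with \<open>D\<close> changes nothing.\<close>
    have AD: "A \<inter> D \<in> sets borel" "A \<inter> D \<subseteq> D" by auto
    have "emeasure ?\<mu> (A \<inter> D) \<le> emeasure ?\<nu> (A \<inter> D)"
    proof (rule lim, rule emeasure_le_locally[OF sets AD])
      fix k :: real and z assume "1 < k" "z \<in> D"
      from loc[OF this(2,1)] show "\<exists>U. open U \<and> z \<in> U \<and>
          (\<forall>A\<in>sets borel. A \<subseteq> U \<inter> D \<longrightarrow> emeasure ?\<mu> A \<le> ennreal k * emeasure ?\<nu> A)"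
        by blast
    qed
    moreover have "emeasure ?\<nu> (A \<inter> D) \<le> emeasure ?\<mu> (A \<inter> D)"
    proof (rule lim, rule emeasure_le_locally[OF sets(2,1) AD])
      fix k :: real and z assume "1 < k" "z \<in> D"
      from loc[OF this(2,1)] show "\<exists>U. open U \<and> z \<in> U \<and>
          (\<forall>A\<in>sets borel. A \<subseteq> U \<inter> D \<longrightarrow> emeasure ?\<nu> A \<le> ennreal k * emeasure ?\<mu> A)"
        by blast
    qed
    moreover have "emeasure ?\<mu> (A \<inter> D) = emeasure ?\<mu> A" using \<mu>[OF A] \<mu>[OF AD(1)] by (simp add: Int_assoc)
    moreover have "emeasure ?\<nu> (A \<inter> D) = emeasure ?\<nu> A" using \<nu>[OF A] \<nu>[OF AD(1)] by (simp add: Int_assoc)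
    ultimately show "emeasure ?\<mu> A = emeasure ?\<nu> A" by simp
  qed simp
qed

end

section \<open>Uniqueness of the inverse Radon transform\<close>

context flat_measure
begin

lemma hausdorff_density:
  "\<exists>c>0. density (hausdorff_measure m) (\<lambda>x. ennreal (indicator V x)) = density N (\<lambda>_. ennreal c)"
proof -
  obtain c where c: "0 < c" "\<And>A. A \<in> sets borel \<Longrightarrow> emeasure (hausdorff_measure m) (A \<inter> V) = ennreal c * emeasure N A"
    using hausdorff_proportional by blast
  have "density (hausdorff_measure m) (\<lambda>x. ennreal (indicator V x)) = density N (\<lambda>_. ennreal c)"
  proof (rule measure_eqI)
    fix A assume "A \<in> sets (density (hausdorff_measure m) (\<lambda>x. ennreal (indicator V x)))"
    then have [measurable]: "A \<in> sets borel" by simp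
    have "(\<lambda>x. ennreal (indicator V x) * indicator A x) = (\<lambda>x. indicator (A \<inter> V) x)"
      by (auto simp: indicator_def fun_eq_iff)
    then show "emeasure (density (hausdorff_measure m) (\<lambda>x. ennreal (indicator V x))) A
        = emeasure (density N (\<lambda>_. ennreal c)) A"
      using c(2)[of A] by (subst emeasure_density) (simp_all add: emeasure_density_const)
  qed simp
  with c(1) show ?thesis by blast
qed

text \<open>One constant serves all Borel functions: if \<open>g\<close> is not integrable, both
  Bochner integrals are 0.\<close>

lemma hausdorff_integral:
  "\<exists>c>0. \<forall>g\<in>borel_measurable borel.
    (\<integral>x. indicator V x * (g x :: real) \<partial>hausdorff_measure m) = c * (\<integral>x. g x \<partial>N)"
proof -
  obtain c where c: "0 < c"
    "density (hausdorff_measure m) (\<lambda>x. ennreal (indicator V x)) = density N (\<lambda>_. ennreal c)"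
    using hausdorff_density by blast
  have "(\<integral>x. indicator V x * g x \<partial>hausdorff_measure m) = c * (\<integral>x. g x \<partial>N)"
    if [measurable]: "g \<in> borel_measurable borel" for g :: "'a \<Rightarrow> real"
  proof -
    have "(\<integral>x. indicator V x * g x \<partial>hausdorff_measure m)
        = (\<integral>x. g x \<partial>density (hausdorff_measure m) (\<lambda>x. ennreal (indicator V x)))"
      by (subst integral_density) auto
    also have "\<dots> = (\<integral>x. c * g x \<partial>N)"
      unfolding c(2) using c(1) by (subst integral_density) auto
    finally show ?thesis by simp
  qed
  with c(1) show ?thesis by blast
qed

end

lemma hausdorff_distr_translation:
  fixes v :: "'a::euclidean_space"
  assumes "0 \<le> k"
  shows "distr (hausdorff_measure k) borel (\<lambda>x. x + v) = hausdorff_measure k"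
proof (rule measure_eqI)
  fix A assume "A \<in> sets (distr (hausdorff_measure k) borel (\<lambda>x. x + v))"
  then have A: "A \<in> sets borel" by simp
  have pre: "(\<lambda>x. x + v) -` A \<in> sets borel"
    using measurable_sets_borel[of "\<lambda>x. x + v" borel A] A by simp
  have "A = (\<lambda>x. x + v) ` ((\<lambda>x. x + v) -` A)"
    by (auto simp: image_iff intro!: bexI[of _ "_ - v"])
  moreover have "hausdorff_outer k ((\<lambda>x. x + v) ` ((\<lambda>x. x + v) -` A)) = hausdorff_outer k ((\<lambda>x. x + v) -` A)"
    using assms by (intro hausdorff_outer_isometry) (auto simp: dist_norm)
  ultimately show "emeasure (distr (hausdorff_measure k) borel (\<lambda>x. x + v)) A = emeasure (hausdorff_measure k) A"
    using A pre by (simp add: emeasure_distr emeasure_hausdorff)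
qed simp

context
  fixes \<theta> :: "real^'n"
  assumes unit: "norm \<theta> = 1" and n: "2 \<le> CARD('n)"
begin

interpretation flat_measure "{y. y \<bullet> \<theta> = 0}" "CARD('n) - 1" "perp_measure \<theta>"
  by (rule flat_measure_perp[OF unit n])

lemma real_dim: "real CARD('n) - 1 = real (CARD('n) - 1)"
  using n by simp

text \<open>Moving the hyperplane to the parallel one through 0 turns it into a linear subspace, to
  which \<open>flat_measure\<close> applies.\<close>

lemma radon_shift:
  fixes \<psi> :: "real^'n \<Rightarrow> real"
  assumes [measurable]: "\<psi> \<in> borel_measurable borel"
  shows "radon \<psi> \<theta> t = (\<integral>z. indicator {y. y \<bullet> \<theta> = 0} z * \<psi> (z + t *\<^sub>R \<theta>) \<partial>hausdorff_measure (CARD('n) - 1))"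
proof -
  have "{y. y \<bullet> \<theta> = t} \<in> sets borel" by measurable
  then have "radon \<psi> \<theta> t = (\<integral>z. indicator {y. y \<bullet> \<theta> = t} (z + t *\<^sub>R \<theta>) * \<psi> (z + t *\<^sub>R \<theta>) \<partial>hausdorff_measure (CARD('n) - 1))"
    unfolding radon_def set_lebesgue_integral_def real_dim
    by (subst hausdorff_distr_translation[of _ "t *\<^sub>R \<theta>", symmetric], simp, subst integral_distr) auto
  also have "\<dots> = (\<integral>z. indicator {y. y \<bullet> \<theta> = 0} z * \<psi> (z + t *\<^sub>R \<theta>) \<partial>hausdorff_measure (CARD('n) - 1))"
    by (intro Bochner_Integration.integral_cong) (auto simp: indicator_def inner_add_left inner_unit[OF unit])
  finally show ?thesis .
qed

text \<open>The factor depends on the direction only. Being the same for all \<open>\<psi>\<close>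
  and \<open>t\<close>, it does not affect the comparison of two functions along one
  direction.\<close>

lemma radon_perp_measure:
  "\<exists>c>0. \<forall>\<psi>\<in>borel_measurable borel. \<forall>t. radon \<psi> \<theta> t = c * (\<integral>z. \<psi> (z + t *\<^sub>R \<theta>) \<partial>perp_measure \<theta>)"
proof -
  obtain c where c: "0 < c" "\<And>g. g \<in> borel_measurable borel \<Longrightarrow>
      (\<integral>x. indicator {y. y \<bullet> \<theta> = 0} x * (g x :: real) \<partial>hausdorff_measure (CARD('n) - 1)) = c * (\<integral>x. g x \<partial>perp_measure \<theta>)"
    using hausdorff_integral by blast
  have "radon \<psi> \<theta> t = c * (\<integral>z. \<psi> (z + t *\<^sub>R \<theta>) \<partial>perp_measure \<theta>)" if [measurable]: "\<psi> \<in> borel_measurable borel" for \<psi> t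
    unfolding radon_shift[OF that] by (rule c(2)) measurable
  with c(1) show ?thesis by blast
qed

lemma integral_slices:
  fixes g :: "real^'n \<Rightarrow> real"
  assumes g: "integrable lborel g"
  shows "integrable lborel (\<lambda>t. \<integral>z. g (z + t *\<^sub>R \<theta>) \<partial>perp_measure \<theta>)"
    and "(\<integral>y. g y \<partial>lborel) = (\<integral>t. (\<integral>z. g (z + t *\<^sub>R \<theta>) \<partial>perp_measure \<theta>) \<partial>lborel)"
proof -
  interpret N: sigma_finite_measure "perp_measure \<theta>" by (rule sigma_finite_N)
  interpret pair_sigma_finite "perp_measure \<theta>" "lborel :: real measure" ..
  have [measurable]: "g \<in> borel_measurable borel" using g by auto
  have m: "(\<lambda>(z, t). z + t *\<^sub>R \<theta>) \<in> measurable (perp_measure \<theta> \<Otimes>\<^sub>M lborel) borel"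
    by measurable
  have "integrable (distr (perp_measure \<theta> \<Otimes>\<^sub>M lborel) borel (\<lambda>(z, t). z + t *\<^sub>R \<theta>)) g"
    using g by (simp add: lborel_slice[OF unit])
  then have int: "integrable (perp_measure \<theta> \<Otimes>\<^sub>M lborel) (\<lambda>(z, t). g (z + t *\<^sub>R \<theta>))"
    by (subst (asm) integrable_distr_eq) (auto simp: case_prod_unfold)
  show "integrable lborel (\<lambda>t. \<integral>z. g (z + t *\<^sub>R \<theta>) \<partial>perp_measure \<theta>)"
    using integrable_snd[OF int] .
  have "(\<integral>y. g y \<partial>lborel) = (\<integral>y. g y \<partial>distr (perp_measure \<theta> \<Otimes>\<^sub>M lborel) borel (\<lambda>(z, t). z + t *\<^sub>R \<theta>))"
    by (simp add: lborel_slice[OF unit])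
  also have "\<dots> = (\<integral>(z, t). g (z + t *\<^sub>R \<theta>) \<partial>(perp_measure \<theta> \<Otimes>\<^sub>M lborel))"
    using m by (subst integral_distr) (auto simp: case_prod_unfold)
  also have "\<dots> = (\<integral>t. (\<integral>z. g (z + t *\<^sub>R \<theta>) \<partial>perp_measure \<theta>) \<partial>lborel)"
    using integral_snd[OF int] by simp
  finally show "(\<integral>y. g y \<partial>lborel) = (\<integral>t. (\<integral>z. g (z + t *\<^sub>R \<theta>) \<partial>perp_measure \<theta>) \<partial>lborel)" .
qed

end

section \<open>Laplace transforms and directions\<close>

text \<open>On the support \<open>\<xi> \<bullet> y\<close> is at most \<open>norm \<xi>\<close>. As
  the bound depends on \<open>\<xi>\<close> only through its norm, it also dominates when the
  direction varies.\<close>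

lemma integrable_exp_inner:
  fixes \<psi> :: "'a::euclidean_space \<Rightarrow> real"
  assumes int: "integrable lborel \<psi>" and supp: "\<And>y. y \<notin> cball 0 1 \<Longrightarrow> \<psi> y = 0"
  shows "norm (\<psi> y * exp (\<xi> \<bullet> y)) \<le> exp (norm \<xi>) * norm (\<psi> y)"
    and "integrable lborel (\<lambda>y. \<psi> y * exp (\<xi> \<bullet> y))"
proof -
  have *: "norm (\<psi> y * exp (\<xi> \<bullet> y)) \<le> exp (norm \<xi>) * norm (\<psi> y)" for y
  proof (cases "y \<in> cball 0 1")
    case True
    have "\<xi> \<bullet> y \<le> norm \<xi> * norm y" by (rule norm_cauchy_schwarz)
    also have "\<dots> \<le> norm \<xi>" using True by (intro mult_left_le) auto
    finally have "exp (\<xi> \<bullet> y) \<le> exp (norm \<xi>)" by simp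
    then show ?thesis
      using mult_left_mono[of "exp (\<xi> \<bullet> y)" "exp (norm \<xi>)" "\<bar>\<psi> y\<bar>"] by (simp add: abs_mult mult.commute)
  qed (simp add: supp)
  then show "norm (\<psi> y * exp (\<xi> \<bullet> y)) \<le> exp (norm \<xi>) * norm (\<psi> y)" .
  have [measurable]: "\<psi> \<in> borel_measurable borel" using int by auto
  show "integrable lborel (\<lambda>y. \<psi> y * exp (\<xi> \<bullet> y))"
    by (rule Bochner_Integration.integrable_bound[of _ "\<lambda>y. exp (norm \<xi>) * norm (\<psi> y)"]) (use int * in auto)
qed

text \<open>The radial values of the bilateral Laplace transform of \<open>\<psi>\<close> are one-dimensional
  Laplace transforms of \<open>radon \<psi> \<theta>\<close>.\<close>

lemma laplace_eq_on_line:
  fixes \<theta> :: "real^'n" and \<psi>1 \<psi>2 :: "real^'n \<Rightarrow> real"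
  assumes \<theta>: "norm \<theta> = 1" and n: "2 \<le> CARD('n)"
    and 1: "integrable lborel \<psi>1" "\<And>y. y \<notin> cball 0 1 \<Longrightarrow> \<psi>1 y = 0"
    and 2: "integrable lborel \<psi>2" "\<And>y. y \<notin> cball 0 1 \<Longrightarrow> \<psi>2 y = 0"
    and eq: "AE t in lborel. radon \<psi>1 \<theta> t = radon \<psi>2 \<theta> t"
  shows "(\<integral>y. \<psi>1 y * exp ((s *\<^sub>R \<theta>) \<bullet> y) \<partial>lborel) = (\<integral>y. \<psi>2 y * exp ((s *\<^sub>R \<theta>) \<bullet> y) \<partial>lborel)"
proof -
  interpret flat_measure "{y. y \<bullet> \<theta> = 0}" "CARD('n) - 1" "perp_measure \<theta>"
    by (rule flat_measure_perp[OF \<theta> n])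
  obtain c where c: "0 < c" "\<And>\<psi> t. \<psi> \<in> borel_measurable borel \<Longrightarrow>
      radon \<psi> \<theta> t = c * (\<integral>z. \<psi> (z + t *\<^sub>R \<theta>) \<partial>perp_measure \<theta>)"
    using radon_perp_measure[OF \<theta> n] by blast
  have inner: "(\<integral>z. \<psi> (z + t *\<^sub>R \<theta>) * exp ((s *\<^sub>R \<theta>) \<bullet> (z + t *\<^sub>R \<theta>)) \<partial>perp_measure \<theta>)
      = exp (s * t) / c * radon \<psi> \<theta> t"
    if [measurable]: "\<psi> \<in> borel_measurable borel" for \<psi> t
  proof -
    \<comment> \<open>On the subspace \<open>z \<bullet> \<theta> = 0\<close>, so the exponential is
      constant along the slice and equals \<open>exp (s * t)\<close>.\<close>
    have "(\<integral>z. \<psi> (z + t *\<^sub>R \<theta>) * exp ((s *\<^sub>R \<theta>) \<bullet> (z + t *\<^sub>R \<theta>)) \<partial>perp_measure \<theta>)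
        = (\<integral>z. \<psi> (z + t *\<^sub>R \<theta>) * exp (s * t) \<partial>perp_measure \<theta>)"
      using AE_V by (intro integral_cong_AE) (auto simp: inner_add_right inner_unit[OF \<theta>] inner_commute)
    then show ?thesis using c(1) by (simp add: c(2))
  qed
  have m: "\<psi>1 \<in> borel_measurable borel" "\<psi>2 \<in> borel_measurable borel" using 1(1) 2(1) by auto
  have "integrable lborel (\<lambda>y. \<psi>1 y * exp ((s *\<^sub>R \<theta>) \<bullet> y))" "integrable lborel (\<lambda>y. \<psi>2 y * exp ((s *\<^sub>R \<theta>) \<bullet> y))"
    by (rule integrable_exp_inner(2)[OF 1] integrable_exp_inner(2)[OF 2]; assumption)+
  note int1 = integral_slices[OF \<theta> n this(1)] and int2 = integral_slices[OF \<theta> n this(2)]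
  have "(\<integral>t. (\<integral>z. \<psi>1 (z + t *\<^sub>R \<theta>) * exp ((s *\<^sub>R \<theta>) \<bullet> (z + t *\<^sub>R \<theta>)) \<partial>perp_measure \<theta>) \<partial>lborel)
      = (\<integral>t. (\<integral>z. \<psi>2 (z + t *\<^sub>R \<theta>) * exp ((s *\<^sub>R \<theta>) \<bullet> (z + t *\<^sub>R \<theta>)) \<partial>perp_measure \<theta>) \<partial>lborel)"
  proof (rule integral_cong_AE)
    show "AE t in lborel. (\<integral>z. \<psi>1 (z + t *\<^sub>R \<theta>) * exp ((s *\<^sub>R \<theta>) \<bullet> (z + t *\<^sub>R \<theta>)) \<partial>perp_measure \<theta>)
      = (\<integral>z. \<psi>2 (z + t *\<^sub>R \<theta>) * exp ((s *\<^sub>R \<theta>) \<bullet> (z + t *\<^sub>R \<theta>)) \<partial>perp_measure \<theta>)"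
      unfolding inner[OF m(1)] inner[OF m(2)] using eq by eventually_elim simp
    show "(\<lambda>t. \<integral>z. \<psi>1 (z + t *\<^sub>R \<theta>) * exp ((s *\<^sub>R \<theta>) \<bullet> (z + t *\<^sub>R \<theta>)) \<partial>perp_measure \<theta>) \<in> borel_measurable lborel"
      using int1(1) by (rule borel_measurable_integrable)
    show "(\<lambda>t. \<integral>z. \<psi>2 (z + t *\<^sub>R \<theta>) * exp ((s *\<^sub>R \<theta>) \<bullet> (z + t *\<^sub>R \<theta>)) \<partial>perp_measure \<theta>) \<in> borel_measurable lborel"
      using int2(1) by (rule borel_measurable_integrable)
  qed
  then show ?thesis using int1(2) int2(2) by argo
qed

text \<open>Projecting an open piece of the sphere to the tangent hyperplane does not increase Hausdorff measure and covers a disc.\<close>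

lemma dense_directions:
  fixes \<theta>0 :: "real^'n"
  assumes \<theta>0: "norm \<theta>0 = 1" and n: "2 \<le> CARD('n)" and e: "0 < e"
    and AE: "AE \<theta> in restrict_space (hausdorff_measure (real CARD('n) - 1)) (sphere 0 1). P \<theta>"
  obtains \<theta> where "norm \<theta> = 1" "P \<theta>" "dist \<theta> \<theta>0 < e"
proof -
  interpret flat_measure "{y. y \<bullet> \<theta>0 = 0}" "CARD('n) - 1" "perp_measure \<theta>0"
    by (rule flat_measure_perp[OF \<theta>0 n])
  have "\<exists>\<theta>. norm \<theta> = 1 \<and> P \<theta> \<and> dist \<theta> \<theta>0 < e"
  proof (rule ccontr)
    assume none: "\<not> ?thesis"
    have "AE \<theta> in hausdorff_measure (real (CARD('n) - 1)). \<theta> \<in> sphere 0 1 \<longrightarrow> P \<theta>"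
      using AE unfolding real_dim[OF \<theta>0 n] by (subst (asm) AE_restrict_space_iff) auto
    then obtain X where X: "{\<theta>. \<not> (\<theta> \<in> sphere 0 1 \<longrightarrow> P \<theta>)} \<subseteq> X" "X \<in> sets borel"
      "emeasure (hausdorff_measure (real (CARD('n) - 1))) X = 0"
      by (auto elim!: AE_E)
    define U where "U = sphere 0 1 \<inter> ball \<theta>0 e"
    have "U \<subseteq> X" using none X(1) by (auto simp: U_def dist_commute)
    then have "H U \<le> H X" by (rule hausdorff_outer_mono)
    then have HU: "H U = 0" using X by (simp add: emeasure_hausdorff)
    \<comment> \<open>With \<open>q = 1 - (norm z)\<^sup>2\<close>, the point of the sphere above
      \<open>z\<close> differs from \<open>\<theta>0\<close> by at most
      \<open>(1 - sqrt q) + norm z\<close>. Since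
      \<open>1 - sqrt q \<le> 1 - q \<le> norm z\<close>, this is at most \<open>2 * d\<close>,
      hence below \<open>e\<close>.\<close>
    define d where "d = min (1/2) (e/3)"
    have d: "0 < d" "d \<le> 1/2" "3 * d \<le> e" using e by (auto simp: d_def)
    have sub: "cball 0 d \<inter> {y. y \<bullet> \<theta>0 = 0} \<subseteq> proj \<theta>0 ` U"
    proof
      fix z assume z: "z \<in> cball 0 d \<inter> {y. y \<bullet> \<theta>0 = 0}"
      define q where "q = 1 - (norm z)\<^sup>2"
      have nz: "norm z \<le> d" using z by simp
      have "(norm z)\<^sup>2 \<le> norm z" using nz d by (simp add: power2_eq_square mult_left_le)
      then have q: "0 \<le> q" "q \<le> 1" "1 - norm z \<le> q" using nz d by (auto simp: q_def)
      have sq: "q \<le> sqrt q" "sqrt q \<le> 1"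
        using q by (auto simp: real_le_rsqrt power2_eq_square mult_left_le)
      define \<theta> where "\<theta> = z + sqrt q *\<^sub>R \<theta>0"
      have z\<theta>: "z \<bullet> \<theta>0 = 0" "\<theta>0 \<bullet> z = 0" using z by (auto simp: inner_commute)
      have "\<theta> \<bullet> \<theta> = 1"
        using q(1) by (simp add: \<theta>_def inner_add_left inner_add_right z\<theta> inner_unit[OF \<theta>0] q_def power2_norm_eq_inner)
      then have "norm \<theta> = 1" by (simp add: norm_eq_1)
      moreover have "dist \<theta>0 \<theta> < e"
      proof -
        have "\<theta>0 - \<theta> = (1 - sqrt q) *\<^sub>R \<theta>0 - z" by (simp add: \<theta>_def algebra_simps)
        then have "dist \<theta>0 \<theta> \<le> norm ((1 - sqrt q) *\<^sub>R \<theta>0) + norm z"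
          unfolding dist_norm by (metis norm_triangle_ineq4)
        also have "\<dots> \<le> 2 * d" using \<theta>0 sq q nz by simp
        finally show ?thesis using d by simp
      qed
      moreover have "proj \<theta>0 \<theta> = z" by (simp add: proj_def \<theta>_def inner_add_left z\<theta> inner_unit[OF \<theta>0])
      ultimately show "z \<in> proj \<theta>0 ` U" by (auto simp: U_def image_iff)
    qed
    have "proj \<theta>0 x - proj \<theta>0 y = proj \<theta>0 (x - y)" for x y
      by (simp add: proj_def inner_diff_left algebra_simps)
    then have "H (proj \<theta>0 ` U) \<le> ennreal (1 powr real (CARD('n) - 1)) * H U"
      using norm_proj_le[OF \<theta>0] by (intro hausdorff_outer_Lipschitz) (auto simp: dist_norm)
    then have "H (cball 0 d \<inter> {y. y \<bullet> \<theta>0 = 0}) = 0"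
      using HU hausdorff_outer_mono[OF sub, of "real (CARD('n) - 1)"] by simp
    then have "emeasure (perp_measure \<theta>0) (cball 0 d) = 0"
      using N_le_hausdorff[of "cball 0 d"] by simp
    moreover have "0 < K * d ^ (CARD('n) - 1)" using K(2) d(1) by simp
    ultimately show False
      using emeasure_cball[of 0 d] d(1) by (auto simp: ennreal_eq_0_iff)
  qed
  then show ?thesis using that by blast
qed

section \<open>Injectivity of the Laplace transform on functions supported in the unit ball\<close>

text \<open>The inductive form lets closure under products and the vanishing of integrals be proved
  by induction on the sum. Products stay inside because exponents add.\<close>

inductive exp_sum :: "('a::euclidean_space \<Rightarrow> real) \<Rightarrow> bool" where
  exp: "exp_sum (\<lambda>y. a * exp (\<xi> \<bullet> y))"
| add: "exp_sum f \<Longrightarrow> exp_sum g \<Longrightarrow> exp_sum (\<lambda>y. f y + g y)"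

lemma exp_sum_mult:
  assumes "exp_sum f" "exp_sum g" shows "exp_sum (\<lambda>y. f y * g y)"
  using assms(1)
proof induction
  case (exp a \<xi>)
  from assms(2) show ?case
  proof induction
    case (exp b \<eta>)
    have "(\<lambda>y. a * exp (\<xi> \<bullet> y) * (b * exp (\<eta> \<bullet> y))) = (\<lambda>y. (a * b) * exp ((\<xi> + \<eta>) \<bullet> y))"
      by (simp add: inner_add_left exp_add mult_ac)
    then show ?case by (simp only: exp_sum.exp)
  next
    case (add f g)
    then show ?case by (simp only: distrib_left exp_sum.add)
  qed
next
  case (add f g)
  then show ?case by (simp only: distrib_right exp_sum.add)
qed

lemma exp_sum_continuous: "exp_sum f \<Longrightarrow> continuous_on S f"
  by (induction rule: exp_sum.induct) (auto intro!: continuous_intros)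

lemma exp_sum_approx:
  fixes g :: "'a::euclidean_space \<Rightarrow> real"
  assumes "continuous_on (cball 0 1) g" "0 < e"
  shows "\<exists>p. exp_sum p \<and> (\<forall>y\<in>cball 0 1. \<bar>g y - p y\<bar> < e)"
proof (rule Stone_Weierstrass_HOL[where P = exp_sum and S = "cball 0 1"])
  show "exp_sum (\<lambda>x :: 'a. c)" for c using exp_sum.exp[of c 0] by simp
  \<comment> \<open>The exponent \<open>x - y\<close> separates the points: its inner products with
    them differ by \<open>|x - y|^2\<close>.\<close>
  show "\<exists>f. exp_sum f \<and> f x \<noteq> f y" if "x \<in> cball 0 1 \<and> y \<in> cball 0 1 \<and> x \<noteq> y" for x y :: 'a
  proof -
    have "(x - y) \<bullet> (x - y) \<noteq> 0" using that by simp
    then have "(x - y) \<bullet> x \<noteq> (x - y) \<bullet> y" by (simp add: inner_diff_right)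
    then show ?thesis using exp_sum.exp[of 1 "x - y"] by (intro exI[of _ "\<lambda>z. exp ((x - y) \<bullet> z)"]) auto
  qed
qed (use assms exp_sum_continuous exp_sum.add exp_sum_mult in auto)

text \<open>The class of \<open>g\<close> for which the integral of \<open>\<phi> * g\<close>
  vanishes grows from exponentials to continuous functions by uniform approximation on the ball
  carrying \<open>\<phi>\<close>, to indicators of closed sets by dominated convergence, and to
  indicators of Borel sets because closed sets form an intersection-stable generator.\<close>

lemma laplace_inj:
  fixes \<phi> :: "'a::euclidean_space \<Rightarrow> real"
  assumes int: "integrable lborel \<phi>" and supp: "\<And>y. y \<notin> cball 0 1 \<Longrightarrow> \<phi> y = 0"
    and zero: "\<And>\<xi>. (\<integral>y. \<phi> y * exp (\<xi> \<bullet> y) \<partial>lborel) = 0"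
  shows "AE y in lborel. \<phi> y = 0"
proof -
  have [measurable]: "\<phi> \<in> borel_measurable borel" using int by auto
  have exp_sum: "integrable lborel (\<lambda>y. \<phi> y * p y) \<and> (\<integral>y. \<phi> y * p y \<partial>lborel) = 0" if "exp_sum p" for p
    using that
  proof induction
    case (exp a \<xi>)
    have "(\<lambda>y. \<phi> y * (a * exp (\<xi> \<bullet> y))) = (\<lambda>y. a * (\<phi> y * exp (\<xi> \<bullet> y)))" by (simp add: mult_ac)
    then show ?case using integrable_exp_inner(2)[OF int supp, of \<xi>] zero[of \<xi>] by simp
  next
    case (add f g) then show ?case by (simp add: distrib_left)
  qed
  have cont: "(\<integral>y. \<phi> y * g y \<partial>lborel) = 0" if g: "continuous_on UNIV g" for g
  proof -
    have [measurable]: "g \<in> borel_measurable borel" using g by (rule borel_measurable_continuous_onI)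
    define M where "M = (\<integral>y. \<bar>\<phi> y\<bar> \<partial>lborel)"
    have M: "0 \<le> M" by (simp add: M_def)
    have bound: "\<bar>\<integral>y. \<phi> y * g y \<partial>lborel\<bar> \<le> e * M" if e: "0 < e" for e
    proof -
      obtain p where p: "exp_sum p" "\<And>y. y \<in> cball 0 1 \<Longrightarrow> \<bar>g y - p y\<bar> < e"
        using exp_sum_approx[OF continuous_on_subset[OF g subset_UNIV] e] by blast
      have [measurable]: "p \<in> borel_measurable borel"
        using exp_sum_continuous[OF p(1)] by (rule borel_measurable_continuous_onI)
      have le: "\<bar>\<phi> y * (g y - p y)\<bar> \<le> e * \<bar>\<phi> y\<bar>" for y
        using p(2)[of y] supp[of y] mult_right_mono[of "\<bar>g y - p y\<bar>" e "\<bar>\<phi> y\<bar>"]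
        by (cases "y \<in> cball 0 1") (auto simp: abs_mult mult.commute)
      have int_d: "integrable lborel (\<lambda>y. \<phi> y * (g y - p y))"
        by (rule Bochner_Integration.integrable_bound[of _ "\<lambda>y. e * \<bar>\<phi> y\<bar>"]) (use int le e in \<open>auto simp: abs_mult\<close>)
      have "(\<integral>y. \<phi> y * g y \<partial>lborel) = (\<integral>y. \<phi> y * (g y - p y) + \<phi> y * p y \<partial>lborel)"
        by (simp add: algebra_simps)
      also have "\<dots> = (\<integral>y. \<phi> y * (g y - p y) \<partial>lborel)"
        using int_d exp_sum[OF p(1)] by simp
      also have "\<bar>\<dots>\<bar> \<le> (\<integral>y. \<bar>\<phi> y * (g y - p y)\<bar> \<partial>lborel)"
        using integral_norm_bound[of lborel "\<lambda>y. \<phi> y * (g y - p y)"] by simp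
      also have "\<dots> \<le> (\<integral>y. e * \<bar>\<phi> y\<bar> \<partial>lborel)"
        using int_d int le by (intro integral_mono) auto
      finally show ?thesis by (simp add: M_def)
    qed
    have "\<bar>\<integral>y. \<phi> y * g y \<partial>lborel\<bar> \<le> 0"
    proof (rule field_le_epsilon)
      fix e :: real assume "0 < e"
      \<comment> \<open>Dividing by \<open>M + 1\<close> also covers the case
        \<open>M = 0\<close>.\<close>
      then have "\<bar>\<integral>y. \<phi> y * g y \<partial>lborel\<bar> \<le> (e / (M + 1)) * M" using M by (intro bound) auto
      also have "\<dots> \<le> e" using M \<open>0 < e\<close> by (simp add: field_simps)
      finally show "\<bar>\<integral>y. \<phi> y * g y \<partial>lborel\<bar> \<le> 0 + e" by simp
    qed
    then show ?thesis by simp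
  qed
  have closed: "(\<integral>y. \<phi> y * indicator F y \<partial>lborel) = 0" if "closed F" for F
  proof (cases "F = {}")
    case False
    \<comment> \<open>Continuous functions between 0 and 1 that converge pointwise to the indicator,
      since \<open>infdist\<close> is positive off a nonempty closed set. For the empty set
      \<open>infdist\<close> is 0 by convention and the limit would be 1.\<close>
    define g where "g k y = max 0 (1 - real k * infdist y F)" for k y
    have gc: "continuous_on UNIV (g k)" for k unfolding g_def by (intro continuous_intros)
    then have [measurable]: "g k \<in> borel_measurable borel" for k by (rule borel_measurable_continuous_onI)
    have g01: "\<bar>g k y\<bar> \<le> 1" for k y using infdist_nonneg[of y F] by (auto simp: g_def)
    have lim: "(\<lambda>k. g k y) \<longlonglongrightarrow> indicator F y" for y
    proof (cases "y \<in> F")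
      case True then show ?thesis by (simp add: g_def)
    next
      case False
      then have "0 < infdist y F" using \<open>closed F\<close> \<open>F \<noteq> {}\<close> by (simp add: infdist_pos_not_in_closed)
      then obtain K where K: "1 < real K * infdist y F" using reals_Archimedean3 by blast
      have "g k y = 0" if "K \<le> k" for k
        using K mult_right_mono[of "real K" "real k" "infdist y F"] that infdist_nonneg[of y F] by (simp add: g_def)
      then have "\<forall>\<^sub>F k in sequentially. g k y = indicator F y"
        using False by (auto simp: eventually_sequentially)
      then show ?thesis by (rule tendsto_eventually)
    qed
    have [measurable]: "F \<in> sets borel" using that by (rule borel_closed)
    have "(\<lambda>k. \<integral>y. \<phi> y * g k y \<partial>lborel) \<longlonglongrightarrow> (\<integral>y. \<phi> y * indicator F y \<partial>lborel)"
    proof (rule integral_dominated_convergence[where w = "\<lambda>y. \<bar>\<phi> y\<bar>"])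
      show "AE y in lborel. (\<lambda>k. \<phi> y * g k y) \<longlonglongrightarrow> \<phi> y * indicator F y"
        by (intro AE_I2 tendsto_mult tendsto_const lim)
      show "AE y in lborel. norm (\<phi> y * g k y) \<le> \<bar>\<phi> y\<bar>" for k
        using g01[of k] by (intro AE_I2) (simp add: abs_mult mult_left_le)
    qed (use int in auto)
    then show ?thesis using cont[OF gc] by (simp add: LIMSEQ_const_iff)
  qed simp
  have borel: "(\<integral>y. \<phi> y * indicator A y \<partial>lborel) = 0" if A: "A \<in> sets borel" for A
  proof -
    have sets: "sets (borel :: 'a measure) = sigma_sets UNIV (Collect closed)"
      by (simp add: borel_eq_closed)
    have int_A: "integrable lborel (\<lambda>y. \<phi> y * indicator B y)" if "B \<in> sets borel" for B
      using integrable_mult_indicator[of B lborel \<phi>] that int by (simp add: mult.commute)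
    have "Int_stable (Collect closed :: 'a set set)" by (auto simp: Int_stable_def)
    moreover have "Collect closed \<subseteq> Pow (UNIV :: 'a set)" by simp
    moreover have "A \<in> sigma_sets UNIV (Collect closed)" using A sets by simp
    ultimately show ?thesis
    proof (induction rule: sigma_sets_induct_disjoint)
      case (basic A) then show ?case using closed by simp
    next
      \<comment> \<open>Complements need the total integral of \<open>\<phi>\<close> to vanish,
        which is the case of the constant function 1.\<close>
      case (compl A)
      then have A: "A \<in> sets borel" using sets by simp
      have "(\<integral>y. \<phi> y * indicator (UNIV - A) y \<partial>lborel) = (\<integral>y. \<phi> y * 1 - \<phi> y * indicator A y \<partial>lborel)"
        by (intro Bochner_Integration.integral_cong) (auto simp: indicator_def)
      also have "\<dots> = (\<integral>y. \<phi> y * 1 \<partial>lborel) - (\<integral>y. \<phi> y * indicator A y \<partial>lborel)"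
        using int int_A[OF A] by (intro Bochner_Integration.integral_diff) auto
      finally show ?case using compl cont[of "\<lambda>_. 1"] by simp
    next
      case (union A)
      have A: "A i \<in> sets lborel" for i using union(2) sets by auto
      have "(LINT y:(\<Union>i. A i)|lborel. \<phi> y) = (\<Sum>i. (LINT y:(A i)|lborel. \<phi> y))"
      proof (rule lebesgue_integral_countable_add)
        show "A i \<inter> A j = {}" if "i \<noteq> j" for i j using union(1) that by (auto simp: disjoint_family_on_def)
        show "set_integrable lborel (\<Union>i. A i) \<phi>"
          unfolding set_integrable_def using A int by (intro integrable_mult_indicator) auto
      qed (rule A)
      then show ?case using union(3) by (simp add: set_lebesgue_integral_def mult.commute)
    qed simp
  qed
  show ?thesis
  proof (rule density_unique_real)
    fix A :: "'a set" assume "A \<in> sets lborel"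
    then show "(LINT y:A|lborel. \<phi> y) = (LINT y:A|lborel. 0)"
      using borel[of A] by (simp add: set_lebesgue_integral_def mult.commute)
  qed (use int in auto)
qed

theorem inv_radon_unique:
  fixes \<psi>1 \<psi>2 :: "real^'n \<Rightarrow> real"
  assumes n: "2 \<le> CARD('n)" and inv: "is_inv_radon \<Phi> \<psi>1" "is_inv_radon \<Phi> \<psi>2"
  shows "AE y in lborel. \<psi>1 y = \<psi>2 y"
proof -
  have 1: "integrable lborel \<psi>1" "\<And>y. y \<notin> cball 0 1 \<Longrightarrow> \<psi>1 y = 0"
    and 2: "integrable lborel \<psi>2" "\<And>y. y \<notin> cball 0 1 \<Longrightarrow> \<psi>2 y = 0"
    using inv unfolding is_inv_radon_def by blast+
  define M where "M = restrict_space (hausdorff_measure (real CARD('n) - 1)) (sphere (0::real^'n) 1)"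
  define P where "P \<theta> \<longleftrightarrow> (AE t in lborel. radon \<psi>1 \<theta> t = radon \<psi>2 \<theta> t)" for \<theta>
  have "AE p in M \<Otimes>\<^sub>M lborel. radon \<psi>1 (fst p) (snd p) = radon \<psi>2 (fst p) (snd p)"
    using inv unfolding is_inv_radon_def sphere_line_def M_def by auto
  \<comment> \<open>The exceptional set is not known to be measurable, so it is enclosed in a null
    set \<open>X\<close> of the product; by Tonelli almost every section of \<open>X\<close> is
    null.\<close>
  then obtain X where X: "{p \<in> space (M \<Otimes>\<^sub>M lborel). radon \<psi>1 (fst p) (snd p) \<noteq> radon \<psi>2 (fst p) (snd p)} \<subseteq> X"
    "X \<in> sets (M \<Otimes>\<^sub>M lborel)" "emeasure (M \<Otimes>\<^sub>M lborel) X = 0"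
    by (auto elim!: AE_E)
  have "(\<integral>\<^sup>+\<theta>. emeasure lborel (Pair \<theta> -` X) \<partial>M) = 0"
    using X by (simp add: lborel.emeasure_pair_measure_alt)
  then have "AE \<theta> in M. emeasure lborel (Pair \<theta> -` X) = 0"
    using X(2) by (subst (asm) nn_integral_0_iff_AE) (auto intro: lborel.measurable_emeasure_Pair)
  then have AE_P: "AE \<theta> in M. P \<theta>"
  proof (rule AE_mp, intro AE_I2 impI)
    fix \<theta> assume \<theta>: "\<theta> \<in> space M" and null: "emeasure lborel (Pair \<theta> -` X) = 0"
    show "P \<theta>" unfolding P_def
    proof (rule AE_I[of _ _ "Pair \<theta> -` X"])
      show "{t \<in> space lborel. radon \<psi>1 \<theta> t \<noteq> radon \<psi>2 \<theta> t} \<subseteq> Pair \<theta> -` X"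
      proof
        fix t assume "t \<in> {t \<in> space lborel. radon \<psi>1 \<theta> t \<noteq> radon \<psi>2 \<theta> t}"
        then have "(\<theta>, t) \<in> {p \<in> space (M \<Otimes>\<^sub>M lborel). radon \<psi>1 (fst p) (snd p) \<noteq> radon \<psi>2 (fst p) (snd p)}"
          using \<theta> by (simp add: space_pair_measure)
        then show "t \<in> Pair \<theta> -` X" using X(1) by blast
      qed
    qed (use null X(2) in \<open>auto intro: sets_Pair1\<close>)
  qed
  have laplace: "(\<integral>y. \<psi>1 y * exp (\<xi> \<bullet> y) \<partial>lborel) = (\<integral>y. \<psi>2 y * exp (\<xi> \<bullet> y) \<partial>lborel)" for \<xi>
  proof -
    define s where "s = norm \<xi>"
    obtain \<theta>0 where \<theta>0: "norm \<theta>0 = 1" "\<xi> = s *\<^sub>R \<theta>0"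
    proof (cases "\<xi> = 0")
      case True
      \<comment> \<open>For \<open>\<xi> = 0\<close> any unit vector serves, since
        \<open>s = 0\<close>.\<close>
      show ?thesis by (rule that[of "axis undefined 1"]) (auto simp: True s_def)
    next
      case False
      then show ?thesis by (intro that[of "sgn \<xi>"]) (auto simp: norm_sgn s_def sgn_div_norm)
    qed
    have "\<exists>\<theta>. norm \<theta> = 1 \<and> P \<theta> \<and> dist \<theta> \<theta>0 < 1 / real (Suc k)" for k
      by (rule dense_directions[OF \<theta>0(1) n _ AE_P[unfolded M_def], of "1 / real (Suc k)"]) auto
    then obtain \<theta> where \<theta>: "\<And>k. norm (\<theta> k) = 1" "\<And>k. P (\<theta> k)" "\<And>k. dist (\<theta> k) \<theta>0 < 1 / real (Suc k)"
      by metis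
    have "(\<lambda>k. dist (\<theta> k) \<theta>0) \<longlonglongrightarrow> 0"
      by (rule tendsto_sandwich[OF _ _ tendsto_const LIMSEQ_Suc[OF lim_1_over_n]])
         (use \<theta>(3) in \<open>auto intro!: always_eventually less_imp_le\<close>)
    then have lim: "\<theta> \<longlonglongrightarrow> \<theta>0" by (rule iffD2[OF tendsto_dist_iff])
    \<comment> \<open>All approximating exponents have norm \<open>s\<close>, so
      \<open>exp s * norm (\<psi> y)\<close> dominates uniformly in \<open>k\<close>.\<close>
    have conv: "(\<lambda>k. \<integral>y. \<psi> y * exp ((s *\<^sub>R \<theta> k) \<bullet> y) \<partial>lborel) \<longlonglongrightarrow> (\<integral>y. \<psi> y * exp (\<xi> \<bullet> y) \<partial>lborel)"
      if \<psi>: "integrable lborel \<psi>" "\<And>y. y \<notin> cball 0 1 \<Longrightarrow> \<psi> y = 0" for \<psi>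
    proof (rule integral_dominated_convergence[where w = "\<lambda>y. exp s * norm (\<psi> y)"])
      have [measurable]: "\<psi> \<in> borel_measurable borel" using \<psi>(1) by auto
      show "(\<lambda>y. \<psi> y * exp (\<xi> \<bullet> y)) \<in> borel_measurable lborel"
        "(\<lambda>y. \<psi> y * exp ((s *\<^sub>R \<theta> k) \<bullet> y)) \<in> borel_measurable lborel" for k by measurable
      show "integrable lborel (\<lambda>y. exp s * norm (\<psi> y))" using \<psi>(1) by auto
      show "AE y in lborel. (\<lambda>k. \<psi> y * exp ((s *\<^sub>R \<theta> k) \<bullet> y)) \<longlonglongrightarrow> \<psi> y * exp (\<xi> \<bullet> y)"
        unfolding \<theta>0(2) by (intro AE_I2 tendsto_intros lim)
      show "AE y in lborel. norm (\<psi> y * exp ((s *\<^sub>R \<theta> k) \<bullet> y)) \<le> exp s * norm (\<psi> y)" for k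
        using integrable_exp_inner(1)[OF \<psi>, of _ "s *\<^sub>R \<theta> k"] \<theta>(1)[of k] by (intro AE_I2) (simp add: s_def)
    qed
    have "(\<integral>y. \<psi>1 y * exp ((s *\<^sub>R \<theta> k) \<bullet> y) \<partial>lborel) = (\<integral>y. \<psi>2 y * exp ((s *\<^sub>R \<theta> k) \<bullet> y) \<partial>lborel)" for k
      using laplace_eq_on_line[OF \<theta>(1)[of k] n 1 2] \<theta>(2)[of k] unfolding P_def by blast
    then show ?thesis using LIMSEQ_unique[OF conv[OF 1]] conv[OF 2] by simp
  qed
  have "AE y in lborel. \<psi>1 y - \<psi>2 y = 0"
  proof (rule laplace_inj)
    show "(\<integral>y. (\<psi>1 y - \<psi>2 y) * exp (\<xi> \<bullet> y) \<partial>lborel) = 0" for \<xi>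
      using integrable_exp_inner(2)[OF 1, of \<xi>] integrable_exp_inner(2)[OF 2, of \<xi>] laplace[of \<xi>]
      by (simp add: left_diff_distrib)
  qed (use 1 2 in auto)
  then show ?thesis by simp
qed

section \<open>The reduction to the Radon transform\<close>

context flat_measure
begin

section \<open>Null spheres and change of variables on the graph\<close>

text \<open>For \<open>q < r\<close> the sphere is disjoint from the ball of radius
  \<open>q\<close>, and both lie in the ball of radius \<open>r\<close>. As \<open>q\<close> tends
  to \<open>r\<close>, the volumes \<open>K * q ^ m\<close> exhaust the finite
  \<open>K * r ^ m\<close> and leave nothing for the sphere.\<close>

lemma N_sphere_null: "0 < r \<Longrightarrow> emeasure N (sphere 0 r) = 0"
proof -
  assume r: "0 < r"
  have le: "emeasure N (sphere 0 r) + ennreal (K * q ^ m) \<le> ennreal (K * r ^ m)" if q: "0 < q" "q < r" for q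
  proof -
    have "emeasure N (sphere 0 r) + emeasure N (cball 0 q) = emeasure N (sphere 0 r \<union> cball 0 q)"
      using q by (intro plus_emeasure) auto
    also have "\<dots> \<le> emeasure N (cball 0 r)" using q by (intro emeasure_mono) auto
    finally show ?thesis using q r subspace_0[OF V] by (simp add: emeasure_cball)
  qed
  have "emeasure N (sphere 0 r) + ennreal (K * r ^ m) \<le> ennreal (K * r ^ m)"
  proof (rule tendsto_upperbound)
    show "((\<lambda>q. emeasure N (sphere 0 r) + ennreal (K * q ^ m)) \<longlongrightarrow> emeasure N (sphere 0 r) + ennreal (K * r ^ m)) (at_left r)"
      by (intro tendsto_add tendsto_const tendsto_ennrealI tendsto_mult tendsto_power tendsto_ident_at)
    show "\<forall>\<^sub>F q in at_left r. emeasure N (sphere 0 r) + ennreal (K * q ^ m) \<le> ennreal (K * r ^ m)"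
      using eventually_at_left_real[OF r] by eventually_elim (auto intro: le)
  qed (simp add: trivial_limit_at_left_real)
  then show ?thesis
    by (cases "emeasure N (sphere 0 r)") (use K(2) r in \<open>auto simp flip: ennreal_plus simp: top_unique ennreal_neg\<close>)
qed

text \<open>This takes care of the equator, which the graph over the open ball leaves out.\<close>

lemma hausdorff_sphere_null:
  assumes "0 < r"
  shows "H (sphere 0 r \<inter> V) = 0"
proof -
  obtain c where "emeasure (hausdorff_measure m) (sphere 0 r \<inter> V) = ennreal c * emeasure N (sphere 0 r)"
    using hausdorff_proportional by (metis borel_closed closed_sphere)
  then show ?thesis using N_sphere_null[OF assms] by (simp add: emeasure_hausdorff)
qed

lemma hausdorff_integrable:
  fixes g :: "'a \<Rightarrow> real"
  assumes [measurable]: "g \<in> borel_measurable borel"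
  shows "integrable (hausdorff_measure m) (\<lambda>x. indicator V x * g x) \<longleftrightarrow> integrable N g"
proof -
  obtain c where c: "0 < c"
    "density (hausdorff_measure m) (\<lambda>x. ennreal (indicator V x)) = density N (\<lambda>_. ennreal c)"
    using hausdorff_density by blast
  have "integrable (hausdorff_measure m) (\<lambda>x. indicator V x * g x)
      \<longleftrightarrow> integrable (density (hausdorff_measure m) (\<lambda>x. ennreal (indicator V x))) g"
    by (subst integrable_density) auto
  also have "\<dots> \<longleftrightarrow> integrable N (\<lambda>x. c * g x)"
    unfolding c(2) using c(1) by (subst integrable_density) auto
  finally show ?thesis using c(1) by simp
qed

text \<open>This is \<open>hausdorff_lift\<close> as a change of variables. Pushing forward by the
  projection loses nothing, because \<open>lift\<close> inverts it on the graph; this is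
  \<open>lift_back\<close>.\<close>

lemma
  fixes F :: "'a \<times> real \<Rightarrow> real" and a :: 'a and \<rho> :: real
  assumes [measurable]: "F \<in> borel_measurable borel"
  defines "D \<equiv> V \<inter> ball 0 \<rho>"
  shows lift_integral: "(\<integral>x. indicator (lift a \<rho> ` D) x * F x \<partial>hausdorff_measure m)
        = (\<integral>z. indicator D z * (\<rho> / height \<rho> z * F (lift a \<rho> z)) \<partial>hausdorff_measure m)"
    and lift_integrable: "integrable (hausdorff_measure m) (\<lambda>x. indicator (lift a \<rho> ` D) x * F x)
      \<longleftrightarrow> integrable (hausdorff_measure m) (\<lambda>z. indicator D z * (\<rho> / height \<rho> z * F (lift a \<rho> z)))"
proof -
  have [measurable]: "D \<in> sets borel" by (simp add: D_def)
  have [measurable]: "lift a \<rho> ` D \<in> sets borel" by (rule lift_image_borel) fact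
  have [measurable]: "(\<lambda>z. F (lift a \<rho> z)) \<in> borel_measurable borel" by measurable
  have s: "ennreal (indicator D z * (\<rho> / height \<rho> z)) = ennreal (\<rho> / height \<rho> z) * indicator D z" for z
    by (auto simp: indicator_def)
  have nonneg: "0 \<le> indicator D z * (\<rho> / height \<rho> z)" for z
  proof (cases "z \<in> D")
    case True
    then have "norm z < \<rho>" by (simp add: D_def)
    moreover then have "0 < \<rho>" using norm_ge_zero[of z] by linarith
    ultimately show ?thesis using height_pos[of z \<rho>] by (simp add: indicator_def)
  qed simp
  have eq: "distr (density (hausdorff_measure m) (\<lambda>x. ennreal (indicator (lift a \<rho> ` D) x))) borel (\<lambda>x. fst x - a)
      = density (hausdorff_measure m) (\<lambda>z. ennreal (indicator D z * (\<rho> / height \<rho> z)))"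
    unfolding D_def using hausdorff_lift[of a \<rho>] by (simp only: s[unfolded D_def] ennreal_indicator)
  have lift_back: "indicator (lift a \<rho> ` D) x * F (lift a \<rho> (fst x - a)) = indicator (lift a \<rho> ` D) x * F x" for x
    by (auto simp: indicator_def lift_def)
  show "(\<integral>x. indicator (lift a \<rho> ` D) x * F x \<partial>hausdorff_measure m)
      = (\<integral>z. indicator D z * (\<rho> / height \<rho> z * F (lift a \<rho> z)) \<partial>hausdorff_measure m)"
    using arg_cong[OF eq, of "\<lambda>M. \<integral>z. F (lift a \<rho> z) \<partial>M"] nonneg
    by (subst (asm) integral_distr, simp, simp, subst (asm) integral_density, simp, simp, simp,
        subst (asm) integral_density, simp, simp, simp) (simp add: lift_back mult.assoc)
  show "integrable (hausdorff_measure m) (\<lambda>x. indicator (lift a \<rho> ` D) x * F x)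
      \<longleftrightarrow> integrable (hausdorff_measure m) (\<lambda>z. indicator D z * (\<rho> / height \<rho> z * F (lift a \<rho> z)))"
    using arg_cong[OF eq, of "\<lambda>M. integrable M (\<lambda>z. F (lift a \<rho> z))"] nonneg
    by (subst (asm) integrable_distr_eq, simp, simp, subst (asm) integrable_density, simp, simp, simp,
        subst (asm) integrable_density, simp, simp, simp) (simp add: lift_back mult.assoc)
qed

text \<open>The pushed-forward measure has a density with respect to Hausdorff measure on
  \<open>V\<close>, so it vanishes on null sets of \<open>N\<close>. This turns almost-everywhere
  statements about the base into ones about the graph.\<close>

lemma hausdorff_lift_null:
  fixes a :: 'a and \<rho> :: real
  assumes [measurable]: "A \<in> sets borel" and null_A: "emeasure N A = 0"
  shows "H {x \<in> lift a \<rho> ` (V \<inter> ball 0 \<rho>). fst x - a \<in> A} = 0"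
proof -
  define D where "D = V \<inter> ball 0 \<rho>"
  have [measurable]: "D \<in> sets borel" by (simp add: D_def)
  have LD [measurable]: "lift a \<rho> ` D \<in> sets borel" by (rule lift_image_borel) fact
  obtain c where "emeasure (hausdorff_measure m) (A \<inter> V) = ennreal c * emeasure N A"
    using hausdorff_proportional assms(1) by blast
  then have null: "A \<inter> V \<in> null_sets (hausdorff_measure m)" using null_A by auto
  have "{x \<in> lift a \<rho> ` D. fst x - a \<in> A} = lift a \<rho> ` D \<inter> (\<lambda>x. fst x - a) -` A" by auto
  moreover have pre: "(\<lambda>x :: 'a \<times> real. fst x - a) -` A \<in> sets borel"
    using measurable_sets_borel[of "\<lambda>x :: 'a \<times> real. fst x - a" borel A] by simp
  ultimately have "H {x \<in> lift a \<rho> ` D. fst x - a \<in> A}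
      = emeasure (distr (density (hausdorff_measure m) (indicator (lift a \<rho> ` D))) borel (\<lambda>x. fst x - a)) A"
    using LD by (simp add: emeasure_distr emeasure_density emeasure_hausdorff flip: indicator_inter_arith)
  also have "\<dots> = (\<integral>\<^sup>+z. ennreal (\<rho> / height \<rho> z) * indicator D z * indicator A z \<partial>hausdorff_measure m)"
    unfolding hausdorff_lift[of a \<rho>, folded D_def] by (subst emeasure_density) auto
  also have "\<dots> \<le> (\<integral>\<^sup>+z. ennreal (\<rho> / height \<rho> z) * indicator (A \<inter> V) z \<partial>hausdorff_measure m)"
    by (intro nn_integral_mono) (auto simp: indicator_def D_def)
  also have "\<dots> = 0" using null by (rule nn_integral_null_set)
  finally show ?thesis by (simp add: D_def)
qed

end

section \<open>Sections of the hemisphere and the inversion formula\<close>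

lemma upper_hemisphere_borel [measurable]: "upper_hemisphere \<in> sets borel"
proof -
  have "closed (upper_hemisphere :: ((real^'n) \<times> real) set)"
    unfolding upper_hemisphere_def by (intro closed_Collect_conj closed_Collect_eq closed_Collect_le continuous_intros)
  then show ?thesis by (rule borel_closed)
qed

lemma tau_sec_borel [measurable]: "tau_sec \<theta> t \<in> sets borel"
proof -
  have "closed (tau_sec \<theta> t)"
    unfolding tau_sec_def by (intro closed_Collect_conj closed_Collect_eq continuous_intros)
  then show ?thesis by (rule borel_closed)
qed

lemma norm_pair_eq_1: "norm x = 1 \<longleftrightarrow> (norm (fst x))\<^sup>2 + (norm (snd x))\<^sup>2 = 1"
  by (cases x) (simp add: norm_Pair)

context
  fixes \<theta> :: "real^'n" and t :: real
  assumes unit: "norm \<theta> = 1"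
begin

lemma norm_shift: "z \<bullet> \<theta> = 0 \<Longrightarrow> (norm (t *\<^sub>R \<theta> + z))\<^sup>2 = t\<^sup>2 + (norm z)\<^sup>2"
  unfolding power2_norm_eq_inner
  by (simp add: inner_add_left inner_add_right inner_commute inner_unit[OF unit] power2_eq_square)

text \<open>By Pythagoras \<open>|t \<theta> + z|^2 = t^2 + |z|^2\<close>, so the equation of the
  unit sphere becomes that of a sphere of radius \<open>sqrt (1 - t\<^sup>2)\<close> over the
  subspace. Points with \<open>snd x = 0\<close> are missing because the ball is open.\<close>

lemma lift_slice:
  assumes t: "\<bar>t\<bar> < 1"
  shows "lift (t *\<^sub>R \<theta>) (sqrt (1 - t\<^sup>2)) ` ({y. y \<bullet> \<theta> = 0} \<inter> ball 0 (sqrt (1 - t\<^sup>2)))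
    = {x \<in> upper_hemisphere \<inter> tau_sec \<theta> t. 0 < snd x}" (is "lift ?a ?\<rho> ` ?D = ?R")
proof (rule equalityI; rule subsetI)
  have t2: "t\<^sup>2 < 1" using t by (simp add: abs_square_less_1)
  fix x assume "x \<in> lift ?a ?\<rho> ` ?D"
  then obtain z where z: "z \<bullet> \<theta> = 0" "norm z < ?\<rho>" and x: "x = lift ?a ?\<rho> z" by auto
  have "(norm (?a + z))\<^sup>2 + (height ?\<rho> z)\<^sup>2 = 1"
    using norm_shift[OF z(1)] height_sq[OF z(2)] t2 by (simp add: power2_norm_eq_inner)
  then show "x \<in> ?R"
    using z height_pos[OF z(2)]
    by (auto simp: x lift_def upper_hemisphere_def tau_sec_def norm_pair_eq_1 inner_add_left inner_unit[OF unit])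
next
  have t2: "t\<^sup>2 < 1" using t by (simp add: abs_square_less_1)
  fix x assume x: "x \<in> ?R"
  define z where "z = fst x - ?a"
  have z: "z \<bullet> \<theta> = 0" using x by (simp add: z_def tau_sec_def inner_diff_left inner_unit[OF unit])
  have s: "0 < snd x" "(norm (fst x))\<^sup>2 + (snd x)\<^sup>2 = 1"
    using x norm_pair_eq_1[of x] by (auto simp: tau_sec_def)
  have "fst x = ?a + z" by (simp add: z_def)
  then have eq: "(snd x)\<^sup>2 = 1 - t\<^sup>2 - (norm z)\<^sup>2" using s(2) norm_shift[OF z] by simp
  then have "(norm z)\<^sup>2 < 1 - t\<^sup>2" using s(1) zero_less_power[of "snd x" 2] by linarith
  then have "norm z < ?\<rho>" by (rule real_less_rsqrt)
  moreover have "height ?\<rho> z = snd x"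
    using eq s(1) t2 by (simp add: height_def flip: eq)
  ultimately show "x \<in> lift ?a ?\<rho> ` ?D"
    using z \<open>fst x = ?a + z\<close> by (intro image_eqI[of _ _ z]) (auto simp: lift_def prod_eq_iff)
qed

end

text \<open>Integrability over \<open>sigma_plus\<close> controls \<open>f\<close> on the hemisphere
  only. Extending by 0 gives a Borel function on the whole space, to which the change of variables
  applies.\<close>

definition hemi_ext :: "((real^'n) \<times> real \<Rightarrow> real) \<Rightarrow> (real^'n) \<times> real \<Rightarrow> real" where
  "hemi_ext f x = indicator upper_hemisphere x * f x"

text \<open>The candidate for the inverse Radon transform: \<open>f / x_{n+1}\<close>, read off in the graph
  coordinates of the hemisphere.\<close>

definition pulled_back :: "((real^'n) \<times> real \<Rightarrow> real) \<Rightarrow> real^'n \<Rightarrow> real" where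
  "pulled_back f y = (if norm y < 1 then hemi_ext f (lift 0 1 y) / height 1 y else 0)"

context
  fixes f :: "(real^'n) \<times> real \<Rightarrow> real"
  assumes n: "2 \<le> CARD('n)" and f: "integrable sigma_plus f"
begin

interpretation full: flat_measure UNIV "CARD('n)" "lborel :: (real^'n) measure"
  by (rule flat_measure_lborel)

lemma hemi_ext_integrable: "integrable (hausdorff_measure (real CARD('n))) (hemi_ext f)"
  using f unfolding sigma_plus_def hemi_ext_def[abs_def] by (subst (asm) integrable_restrict_space) auto

lemma hemi_ext_borel [measurable]: "hemi_ext f \<in> borel_measurable borel"
  using borel_measurable_integrable[OF hemi_ext_integrable] by simp

lemma pulled_back_borel [measurable]: "pulled_back f \<in> borel_measurable borel"
  unfolding pulled_back_def[abs_def] by measurable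

text \<open>For \<open>\<rho> = 1\<close> the density of the area formula is
  \<open>1 / height 1\<close>, exactly the weight in \<open>pulled_back\<close>, so integrability
  passes over without an estimate.\<close>

lemma pulled_back_integrable: "integrable lborel (pulled_back f)"
proof -
  have "integrable (hausdorff_measure (real CARD('n))) (\<lambda>x. indicator (lift 0 1 ` (UNIV \<inter> ball 0 1)) x * hemi_ext f x)"
    using integrable_mult_indicator[OF _ hemi_ext_integrable, of "lift 0 1 ` (UNIV \<inter> ball 0 1)"]
      lift_image_borel[of "ball 0 1 :: (real^'n) set" 0 1] by simp
  then have "integrable (hausdorff_measure (real CARD('n)))
      (\<lambda>z. indicator (UNIV \<inter> ball 0 1) z * (1 / height 1 z * hemi_ext f (lift 0 1 z)))"
    by (subst (asm) full.lift_integrable) simp_all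
  also have "(\<lambda>z. indicator (UNIV \<inter> ball 0 1) z * (1 / height 1 z * hemi_ext f (lift 0 1 z)))
      = (\<lambda>z. indicator UNIV z * pulled_back f z)"
    by (auto simp: fun_eq_iff pulled_back_def indicator_def)
  finally show ?thesis by (subst (asm) full.hausdorff_integrable) simp_all
qed

lemma V_plus_eq:
  assumes unit: "norm \<theta> = 1" and t: "\<bar>t\<bar> < 1"
  shows "V_plus f \<theta> t = sqrt (1 - t\<^sup>2) * radon (pulled_back f) \<theta> t"
proof -
  interpret flat_measure "{y. y \<bullet> \<theta> = 0}" "CARD('n) - 1" "perp_measure \<theta>"
    by (rule flat_measure_perp[OF unit n])
  let ?V = "{y. y \<bullet> \<theta> = 0}"
  define \<rho> where "\<rho> = sqrt (1 - t\<^sup>2)"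
  define a where "a = t *\<^sub>R \<theta>"
  let ?D = "?V \<inter> ball 0 \<rho>"
  let ?R = "upper_hemisphere \<inter> tau_sec \<theta> t"
  have t2: "t\<^sup>2 < 1" using t by (simp add: abs_square_less_1)
  have \<rho>: "0 < \<rho>" "\<rho>\<^sup>2 = 1 - t\<^sup>2" using t2 by (simp_all add: \<rho>_def)
  have LD: "lift a \<rho> ` ?D = {x \<in> ?R. 0 < snd x}"
    unfolding a_def \<rho>_def by (rule lift_slice[OF unit t])
  have [measurable]: "lift a \<rho> ` ?D \<in> sets borel"
    by (rule lift_image_borel) simp
  \<comment> \<open>The rim of the section is contained in an isometric copy of a sphere in the
    hyperplane, which is null; compactness makes that copy a Borel set.\<close>
  have E_null: "AE x in hausdorff_measure (CARD('n) - 1). \<not> (x \<in> ?R \<and> snd x = 0)"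
  proof -
    let ?E = "(\<lambda>z. (a + z, 0::real)) ` (sphere 0 \<rho> \<inter> ?V)"
    have HE: "H ?E = 0"
      using hausdorff_sphere_null[OF \<rho>(1)] hausdorff_outer_isometry[of "real (CARD('n) - 1)" "sphere 0 \<rho> \<inter> ?V" "\<lambda>z. (a + z, 0::real)"]
      by (simp add: dist_Pair_Pair)
    have "compact (sphere 0 \<rho> \<inter> ?V)" using closed_subspace[OF V] by (intro compact_Int_closed compact_sphere)
    then have "compact ?E" by (intro compact_continuous_image continuous_intros)
    then have "?E \<in> sets borel" by (intro borel_closed compact_imp_closed)
    then have "?E \<in> null_sets (hausdorff_measure (CARD('n) - 1))" using HE by (auto simp: emeasure_hausdorff)
    moreover have "{x. x \<in> ?R \<and> snd x = 0} \<subseteq> ?E"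
    proof
      fix x assume x: "x \<in> {x. x \<in> ?R \<and> snd x = 0}"
      define z where "z = fst x - a"
      have z: "z \<bullet> \<theta> = 0" using x by (simp add: z_def a_def tau_sec_def inner_diff_left inner_unit[OF unit])
      have fx: "fst x = t *\<^sub>R \<theta> + z" by (simp add: z_def a_def)
      have "norm x = 1" "snd x = 0" using x by (auto simp: tau_sec_def)
      then have "(norm (fst x))\<^sup>2 = 1" using iffD1[OF norm_pair_eq_1[of x]] by simp
      then have "(norm z)\<^sup>2 = \<rho>\<^sup>2" using norm_shift[OF unit z, of t] by (simp add: fx \<rho>)
      then have "norm z = \<rho>" using \<rho>(1) by (simp add: power2_eq_iff_nonneg)
      then show "x \<in> ?E" using x z by (intro image_eqI[of _ _ z]) (auto simp: fx a_def prod_eq_iff)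
    qed
    ultimately show ?thesis by (intro AE_I'[of ?E]) auto
  qed
  have "V_plus f \<theta> t = (\<integral>x. indicator ?R x * hemi_ext f x \<partial>hausdorff_measure (CARD('n) - 1))"
    unfolding V_plus_def set_lebesgue_integral_def real_dim[OF unit n]
    by (intro Bochner_Integration.integral_cong) (auto simp: hemi_ext_def indicator_def)
  also have "\<dots> = (\<integral>x. indicator (lift a \<rho> ` ?D) x * hemi_ext f x \<partial>hausdorff_measure (CARD('n) - 1))"
  proof (rule integral_cong_AE)
    show "AE x in hausdorff_measure (CARD('n) - 1). indicator ?R x * hemi_ext f x = indicator (lift a \<rho> ` ?D) x * hemi_ext f x"
      using E_null
    proof eventually_elim
      case (elim x)
      have "x \<in> ?R \<Longrightarrow> 0 \<le> snd x" by (simp add: upper_hemisphere_def)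
      then show ?case using elim unfolding LD by (auto simp: indicator_def)
    qed
  qed measurable
  also have "\<dots> = (\<integral>z. indicator ?D z * (\<rho> / height \<rho> z * hemi_ext f (lift a \<rho> z)) \<partial>hausdorff_measure (CARD('n) - 1))"
    by (rule lift_integral) measurable
  \<comment> \<open>On the subspace \<open>1 - |z + t \<theta>|^2 = \<rho>^2 - |z|^2\<close>, so
    both heights agree and \<open>\<rho> / height \<rho> z\<close> splits into the constant
    \<open>\<rho>\<close> and the weight of \<open>pulled_back\<close>.\<close>
  also have "\<dots> = (\<integral>z. \<rho> * (indicator ?V z * pulled_back f (z + t *\<^sub>R \<theta>)) \<partial>hausdorff_measure (CARD('n) - 1))"
  proof (intro Bochner_Integration.integral_cong refl)
    fix z
    show "indicator ?D z * (\<rho> / height \<rho> z * hemi_ext f (lift a \<rho> z)) = \<rho> * (indicator ?V z * pulled_back f (z + t *\<^sub>R \<theta>))"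
    proof (cases "z \<bullet> \<theta> = 0")
      case True
      have sq: "(norm (z + t *\<^sub>R \<theta>))\<^sup>2 = t\<^sup>2 + (norm z)\<^sup>2"
        using norm_shift[OF unit True, of t] by (simp add: add.commute)
      have "norm (z + t *\<^sub>R \<theta>) < 1 \<longleftrightarrow> (norm (z + t *\<^sub>R \<theta>))\<^sup>2 < 1"
        using abs_square_less_1[of "norm (z + t *\<^sub>R \<theta>)"] by simp
      also have "\<dots> \<longleftrightarrow> (norm z)\<^sup>2 < \<rho>\<^sup>2" unfolding sq \<rho> by auto
      also have "\<dots> \<longleftrightarrow> norm z < \<rho>" using \<rho>(1) abs_le_square_iff[of \<rho> "norm z"] by (simp add: not_le flip: not_less) 
      finally have iff: "norm (z + t *\<^sub>R \<theta>) < 1 \<longleftrightarrow> norm z < \<rho>" .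
      have "height 1 (z + t *\<^sub>R \<theta>) = height \<rho> z" by (simp add: height_def sq \<rho>)
      moreover then have "lift 0 1 (z + t *\<^sub>R \<theta>) = lift a \<rho> z" by (simp add: lift_def a_def add.commute)
      ultimately show ?thesis using True iff by (simp add: pulled_back_def indicator_def)
    qed (simp add: indicator_def)
  qed
  also have "\<dots> = \<rho> * radon (pulled_back f) \<theta> t"
    unfolding radon_shift[OF unit n pulled_back_borel] by simp
  finally show ?thesis by (simp add: \<rho>_def)
qed

lemma Phi_of_eq_radon:
  assumes unit: "norm \<theta> = 1"
  shows "Phi_of f \<theta> t = radon (pulled_back f) \<theta> t"
proof (cases "\<bar>t\<bar> < 1")
  case True
  then have "t\<^sup>2 < 1" by (simp add: abs_square_less_1)
  then have "(1 - t\<^sup>2) powr (-1/2) = 1 / sqrt (1 - t\<^sup>2)" "0 < sqrt (1 - t\<^sup>2)"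
    using powr_minus[of "1 - t\<^sup>2" "1/2"] by (simp_all add: powr_half_sqrt inverse_eq_divide)
  then show ?thesis using True V_plus_eq[OF unit True] by (simp add: Phi_of_def)
next
  case False
  \<comment> \<open>A hyperplane at distance at least 1 from the origin misses the open ball,
    outside which \<open>pulled_back\<close> is 0.\<close>
  have zero: "indicator {y. y \<bullet> \<theta> = 0} z * pulled_back f (z + t *\<^sub>R \<theta>) = 0" for z
  proof (cases "z \<bullet> \<theta> = 0")
    case True
    have "1 \<le> t\<^sup>2" using False abs_square_less_1[of t] by linarith
    also have "\<dots> \<le> (norm (z + t *\<^sub>R \<theta>))\<^sup>2"
      using norm_shift[OF unit True, of t] by (simp add: add.commute)
    finally have "\<not> norm (z + t *\<^sub>R \<theta>) < 1"
      using abs_square_less_1[of "norm (z + t *\<^sub>R \<theta>)"] by simp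
    then show ?thesis by (simp add: pulled_back_def)
  qed simp
  then show ?thesis
    using False unfolding Phi_of_def radon_shift[OF unit n pulled_back_borel] zero by simp
qed

lemma is_inv_radon_pulled_back: "is_inv_radon (Phi_of f) (pulled_back f)"
proof -
  have "AE p in sphere_line. Phi_of f (fst p) (snd p) = radon (pulled_back f) (fst p) (snd p)"
    by (intro AE_I2) (auto simp: sphere_line_def space_pair_measure space_restrict_space intro: Phi_of_eq_radon)
  then show ?thesis
    using pulled_back_integrable by (auto simp: is_inv_radon_def pulled_back_def)
qed

text \<open>An inverse Radon transform is determined up to null sets only, hence the hypothesis on
  \<open>\<psi>\<close>. The points over the exceptional set are null by
  \<open>hausdorff_lift_null\<close>, and every point of the hemisphere off the equator is
  \<open>lift 0 1\<close> of its projection.\<close>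

lemma AE_sigma_plus:
  fixes \<psi> :: "real^'n \<Rightarrow> real"
  assumes int: "integrable lborel \<psi>" and eq: "AE y in lborel. \<psi> y = pulled_back f y"
  shows "AE x in sigma_plus. f x = snd x * \<psi> (fst x)"
proof -
  have [measurable]: "\<psi> \<in> borel_measurable borel" using int by auto
  let ?H = "hausdorff_measure (real CARD('n)) :: ((real^'n) \<times> real) measure"
  define B where "B = {y. \<psi> y \<noteq> pulled_back f y}"
  have B [measurable]: "B \<in> sets borel" unfolding B_def by measurable
  have "emeasure lborel B = 0"
    using eq B by (subst (asm) AE_iff_measurable[of B]) (auto simp: B_def)
  then have HX: "hausdorff_outer CARD('n) {x \<in> lift 0 1 ` (UNIV \<inter> ball 0 1). fst x - (0::real^'n) \<in> B} = 0"
    by (rule full.hausdorff_lift_null[OF B])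
  define X where "X = {x \<in> lift 0 1 ` ball 0 1. fst x \<in> B}"
  have "X = lift 0 1 ` (ball 0 1 \<inter> B)" by (auto simp: X_def lift_def)
  then have "X \<in> sets borel" using lift_image_borel[of "ball 0 1 \<inter> B" 0 1] by simp
  then have X: "X \<in> null_sets ?H" using HX by (auto simp: emeasure_hausdorff X_def)
  \<comment> \<open>On the equator \<open>snd x = 0\<close>, so the formula would force
    \<open>f x = 0\<close> there; it has to be removed as a null set.\<close>
  define E where "E = (\<lambda>y. (y, 0::real)) ` sphere (0::real^'n) 1"
  have "compact E" unfolding E_def by (intro compact_continuous_image continuous_intros compact_sphere)
  moreover have "hausdorff_outer CARD('n) E = 0"
    using full.hausdorff_sphere_null[of 1] hausdorff_outer_isometry[of "real CARD('n)" "sphere (0::real^'n) 1" "\<lambda>y. (y, 0::real)"]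
    by (simp add: E_def dist_Pair_Pair)
  ultimately have E: "E \<in> null_sets ?H"
    by (auto simp: emeasure_hausdorff compact_imp_closed)
  have "AE x in ?H. x \<in> upper_hemisphere \<longrightarrow> f x = snd x * \<psi> (fst x)"
    using AE_not_in[OF X] AE_not_in[OF E]
  proof eventually_elim
    case (elim x)
    show ?case
    proof
      assume x: "x \<in> upper_hemisphere"
      then have nx: "(norm (fst x))\<^sup>2 + (snd x)\<^sup>2 = 1" "0 \<le> snd x"
        using norm_pair_eq_1[of x] by (auto simp: upper_hemisphere_def)
      have "snd x \<noteq> 0"
      proof
        assume "snd x = 0"
        then have "x \<in> E" using nx(1) abs_square_eq_1[of "norm (fst x)"] unfolding E_def
          by (intro image_eqI[of _ _ "fst x"]) (auto simp: prod_eq_iff)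
        then show False using elim by simp
      qed
      then have pos: "0 < snd x" using nx(2) by simp
      then have "(norm (fst x))\<^sup>2 < 1" using nx(1) zero_less_power[of "snd x" 2] by linarith
      then have lt: "norm (fst x) < 1" using abs_square_less_1[of "norm (fst x)"] by simp
      have "1 - (norm (fst x))\<^sup>2 = (snd x)\<^sup>2" using nx(1) by simp
      then have h: "height 1 (fst x) = snd x" using pos by (simp add: height_def)
      then have lx: "lift 0 1 (fst x) = x" by (simp add: lift_def)
      then have "x \<in> lift 0 1 ` ball 0 1" using lt by (intro image_eqI[of _ _ "fst x"]) auto
      then have "fst x \<notin> B" using elim by (simp add: X_def)
      then show "f x = snd x * \<psi> (fst x)"
        using lt pos x by (simp add: B_def pulled_back_def hemi_ext_def h lx)
    qed
  qed
  then show ?thesis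
    unfolding sigma_plus_def by (subst AE_restrict_space_iff) auto
qed

end

theorem theorem2p1:
  fixes f :: "(real^'n) \<times> real \<Rightarrow> real"
  assumes "CARD('n) \<ge> 2"
    and "integrable sigma_plus f"
  shows "(\<exists>\<psi>. is_inv_radon (Phi_of f) \<psi>)
       \<and> (\<forall>\<psi>1 \<psi>2. is_inv_radon (Phi_of f) \<psi>1 \<longrightarrow> is_inv_radon (Phi_of f) \<psi>2 \<longrightarrow>
              (AE y in lborel. \<psi>1 y = \<psi>2 y))
       \<and> (\<forall>\<psi>. is_inv_radon (Phi_of f) \<psi> \<longrightarrow>
              (AE x in sigma_plus. f x = snd x * \<psi> (fst x)))"
proof (intro conjI allI impI)
  show "\<exists>\<psi>. is_inv_radon (Phi_of f) \<psi>"
    using is_inv_radon_pulled_back[OF assms] by blast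
  show "AE y in lborel. \<psi>1 y = \<psi>2 y"
    if "is_inv_radon (Phi_of f) \<psi>1" "is_inv_radon (Phi_of f) \<psi>2" for \<psi>1 \<psi>2
    using inv_radon_unique[OF assms(1) that] .
  show "AE x in sigma_plus. f x = snd x * \<psi> (fst x)" if "is_inv_radon (Phi_of f) \<psi>" for \<psi>
  proof (rule AE_sigma_plus[OF assms])
    show "integrable lborel \<psi>" using that by (simp add: is_inv_radon_def)
    show "AE y in lborel. \<psi> y = pulled_back f y"
      by (rule inv_radon_unique[OF assms(1) that is_inv_radon_pulled_back[OF assms]])
  qed
qed

end
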